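(* Let $\eta_0=0.756\ldots$ be the unique real root of $e\log\eta+\eta=0$. Then for any $\alpha>1+\eta_0$ we have $$\Psi_d\bigl(\alpha\,((d-1)!)^{\frac1{d-1}}\bigr)\to0\qquad\text{as } d\to\infty,$$ in fact with an exponential rate; that is, there exist constants $C>0$ and $0<c<1$ (depending on $\alpha$) such that $\Psi_d\bigl(\alpha\,((d-1)!)^{1/(d-1)}\bigr)\leq C c^d$ for all integers $d\geq3$.
   Context: For an integer $d\geq3$, $\Psi_d:\mathbb{R}_{\geq0}\to\mathbb{R}_{\geq0}$ is the tail function of the limit distribution of normalized Frobenius numbers. Let $\widehat{\mathbb{N}}^d$ be the set of vectors $\boldsymbol a=(a_1,\ldots,a_d)$ with positive integer coefficients whose greatest common divisor is $1$, let $g(\boldsymbol a)$ be the largest integer not representable as a non-negative integer linear combination of $a_1,\ldots,a_d$, and let $f(\boldsymbol a)=g(\boldsymbol a)+a_1+\cdots+a_d$. By a theorem of Marklof there is a unique continuous non-increasing function $\Psi_d$ with $\Psi_d(0)=1$ such that for every bounded set $\mathcal D\subset\mathbb{R}_{\geq0}^d$ with nonempty interior and boundary of Lebesgue measure zero and every $R\geq0$, $$\lim_{T\to\infty}\frac{\#\{\boldsymbol a\in\widehat{\mathbb{N}}^d\cap T\mathcal D : f(\boldsymbol a)/(a_1\cdots a_d)^{1/(d-1)}>R\}}{\#(\widehat{\mathbb{N}}^d\cap T\mathcal D)}=\Psi_d(R).$$ Equivalently (also by Marklof), $\Psi_d$ is given explicitly by $$\Psi_d(R)=\mu_{d-1}\bigl(\{L\in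 X_{d-1} : \rho(L)>R\}\bigr),$$ where $X_{n}$ is the set of all lattices $L\subset\mathbb{R}^{n}$ of covolume one, identified with $\mathrm{SL}(n,\mathbb{Z})\backslash\mathrm{SL}(n,\mathbb{R})$ via $M\mapsto\mathbb{Z}^nM$; $\mu_n$ is the $\mathrm{SL}(n,\mathbb{R})$-invariant probability measure on $X_n$; $\Delta=\{\boldsymbol x\in\mathbb{R}_{\geq0}^{d-1} : x_1+\cdots+x_{d-1}\leq1\}$; and $\rho(L)=\inf\{\rho>0 : L+\rho\Delta=\mathbb{R}^{d-1}\}$. *)

theory Defs
  imports "HOL-Analysis.Analysis"
begin

text \<open>
  The dimension \<open>d\<close> is a bound variable of the main statement, so \<open>d\<close>-dimensional vectors are
  functions on the index set \<open>{..<d}\<close> that are extensional (undefined outside \<open>{..<d}\<close>).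
  Coordinates are numbered \<open>0, \<dots>, d - 1\<close>.
\<close>

definition primitive_vectors :: "nat \<Rightarrow> (nat \<Rightarrow> nat) set" where
  "primitive_vectors d = {a \<in> {..<d} \<rightarrow>\<^sub>E {0<..}. Gcd (a ` {..<d}) = 1}"

definition representable :: "nat \<Rightarrow> (nat \<Rightarrow> nat) \<Rightarrow> int \<Rightarrow> bool" where
  "representable d a m \<longleftrightarrow> (\<exists>x :: nat \<Rightarrow> nat. m = int (\<Sum>i<d. x i * a i))"

text \<open>
  The maximum ranges over all integers, negative ones included: if some \<open>a i\<close> is 1, every
  natural number is representable and the Frobenius number is \<open>-1\<close>.
\<close>

definition frobenius_number :: "nat \<Rightarrow> (nat \<Rightarrow> nat) \<Rightarrow> int" where
  "frobenius_number d a = (GREATEST m. \<not> representable d a m)"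

definition frobenius_pos :: "nat \<Rightarrow> (nat \<Rightarrow> nat) \<Rightarrow> int" where
  "frobenius_pos d a = frobenius_number d a + int (\<Sum>i<d. a i)"

definition normalized_frobenius :: "nat \<Rightarrow> (nat \<Rightarrow> nat) \<Rightarrow> real" where
  "normalized_frobenius d a =
     real_of_int (frobenius_pos d a) / (\<Prod>i<d. real (a i)) powr (1 / (real d - 1))"

abbreviation Rd_topology :: "nat \<Rightarrow> (nat \<Rightarrow> real) topology" where
  "Rd_topology d \<equiv> product_topology (\<lambda>_. euclideanreal) {..<d}"

abbreviation Rd_lebesgue :: "nat \<Rightarrow> (nat \<Rightarrow> real) measure" where
  "Rd_lebesgue d \<equiv> \<Pi>\<^sub>M i\<in>{..<d}. lborel"

text \<open>
  A frontier is closed, hence Borel, so the Borel version of Lebesgue measure suffices to say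
  that it has measure zero.
\<close>

definition admissible_domain :: "nat \<Rightarrow> (nat \<Rightarrow> real) set \<Rightarrow> bool" where
  "admissible_domain d D \<longleftrightarrow>
     D \<subseteq> ({..<d} \<rightarrow>\<^sub>E {0..}) \<and>
     (\<exists>B. \<forall>x\<in>D. \<forall>i<d. \<bar>x i\<bar> \<le> B) \<and>
     Rd_topology d interior_of D \<noteq> {} \<and>
     Rd_topology d frontier_of D \<in> null_sets (Rd_lebesgue d)"

definition primitive_in_dilate :: "nat \<Rightarrow> (nat \<Rightarrow> real) set \<Rightarrow> real \<Rightarrow> (nat \<Rightarrow> nat) set" where
  "primitive_in_dilate d D T =
     {a \<in> primitive_vectors d.
        (\<lambda>i\<in>{..<d}. real (a i)) \<in> (\<lambda>x. \<lambda>i\<in>{..<d}. T * x i) ` D}"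

text \<open>
  By a theorem of Marklof, for every \<open>d \<ge> 3\<close> a function \<open>\<psi>\<close> with the following property exists;
  the property determines its values on \<open>[0, \<infinity>)\<close>, and the values at negative arguments are
  irrelevant.
\<close>

definition frobenius_limit_tail :: "nat \<Rightarrow> (real \<Rightarrow> real) \<Rightarrow> bool" where
  "frobenius_limit_tail d \<psi> \<longleftrightarrow>
     continuous_on {0..} \<psi> \<and> antimono_on {0..} \<psi> \<and> \<psi> 0 = 1 \<and>
     (\<forall>D R. admissible_domain d D \<longrightarrow> R \<ge> 0 \<longrightarrow>
        ((\<lambda>T. real (card {a \<in> primitive_in_dilate d D T. normalized_frobenius d a > R}) /
               real (card (primitive_in_dilate d D T))) \<longlongrightarrow> \<psi> R) at_top)"

lemma admissible_unit_cube: "admissible_domain d ({..<d} \<rightarrow>\<^sub>E {0..1})"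
proof -
  let ?C = "{..<d} \<rightarrow>\<^sub>E {0..1::real}" and ?O = "{..<d} \<rightarrow>\<^sub>E {0<..<1::real}"
  interpret product_sigma_finite "\<lambda>_::nat. lborel :: real measure" ..
  have int: "Rd_topology d interior_of ?C = ?O"
  proof (rule interior_of_unique)
    show "?O \<subseteq> ?C" by (rule PiE_mono) auto
    show "openin (Rd_topology d) ?O" by (simp add: openin_PiE)
    fix T assume T: "T \<subseteq> ?C" "openin (Rd_topology d) T"
    show "T \<subseteq> ?O"
    proof
      fix x assume "x \<in> T"
      then obtain U where U: "\<And>i. i < d \<Longrightarrow> open (U i)" "x \<in> Pi\<^sub>E {..<d} U" "Pi\<^sub>E {..<d} U \<subseteq> T"
        using T(2) unfolding openin_product_topology_alt by simp (metis lessThan_iff)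
      have "x i \<in> {0<..<1}" if i: "i < d" for i
      proof -
        have "U i \<subseteq> {0..1}"
        proof
          fix y assume "y \<in> U i"
          then have "x(i := y) \<in> Pi\<^sub>E {..<d} U"
            using U(2) i by (auto simp: PiE_iff extensional_def)
          then have "x(i := y) \<in> ?C" using U(3) T(1) by blast
          then show "y \<in> {0..1}" using i by (auto simp: PiE_iff split: if_splits)
        qed
        then have "U i \<subseteq> interior {0..1}" using U(1)[OF i] by (rule interior_maximal)
        then show ?thesis using U(2) i by (auto simp: PiE_iff)
      qed
      then show "x \<in> ?O" using U(2) by (auto simp: PiE_iff)
    qed
  qed
  have "Rd_topology d closure_of ?C = ?C" by (simp add: closure_of_product_topology)
  then have fr: "Rd_topology d frontier_of ?C = ?C - ?O"
    by (simp add: frontier_of_def int)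
  have sets: "?C \<in> sets (Rd_lebesgue d)" "?O \<in> sets (Rd_lebesgue d)"
    by (auto intro!: sets_PiM_I_finite)
  have em: "emeasure (Rd_lebesgue d) ?C = 1" "emeasure (Rd_lebesgue d) ?O = 1"
    by (simp_all add: emeasure_PiM)
  have "emeasure (Rd_lebesgue d) (?C - ?O) = 0"
    using sets em by (subst emeasure_Diff) (auto intro!: PiE_mono)
  with sets have null: "?C - ?O \<in> null_sets (Rd_lebesgue d)" by (auto intro: null_setsI)
  have "(\<lambda>i\<in>{..<d}. 1 / 2) \<in> ?O" by auto
  then have ne: "?O \<noteq> {}" by blast
  have sub: "?C \<subseteq> ({..<d} \<rightarrow>\<^sub>E {0..})" by (rule PiE_mono) auto
  have bdd: "\<exists>B. \<forall>x\<in>?C. \<forall>i<d. \<bar>x i\<bar> \<le> B" by (rule exI[of _ 1]) (auto simp: PiE_iff)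
  show ?thesis
    unfolding admissible_domain_def int fr using sub bdd ne null by blast
qed

lemma frobenius_limit_tail_unique:
  assumes "frobenius_limit_tail d \<psi>" "frobenius_limit_tail d \<phi>" "R \<ge> 0"
  shows "\<psi> R = \<phi> R"
  using assms admissible_unit_cube[of d] unfolding frobenius_limit_tail_def
  by (metis (no_types, lifting) tendsto_unique trivial_limit_at_top_linorder)

text \<open>
  Positivity has to be imposed because \<open>ln\<close> is total; for example \<open>\<eta> = 0\<close> also satisfies the
  equation, as \<open>ln 0 = 0\<close>.
\<close>

definition eta0 :: real where
  "eta0 = (THE \<eta>. \<eta> > 0 \<and> exp 1 * ln \<eta> + \<eta> = 0)"

lemma eta0_ex1: "\<exists>!\<eta>::real. \<eta> > 0 \<and> exp 1 * ln \<eta> + \<eta> = 0"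
  and eta0_bounds: "0.756 < eta0" "eta0 < 0.757"
proof -
  let ?f = "\<lambda>x::real. exp 1 * ln x + x"
  have e: "\<bar>exp 1 - 5837465777 / 2147483648\<bar> \<le> (inverse (2 ^ 32) :: real)"
    by (rule e_approx_32)
  have e': "exp 1 < (2.7182819 :: real)" "exp 1 > (2.7182 :: real)"
    using e[unfolded abs_le_iff] by simp_all
  have less: "?f x < ?f y" if "0 < x" "x < y" for x y
    using that by (intro add_strict_mono mult_strict_left_mono) auto
  have hi: "?f 0.757 > 0"
  proof -
    obtain t :: real where
      "exp 0.27848 = (\<Sum>m<6. 0.27848 ^ m / fact m) + exp t / fact 6 * 0.27848 ^ 6"
      using Maclaurin_exp_le[of "0.27848" 6] by blast
    moreover have "exp t / fact 6 * 0.27848 ^ 6 \<ge> 0" by simp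
    ultimately have "exp (0.27848 :: real) \<ge> (\<Sum>m<6. 0.27848 ^ m / fact m)" by linarith
    then have "exp (0.27848 :: real) \<ge> 1.32110"
      by (simp add: eval_nat_numeral fact_numeral)
    then have "exp (- 0.27848 :: real) \<le> inverse 1.32110"
      unfolding exp_minus by (intro le_imp_inverse_le) auto
    then have "exp (- 0.27848 :: real) < 0.757" by simp
    then have "ln (0.757 :: real) > - 0.27848"
      by (metis exp_gt_zero ln_exp ln_less_cancel_iff less_trans)
    moreover have "exp 1 * (0.27848 :: real) < 0.757"
      using e' by simp
    ultimately show ?thesis
      using mult_strict_left_mono[of "- 0.27848" "ln 0.757" "exp 1 :: real"] by simp
  qed
  have lo: "?f 0.756 < 0"
  proof -
    have "ln (0.756 :: real) < - 0.2785"
    proof -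
      have "exp (- 0.2785 :: real) \<ge> (1 - 0.2785 / 64) ^ 64"
        using exp_ge_one_minus_x_over_n_power_n[of "0.2785" 64] by simp
      then have "exp (- 0.2785 :: real) > 0.756"
        by (simp add: field_simps)
      then have "ln (0.756 :: real) < ln (exp (- 0.2785))"
        by (subst ln_less_cancel_iff) simp_all
      then show ?thesis by simp
    qed
    then have "exp 1 * ln (0.756 :: real) < exp 1 * (- 0.2785)"
      by (intro mult_strict_left_mono) auto
    then show ?thesis using e'(2) by simp
  qed
  have "\<exists>x\<ge>0.756. x \<le> 0.757 \<and> ?f x = 0"
    by (rule IVT') (use lo hi in \<open>auto intro!: continuous_intros\<close>)
  then obtain x where x: "0.756 \<le> x" "x \<le> 0.757" "?f x = 0" by blast
  have x': "0.756 < x" "x < 0.757"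
    using x lo hi by (metis less_irrefl order_le_less)+
  have uniq: "y = x" if "y > 0 \<and> ?f y = 0" for y
    using less[of x y] less[of y x] that x x' by (cases x y rule: linorder_cases) auto
  show "\<exists>!\<eta>::real. \<eta> > 0 \<and> exp 1 * ln \<eta> + \<eta> = 0"
    by (rule ex1I[of _ x]) (use x x' uniq in auto)
  have "eta0 = x"
    unfolding eta0_def by (rule the_equality) (use x x' uniq in auto)
  then show "0.756 < eta0" "eta0 < 0.757" using x' by auto
qed

end

theory Submission
  imports Defs
begin

text \<open>
  Put \<open>n = d - 1\<close> and \<open>N = a\<^sub>d\<close>. By the formula of Brauer and Shockley, \<open>f(a) \<le> M\<close> as soon as every residue
  modulo \<open>N\<close> is of the form \<open>a\<^sub>1 x\<^sub>1 + \<dots> + a\<^sub>n x\<^sub>n\<close> with positive integers \<open>x\<^sub>i\<close> and this sum at most \<open>M\<close>.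
  As the limit does not depend on the domain, we take for it a box so thin and so far from the
  origin in the directions \<open>1, \<dots>, n\<close> that \<open>x\<close> may be taken from the simplex \<open>x\<^sub>1 + \<dots> + x\<^sub>n \<le> B\<close> with
  \<open>B\<close> about \<open>1.7555 (n! N)\<^sup>1\<^sup>/\<^sup>n\<close>, and that \<open>a\<^sub>1, \<dots>, a\<^sub>n\<close> are nearly uniform modulo \<open>N\<close>.

  The covering is done in two steps. Let \<open>S\<close> be the simplex with \<open>|S| \<approx> N V\<close>, \<open>V = 1.0005\<^sup>n\<close>. By
  Fourier inversion the \<open>2k\<close>-th central moment of the number of \<open>x \<in> S\<close> in a given residue class
  counts the tuples of \<open>2k\<close> points of \<open>S\<close> with a linear relation modulo \<open>N\<close> that has no zero
  coefficient. Tuples that coincide in pairs contribute \<open>V\<^sup>k\<close>. All other relations are either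
  divisibility relations, of density at most \<open>2\<^sup>-\<^sup>n\<close>, or rational dependencies with coefficients in
  \<open>{-1, 0, 1}\<close>; the latter are no more frequent than \<open>x + y = z + w\<close>, of density \<open>(3/4)\<^sup>n\<close>, because for
  exponential variables \<open>P(E\<^sub>1 + E\<^sub>2 > E\<^sub>3) = 3/4\<close>. With \<open>k\<close> fixed and large, the proportion of residues
  missed by \<open>S\<close> is thus \<open>O(n\<^sup>2\<^sup>k\<^sup>+\<^sup>3 (3/4)\<^sup>n)\<close> on average. The second moment shows that a simplex with
  about \<open>0.755\<^sup>n N\<close> points meets about as many residues, which is more than are missed by \<open>S\<close>. So the
  sum of both simplices meets every residue, and \<open>1.0005 + 0.755 < 1.756 < 1 + eta0\<close>.
\<close>

section \<open>Relations between points\<close>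

text \<open>Averages over \<open>a\<close> alone cannot show that every residue is met: their bound
  for the missed proportion stays near \<open>(3 / 4) ^ n\<close>, while N tends to infinity for
  fixed n. The second simplex removes this obstacle, because it suffices that the missed proportion
  is below its own density. Any ratio strictly between 3/4 and 1 would give exponential decay; 0.755
  is taken because the sum of the two radii, enlarged by the factor 10001/10000 that the shape of
  the box costs, has to stay below 1.756. The first radius only has to exceed 1: relative to the
  mean, coinciding pairs contribute \<open>1 / V ^ k\<close>, and a large k brings this below
  \<open>(3 / 4) ^ n\<close>. A larger k admits more kinds of relations, so whatever depends on the
  2k points must be bounded by a constant or a power of n, uniformly in B and N; this is why bases
  with bounded coordinates are used. Since n is fixed while T grows, B may be taken larger than any
  given function of n, which makes discretisation errors and torsion of very large order
  negligible.\<close>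

text \<open>The witness \<open>P\<close> selects at most \<open>card I\<close> rows, so that the bounds below do not depend on \<open>card R\<close>.\<close>

definition independent_rows :: "'r set \<Rightarrow> 'i set \<Rightarrow> ('i \<Rightarrow> 'r \<Rightarrow> real) \<Rightarrow> bool" where
  "independent_rows R I v \<longleftrightarrow> (\<exists>P\<subseteq>R. finite P \<and> card P \<le> card I \<and>
     (\<forall>c. (\<forall>\<rho>\<in>P. (\<Sum>i\<in>I. c i * v i \<rho>) = 0) \<longrightarrow> (\<forall>i\<in>I. c i = 0)))"

text \<open>The bound on the coefficients leaves only boundedly many integer parts for each of them.
  This later limits the number of points that a given basis can express, independently of the size
  of the simplex.\<close>

definition bounded_combination ::
    "real \<Rightarrow> 'r set \<Rightarrow> 'i set \<Rightarrow> ('i \<Rightarrow> 'r \<Rightarrow> real) \<Rightarrow> ('r \<Rightarrow> real) \<Rightarrow> bool" where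
  "bounded_combination K R I v w \<longleftrightarrow>
     (\<exists>c. (\<forall>i\<in>I. \<bar>c i\<bar> \<le> K) \<and> (\<forall>\<rho>\<in>R. w \<rho> = (\<Sum>i\<in>I. c i * v i \<rho>)))"

definition bounded_basis ::
    "real \<Rightarrow> 'r set \<Rightarrow> 'i set \<Rightarrow> 'i set \<Rightarrow> ('i \<Rightarrow> 'r \<Rightarrow> real) \<Rightarrow> bool" where
  "bounded_basis K R L I v \<longleftrightarrow>
     I \<subseteq> L \<and> independent_rows R I v \<and> (\<forall>l\<in>L. bounded_combination K R I v (v l))"

lemma bounded_combination_member:
  assumes "finite I" "i \<in> I" "K \<ge> 1"
  shows "bounded_combination K R I v (v i)"
  unfolding bounded_combination_def
proof (intro exI[of _ "\<lambda>j. if j = i then 1 else 0"] conjI ballI)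
  show "v i \<rho> = (\<Sum>j\<in>I. (if j = i then 1 else 0) * v j \<rho>)" for \<rho>
    using assms by (simp add: if_distrib[of "\<lambda>t. t * _"] cong: if_cong)
qed (use assms in auto)

text \<open>In the elimination step the pivot receives the coefficient of \<open>l\<close> reduced
  by a sum of at most j products, each a previous coefficient times a multiplier of absolute value
  at most 1. The factor \<open>Suc j\<close> in place of j makes monotonicity in j evident.\<close>

fun elimination_bound :: "nat \<Rightarrow> nat" where
  "elimination_bound 0 = 1"
| "elimination_bound (Suc j) = 1 + Suc j * elimination_bound j"

text \<open>Gaussian elimination with partial pivoting.\<close>

lemma bounded_basis_exists:
  fixes v :: "'i \<Rightarrow> 'r \<Rightarrow> real"
  assumes "finite L"
  shows "\<exists>I. bounded_basis (elimination_bound (card L)) R L I v"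
  using assms
proof (induction "card L" arbitrary: L v)
  case 0
  then have "L = {}" by simp
  then have "bounded_basis (elimination_bound (card L)) R L {} v"
    unfolding bounded_basis_def independent_rows_def by (auto intro!: exI[of _ "{}"])
  then show ?case by blast
next
  case (Suc j)
  show ?case
  proof (cases "\<forall>l\<in>L. \<forall>\<rho>\<in>R. v l \<rho> = 0")
    case True
    then have "bounded_basis (elimination_bound (card L)) R L {} v"
      unfolding bounded_basis_def independent_rows_def bounded_combination_def
      by (auto intro!: exI[of _ "{}"])
    then show ?thesis by blast
  next
    case False
    then obtain \<rho>0 l0 where l0: "l0 \<in> L" "\<rho>0 \<in> R" "v l0 \<rho>0 \<noteq> 0" by blast
    have fin: "finite ((\<lambda>l. \<bar>v l \<rho>0\<bar>) ` L)" using Suc.prems by simp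
    have "Max ((\<lambda>l. \<bar>v l \<rho>0\<bar>) ` L) \<in> (\<lambda>l. \<bar>v l \<rho>0\<bar>) ` L"
      using l0 by (intro Max_in[OF fin]) auto
    then have "\<exists>p\<in>L. \<forall>l\<in>L. \<bar>v l \<rho>0\<bar> \<le> \<bar>v p \<rho>0\<bar>"
      using Max_ge[OF fin] by fastforce
    then obtain p where p: "p \<in> L" "\<And>l. l \<in> L \<Longrightarrow> \<bar>v l \<rho>0\<bar> \<le> \<bar>v p \<rho>0\<bar>" by blast
    have vp: "v p \<rho>0 \<noteq> 0" using l0 p(2)[OF l0(1)] by auto
    define \<mu> where "\<mu> l = v l \<rho>0 / v p \<rho>0" for l
    have \<mu>1: "\<bar>\<mu> l\<bar> \<le> 1" if "l \<in> L" for l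
      using p(2)[OF that] vp unfolding \<mu>_def by (simp add: abs_divide divide_le_eq_1)
    define v' where "v' l \<rho> = v l \<rho> - \<mu> l * v p \<rho>" for l \<rho>
    have v'0: "v' l \<rho>0 = 0" for l using vp by (simp add: v'_def \<mu>_def)
    have cL: "card (L - {p}) = j" using Suc p(1) by simp
    from Suc.hyps(1)[of "L - {p}" v'] cL Suc.prems
    obtain I where I: "bounded_basis (elimination_bound j) R (L - {p}) I v'" by auto
    let ?K = "real (elimination_bound j)"
    have IL: "I \<subseteq> L - {p}" using I by (auto simp: bounded_basis_def)
    have finI: "finite I" and pI: "p \<notin> I" using IL Suc.prems finite_subset by blast+
    have cI: "card I \<le> j" using IL cL Suc.prems card_mono[of "L - {p}" I] by simp
    obtain P where P: "P \<subseteq> R" "finite P" "card P \<le> card I"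
      "\<And>c. (\<forall>\<rho>\<in>P. (\<Sum>i\<in>I. c i * v' i \<rho>) = 0) \<Longrightarrow> (\<forall>i\<in>I. c i = 0)"
      using I unfolding bounded_basis_def independent_rows_def by blast
    \<comment> \<open>Writing \<open>v i\<close> as \<open>v' i + \<mu> i * v p\<close> moves all
      corrections into the coefficient of the pivot. The same identity serves for independence and
      for spanning.\<close>
    have sum_split: "(\<Sum>i\<in>insert p I. c i * v i \<rho>) =
        (\<Sum>i\<in>I. c i * v' i \<rho>) + (c p + (\<Sum>i\<in>I. c i * \<mu> i)) * v p \<rho>" for c \<rho>
      using finI pI by (simp add: v'_def algebra_simps sum.distrib sum_distrib_left sum_distrib_right sum_subtractf)
    have "independent_rows R (insert p I) v"
      unfolding independent_rows_def
    proof (intro exI[of _ "insert \<rho>0 P"] conjI allI impI)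
      show "card (insert \<rho>0 P) \<le> card (insert p I)"
        using P finI pI by (simp add: card_insert_if)
      fix c assume c: "\<forall>\<rho>\<in>insert \<rho>0 P. (\<Sum>i\<in>insert p I. c i * v i \<rho>) = 0"
      then have "(\<Sum>i\<in>insert p I. c i * v i \<rho>0) = 0" by simp
      then have z: "c p + (\<Sum>i\<in>I. c i * \<mu> i) = 0"
        unfolding sum_split using vp by (simp add: v'0)
      have "\<forall>\<rho>\<in>P. (\<Sum>i\<in>I. c i * v' i \<rho>) = 0"
        using c unfolding sum_split z by simp
      then have ci: "\<forall>i\<in>I. c i = 0" by (rule P(4))
      then have "(\<Sum>i\<in>I. c i * \<mu> i) = 0" by (intro sum.neutral) auto
      with z ci show "\<forall>i\<in>insert p I. c i = 0" by auto
    qed (use P l0 in auto)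
    moreover have "bounded_combination (elimination_bound (Suc j)) R (insert p I) v (v l)"
      if l: "l \<in> L" for l
    proof (cases "l = p")
      case True
      show ?thesis unfolding True
        by (rule bounded_combination_member) (use finI in auto)
    next
      case False
      then obtain c where c: "\<And>i. i \<in> I \<Longrightarrow> \<bar>c i\<bar> \<le> ?K"
        "\<And>\<rho>. \<rho> \<in> R \<Longrightarrow> v' l \<rho> = (\<Sum>i\<in>I. c i * v' i \<rho>)"
        using I l unfolding bounded_basis_def bounded_combination_def by blast
      define c' where "c' i = (if i = p then \<mu> l - (\<Sum>i\<in>I. c i * \<mu> i) else c i)" for i
      have "\<bar>c' i\<bar> \<le> elimination_bound (Suc j)" if "i \<in> insert p I" for i
      proof (cases "i = p")
        case True
        have "\<bar>\<Sum>i\<in>I. c i * \<mu> i\<bar> \<le> (\<Sum>i\<in>I. ?K * 1)"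
          by (rule order_trans[OF sum_abs], rule sum_mono, unfold abs_mult)
             (rule mult_mono, use c \<mu>1 IL in auto)
        also have "\<dots> \<le> real j * ?K" using cI by (simp add: mult_right_mono)
        finally have "\<bar>c' i\<bar> \<le> 1 + real j * ?K"
          using \<mu>1[OF l] True by (simp add: c'_def abs_if split: if_splits)
        then show ?thesis by (simp add: algebra_simps)
      next
        case False
        then have "\<bar>c' i\<bar> \<le> ?K" using c that by (auto simp: c'_def)
        also have "\<dots> \<le> elimination_bound (Suc j)" by simp
        finally show ?thesis .
      qed
      moreover have "v l \<rho> = (\<Sum>i\<in>insert p I. c' i * v i \<rho>)" if "\<rho> \<in> R" for \<rho>
      proof -
        have "(\<Sum>i\<in>I. c' i * v' i \<rho>) = (\<Sum>i\<in>I. c i * v' i \<rho>)"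
             "(\<Sum>i\<in>I. c' i * \<mu> i) = (\<Sum>i\<in>I. c i * \<mu> i)"
          using pI by (auto simp: c'_def intro!: sum.cong)
        then show ?thesis
          unfolding sum_split using c(2)[OF that] by (simp add: c'_def v'_def)
      qed
      ultimately show ?thesis unfolding bounded_combination_def by blast
    qed
    ultimately have "bounded_basis (elimination_bound (card L)) R L (insert p I) v"
      unfolding bounded_basis_def using IL p(1) Suc.hyps(2) by auto
    then show ?thesis by blast
  qed
qed

text \<open>For linearly independent integer vectors \<open>v i\<close> this is a set of
  representatives, with coefficients reduced to [0, 1), of a finite group: the integer vectors in
  the real span of the \<open>v i\<close> modulo the lattice generated by them.\<close>

definition fractional_relations :: "'r set \<Rightarrow> 'i set \<Rightarrow> ('i \<Rightarrow> 'r \<Rightarrow> real) \<Rightarrow> ('i \<Rightarrow> real) set" where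
  "fractional_relations R I v =
     {c \<in> I \<rightarrow>\<^sub>E {0..<1}. \<forall>\<rho>\<in>R. (\<Sum>i\<in>I. c i * v i \<rho>) \<in> \<int>}"

definition modular_relations ::
    "nat \<Rightarrow> 'r set \<Rightarrow> 'i set \<Rightarrow> ('i \<Rightarrow> 'r \<Rightarrow> real) \<Rightarrow> ('i \<Rightarrow> nat) set" where
  "modular_relations N R I v =
     {c \<in> I \<rightarrow>\<^sub>E {..<N}. \<forall>\<rho>\<in>R. (\<Sum>i\<in>I. real (c i) * v i \<rho>) / real N \<in> \<int>}"

lemma zero_fractional_relation: "(\<lambda>i\<in>I. 0) \<in> fractional_relations R I v"
  unfolding fractional_relations_def by (auto simp: sum.neutral)

lemma frac_fractional_relation:
  assumes "\<And>i \<rho>. i \<in> I \<Longrightarrow> \<rho> \<in> R \<Longrightarrow> v i \<rho> \<in> \<int>"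
    and "\<And>\<rho>. \<rho> \<in> R \<Longrightarrow> (\<Sum>i\<in>I. c i * v i \<rho>) \<in> \<int>"
  shows "(\<lambda>i\<in>I. frac (c i)) \<in> fractional_relations R I v"
proof -
  have "(\<Sum>i\<in>I. frac (c i) * v i \<rho>) \<in> \<int>" if \<rho>: "\<rho> \<in> R" for \<rho>
  proof -
    have "(\<Sum>i\<in>I. frac (c i) * v i \<rho>) = (\<Sum>i\<in>I. c i * v i \<rho>) - (\<Sum>i\<in>I. of_int \<lfloor>c i\<rfloor> * v i \<rho>)"
      by (simp add: frac_def algebra_simps sum_subtractf)
    also have "\<dots> \<in> \<int>"
      using assms \<rho> by (intro Ints_diff[OF assms(2)] Ints_sum Ints_mult) auto
    finally show ?thesis .
  qed
  then show ?thesis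
    unfolding fractional_relations_def by (auto simp: frac_lt_1)
qed

text \<open>On the at most \<open>card I\<close> rows that witness independence, the sums are
  integers between 0 and \<open>card I * B\<close>, and these integers determine the
  coefficients.\<close>

lemma fractional_relations_card:
  fixes v :: "'i \<Rightarrow> 'r \<Rightarrow> real"
  assumes "finite I" "independent_rows R I v"
    and "\<And>i \<rho>. i \<in> I \<Longrightarrow> \<rho> \<in> R \<Longrightarrow> 0 \<le> v i \<rho> \<and> v i \<rho> \<le> real B"
  shows "finite (fractional_relations R I v)"
    and "card (fractional_relations R I v) \<le> (card I * B + 1) ^ card I"
proof -
  let ?H = "fractional_relations R I v"
  obtain P where P: "P \<subseteq> R" "finite P" "card P \<le> card I"
      "\<And>c. (\<forall>\<rho>\<in>P. (\<Sum>i\<in>I. c i * v i \<rho>) = 0) \<Longrightarrow> (\<forall>i\<in>I. c i = 0)"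
    using assms unfolding independent_rows_def by blast
  define f where "f c = (\<lambda>\<rho>\<in>P. \<lfloor>\<Sum>i\<in>I. c i * v i \<rho>\<rfloor>)" for c
  have val: "of_int (f c \<rho>) = (\<Sum>i\<in>I. c i * v i \<rho>)" if "c \<in> ?H" "\<rho> \<in> P" for c \<rho>
  proof -
    have "(\<Sum>i\<in>I. c i * v i \<rho>) \<in> \<int>" using that P(1) unfolding fractional_relations_def by blast
    then obtain z where "(\<Sum>i\<in>I. c i * v i \<rho>) = of_int z" by (rule Ints_cases)
    then show ?thesis using that(2) by (simp add: f_def)
  qed
  have inj: "inj_on f ?H"
  proof (rule inj_onI)
    fix c c' assume c: "c \<in> ?H" "c' \<in> ?H" "f c = f c'"
    have "\<forall>\<rho>\<in>P. (\<Sum>i\<in>I. (c i - c' i) * v i \<rho>) = 0"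
    proof
      fix \<rho> assume "\<rho> \<in> P"
      then have "(\<Sum>i\<in>I. c i * v i \<rho>) = (\<Sum>i\<in>I. c' i * v i \<rho>)"
        using val[OF c(1)] val[OF c(2)] c(3) by metis
      then show "(\<Sum>i\<in>I. (c i - c' i) * v i \<rho>) = 0" by (simp add: algebra_simps sum_subtractf)
    qed
    then have "\<forall>i\<in>I. c i - c' i = 0" by (rule P(4))
    then show "c = c'"
      using c(1,2) unfolding fractional_relations_def
      by (intro extensionalityI[of _ I]) (auto simp: PiE_def)
  qed
  have sub: "f ` ?H \<subseteq> P \<rightarrow>\<^sub>E {0..int (card I * B)}"
  proof
    fix g assume "g \<in> f ` ?H"
    then obtain c where c: "c \<in> ?H" "g = f c" by blast
    have cb: "0 \<le> c i \<and> c i \<le> 1" if "i \<in> I" for i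
      using c(1) that unfolding fractional_relations_def by (force simp: PiE_iff)
    have "0 \<le> f c \<rho> \<and> f c \<rho> \<le> int (card I * B)" if \<rho>: "\<rho> \<in> P" for \<rho>
    proof -
      have "(\<Sum>i\<in>I. c i * v i \<rho>) \<le> (\<Sum>i\<in>I. 1 * real B)"
        using cb assms(3) P(1) \<rho> by (intro sum_mono mult_mono) auto
      moreover have "0 \<le> (\<Sum>i\<in>I. c i * v i \<rho>)"
        using cb assms(3) P(1) \<rho> by (intro sum_nonneg mult_nonneg_nonneg) auto
      ultimately show ?thesis using \<rho> by (simp add: f_def floor_le_iff)
    qed
    then show "g \<in> P \<rightarrow>\<^sub>E {0..int (card I * B)}" unfolding c(2) by (auto simp: f_def)
  qed
  have fin: "finite (P \<rightarrow>\<^sub>E {0..int (card I * B)})" using P(2) by (intro finite_PiE) auto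
  show "finite ?H" using inj sub fin by (meson finite_imageD finite_subset)
  have "card ?H = card (f ` ?H)" using inj by (simp add: card_image)
  also have "\<dots> \<le> card (P \<rightarrow>\<^sub>E {0..int (card I * B)})" by (rule card_mono[OF fin sub])
  also have "\<dots> = (card I * B + 1) ^ card P" using P(2) by (simp add: card_PiE nat_add_distrib nat_mult_distrib)
  also have "\<dots> \<le> (card I * B + 1) ^ card I" using P(3) by (intro power_increasing) auto
  finally show "card ?H \<le> (card I * B + 1) ^ card I" .
qed

lemma eq_if_restrict_eq:
  assumes "x \<in> extensional L" "y \<in> extensional L"
    and "restrict x I = restrict y I" "restrict x (L - I) = restrict y (L - I)"
  shows "x = y"
proof (rule extensionalityI[OF assms(1,2)])
  fix l assume "l \<in> L"
  then show "x l = y l" using fun_cong[OF assms(3), of l] fun_cong[OF assms(4), of l] by (cases "l \<in> I") simp_all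
qed

lemma card_le_fibers:
  assumes "finite A" "finite Y" "f ` A \<subseteq> Y" "\<And>y. y \<in> Y \<Longrightarrow> card {a\<in>A. f a = y} \<le> M"
  shows "card A \<le> card Y * M"
proof -
  have "A = (\<Union>y\<in>Y. {a\<in>A. f a = y})" using assms(3) by auto
  then have "card A \<le> (\<Sum>y\<in>Y. card {a\<in>A. f a = y})"
    using card_UN_le[OF assms(2), of "\<lambda>y. {a\<in>A. f a = y}"] by simp
  also have "\<dots> \<le> (\<Sum>y\<in>Y. M)" using assms(4) by (rule sum_mono)
  finally show ?thesis by simp
qed

text \<open>The coefficients outside \<open>I\<close> are free. Once they are fixed, two relations
  differ only on \<open>I\<close>, and their difference divided by \<open>N\<close> is, modulo 1, a
  fractional relation between the vectors indexed by \<open>I\<close>.\<close>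

lemma modular_relations_card:
  assumes "finite L" "I \<subseteq> L" "finite (fractional_relations R I v)" "N > 0"
    and "\<And>i \<rho>. i \<in> I \<Longrightarrow> \<rho> \<in> R \<Longrightarrow> v i \<rho> \<in> \<int>"
  shows "card (modular_relations N R L v) \<le> N ^ card (L - I) * card (fractional_relations R I v)"
proof -
  let ?A = "modular_relations N R L v" and ?H = "fractional_relations R I v"
  let ?Y = "(L - I) \<rightarrow>\<^sub>E {..<N}"
  have finI: "finite I" using assms finite_subset by blast
  have finA: "finite ?A"
    using assms(1) unfolding modular_relations_def
    by (intro finite_subset[OF _ finite_PiE[of L "\<lambda>_. {..<N}"]]) auto
  have "card ?A \<le> card ?Y * card ?H"
  proof (rule card_le_fibers[OF finA, where f = "\<lambda>c. restrict c (L - I)"])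
    show "(\<lambda>c. restrict c (L - I)) ` ?A \<subseteq> ?Y"
      by (auto simp: modular_relations_def PiE_iff restrict_def extensional_def split: if_splits)
    fix y assume "y \<in> ?Y"
    let ?F = "{c \<in> ?A. restrict c (L - I) = y}"
    show "card ?F \<le> card ?H"
    proof (cases "?F = {}")
      case False
      then obtain c0 where c0: "c0 \<in> ?A" "restrict c0 (L - I) = y" by blast
      define g where "g c = (\<lambda>i\<in>I. frac ((real (c i) - real (c0 i)) / real N))" for c :: "_ \<Rightarrow> nat"
      have "g ` ?F \<subseteq> ?H"
      proof
        fix h assume "h \<in> g ` ?F"
        then obtain c where c: "c \<in> ?A" "restrict c (L - I) = y" "h = g c" by blast
        have eq: "c l = c0 l" if "l \<in> L - I" for l
          using fun_cong[OF c(2), of l] fun_cong[OF c0(2), of l] that by simp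
        have "(\<Sum>i\<in>I. (real (c i) - real (c0 i)) / real N * v i \<rho>) \<in> \<int>" if \<rho>: "\<rho> \<in> R" for \<rho>
        proof -
          have "(\<Sum>i\<in>I. (real (c i) - real (c0 i)) / real N * v i \<rho>) =
                (\<Sum>i\<in>L. (real (c i) - real (c0 i)) / real N * v i \<rho>)"
            by (rule sum.mono_neutral_left) (use assms eq in auto)
          also have "\<dots> = (\<Sum>i\<in>L. real (c i) * v i \<rho>) / real N - (\<Sum>i\<in>L. real (c0 i) * v i \<rho>) / real N"
            by (simp add: sum_divide_distrib sum_subtractf [symmetric] algebra_simps diff_divide_distrib)
          also have "\<dots> \<in> \<int>"
            using c(1) c0(1) \<rho> unfolding modular_relations_def by (intro Ints_diff) auto
          finally show ?thesis .
        qed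
        then show "h \<in> ?H"
          unfolding c(3) g_def by (intro frac_fractional_relation assms(5))
      qed
      moreover have "inj_on g ?F"
      proof (rule inj_onI)
        fix c c' assume c: "c \<in> ?F" "c' \<in> ?F" "g c = g c'"
        have "c l = c' l" if "l \<in> L" for l
        proof (cases "l \<in> I")
          case True
          have lt: "c l < N" "c' l < N" using c that by (auto simp: modular_relations_def PiE_iff)
          have "frac ((real (c l) - real (c0 l)) / real N) = frac ((real (c' l) - real (c0 l)) / real N)"
            using fun_cong[OF c(3), of l] True by (simp add: g_def)
          then have "(real (c l) - real (c0 l)) / real N - (real (c' l) - real (c0 l)) / real N =
              of_int (\<lfloor>(real (c l) - real (c0 l)) / real N\<rfloor> - \<lfloor>(real (c' l) - real (c0 l)) / real N\<rfloor>)"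
            unfolding frac_def by simp
          then have "(real (c l) - real (c0 l)) / real N - (real (c' l) - real (c0 l)) / real N \<in> \<int>"
            by (metis Ints_of_int)
          then have "(real (c l) - real (c' l)) / real N \<in> \<int>"
            by (simp add: diff_divide_distrib)
          then obtain t where t: "(real (c l) - real (c' l)) / real N = of_int t" by (auto elim: Ints_cases)
          have "\<bar>(real (c l) - real (c' l)) / real N\<bar> < 1" using lt assms(4) by (auto simp: abs_if field_simps)
          then have "t = 0" unfolding t by linarith
          then show ?thesis using t assms(4) by simp
        next
          case False
          have "restrict c (L - I) = restrict c' (L - I)" using c by simp
          from fun_cong[OF this, of l] show ?thesis using False that by simp
        qed
        then show "c = c'"
          using c(1,2) unfolding modular_relations_def
          by (intro extensionalityI[of _ L]) (auto simp: PiE_def)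
      qed
      ultimately show ?thesis using assms(3) by (meson card_inj_on_le)
    next
      case True
      then show ?thesis by (metis card.empty le0)
    qed
  qed (use assms in \<open>auto intro: finite_PiE\<close>)
  then show ?thesis using assms(1) by (simp add: card_PiE)
qed

section \<open>Weighted point counts in a simplex\<close>

text \<open>Coordinates start at 1 because the target is \<open>frobenius_pos\<close>, where every
  generator is counted once in addition. This also makes the number of points a single binomial
  coefficient.\<close>

definition simplex_points :: "nat \<Rightarrow> nat \<Rightarrow> (nat \<Rightarrow> nat) set" where
  "simplex_points n B = {x \<in> {..<n} \<rightarrow>\<^sub>E {1..}. (\<Sum>\<rho><n. x \<rho>) \<le> B}"

lemma simplex_points_coord:
  assumes "x \<in> simplex_points n B" "\<rho> < n"
  shows "1 \<le> x \<rho>" "x \<rho> \<le> B"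
proof -
  show "1 \<le> x \<rho>" using assms by (auto simp: simplex_points_def PiE_iff)
  have "x \<rho> \<le> (\<Sum>\<rho><n. x \<rho>)" using assms(2) by (intro member_le_sum) auto
  then show "x \<rho> \<le> B" using assms(1) by (auto simp: simplex_points_def)
qed

lemma simplex_points_subset: "simplex_points n B \<subseteq> {..<n} \<rightarrow>\<^sub>E {1..B}"
proof
  fix x assume x: "x \<in> simplex_points n B"
  then have "x \<in> extensional {..<n}" by (auto simp: simplex_points_def PiE_def)
  then show "x \<in> {..<n} \<rightarrow>\<^sub>E {1..B}" using simplex_points_coord[OF x] by (auto simp: PiE_iff)
qed

lemma finite_simplex_points [simp]: "finite (simplex_points n B)"
  by (rule finite_subset[OF simplex_points_subset]) (auto intro: finite_PiE)

text \<open>Splitting off the last coordinate \<open>u\<close> leaves a simplex of size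
  \<open>B - u\<close>, and the hockey-stick identity adds up the resulting binomial
  coefficients.\<close>

lemma card_simplex_points: "card (simplex_points n B) = B choose n"
proof (induction n arbitrary: B)
  case 0
  have "simplex_points 0 B = {\<lambda>_. undefined}" by (auto simp: simplex_points_def)
  then show ?case by simp
next
  case (Suc n)
  let ?T = "SIGMA u:{1..B}. simplex_points n (B - u)"
  have "bij_betw (\<lambda>(u, y). y(n := u)) ?T (simplex_points (Suc n) B)"
  proof (rule bij_betwI[where g = "\<lambda>x. (x n, restrict x {..<n})"])
    show "(\<lambda>(u, y). y(n := u)) \<in> ?T \<rightarrow> simplex_points (Suc n) B"
    proof clarify
      fix u y assume u: "u \<in> {1..B}" and y: "y \<in> simplex_points n (B - u)"
      have "(\<Sum>\<rho><Suc n. (y(n := u)) \<rho>) = (\<Sum>\<rho><n. y \<rho>) + u"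
        by (simp add: sum.lessThan_Suc)
      then show "y(n := u) \<in> simplex_points (Suc n) B"
        using u y by (auto simp: simplex_points_def PiE_iff extensional_def less_Suc_eq)
    qed
    show "(\<lambda>x. (x n, restrict x {..<n})) \<in> simplex_points (Suc n) B \<rightarrow> ?T"
    proof
      fix x assume x: "x \<in> simplex_points (Suc n) B"
      have "1 \<le> x n" "x n \<le> B" using simplex_points_coord[OF x] by auto
      then show "(x n, restrict x {..<n}) \<in> ?T"
        using x by (auto simp: simplex_points_def PiE_iff)
    qed
    show "(\<lambda>(u, y). y(n := u)) (x n, restrict x {..<n}) = x" if "x \<in> simplex_points (Suc n) B" for x
      using that by (auto simp: simplex_points_def PiE_iff extensional_def fun_eq_iff)
    show "(\<lambda>x. (x n, restrict x {..<n})) ((\<lambda>(u, y). y(n := u)) t) = t" if t: "t \<in> ?T" for t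
      using that by (auto simp: simplex_points_def PiE_iff extensional_def fun_eq_iff)
  qed
  then have "card (simplex_points (Suc n) B) = card ?T"
    by (rule bij_betw_same_card[symmetric])
  also have "\<dots> = (\<Sum>u\<in>{1..B}. (B - u) choose n)" using Suc by simp
  also have "\<dots> = (\<Sum>m<B. m choose n)"
    by (rule sum.reindex_bij_witness[where i = "\<lambda>m. B - m" and j = "\<lambda>u. B - u"]) auto
  also have "\<dots> = B choose Suc n"
  proof (cases B)
    case (Suc b)
    then show ?thesis using sum_choose_upper[of n b] by (simp add: lessThan_Suc_atMost)
  qed simp
  finally show ?case .
qed

lemma card_simplex_points_le: "real (card (simplex_points n B)) \<le> real B ^ n / fact n"
proof -
  have "real ((B choose n) * fact n) \<le> real (B ^ n)"
    using binomial_fact_pow[of B n] by (simp only: of_nat_le_iff)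
  then show ?thesis by (simp add: card_simplex_points field_simps)
qed

text \<open>Each of the n factors of the falling factorial is at least \<open>B - n\<close>, and by
  Bernoulli's inequality \<open>n\<^sup>2 / B \<le> 1 / 2\<close> limits the loss to a factor
  2.\<close>

lemma card_simplex_points_ge:
  assumes "2 * n\<^sup>2 \<le> B"
  shows "real B ^ n / (2 * fact n) \<le> real (card (simplex_points n B))"
proof (cases "n = 0")
  case False
  have nB: "n \<le> B" using assms False by (metis le_square power2_eq_square le_trans mult_2 trans_le_add1)
  have B0: "B > 0" using nB False by auto
  have "1 / 2 \<le> 1 + real n * (- (real n / real B))"
    using assms B0 by (simp add: field_simps power2_eq_square flip: of_nat_mult)
  also have "\<dots> \<le> (1 + - (real n / real B)) ^ n"
    using nB B0 by (intro Bernoulli_inequality) (simp add: field_simps)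
  finally have "1 / 2 * real B ^ n \<le> (1 + - (real n / real B)) ^ n * real B ^ n"
    by (intro mult_right_mono) auto
  also have "\<dots> = (real B - real n) ^ n"
    using B0 by (simp add: power_mult_distrib[symmetric] field_simps)
  also have "\<dots> = (\<Prod>i<n. real B - real n)" by simp
  also have "\<dots> \<le> (\<Prod>i<n. real B - real i)"
    using nB by (intro prod_mono) auto
  also have "\<dots> = fact n * real (B choose n)"
    by (simp add: binomial_gbinomial gbinomial_prod_rev atLeast0LessThan)
  finally show ?thesis by (simp add: card_simplex_points field_simps)
qed (use card_simplex_points[of 0 B] in simp)

section \<open>Counting by exponential weights\<close>

lemma fact_exp_le:
  assumes "n > 0"
  shows "fact n * exp (real n) \<le> exp 1 * real n * real n ^ n"
  using assms
proof (induction n rule: nat_induct_non_zero)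
  case (Suc n)
  define t where "t = 1 + 1 / real n"
  have t: "t > 0" by (simp add: t_def add_pos_nonneg)
  have tn: "real (Suc n) = real n * t" using Suc by (simp add: t_def field_simps)
  have "1 \<le> (real n + 1) * ln t"
  proof -
    have "ln (1 / t) \<le> 1 / t - 1" using t by (intro ln_le_minus_one) simp
    then have "1 - 1 / t \<le> ln t" using t by (simp add: ln_div)
    moreover have "1 - 1 / t = 1 / (real n + 1)" using Suc by (simp add: t_def field_simps)
    ultimately have "1 / (real n + 1) \<le> ln t" by simp
    then show ?thesis by (simp add: field_simps)
  qed
  then have "exp 1 \<le> exp ((real n + 1) * ln t)" by simp
  also have "\<dots> = t ^ Suc n"
    using t by (simp add: exp_of_nat_mult[of "Suc n" "ln t", simplified] add.commute)
  finally have e: "exp 1 \<le> t ^ Suc n" .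
  have "fact (Suc n) * exp (real (Suc n)) = real (Suc n) * exp 1 * (fact n * exp (real n))"
    by (simp add: exp_add algebra_simps)
  also have "\<dots> \<le> real (Suc n) * t ^ Suc n * (exp 1 * real n * real n ^ n)"
    using t by (intro mult_mono[OF mult_left_mono[OF e] Suc.IH]) auto
  also have "\<dots> = exp 1 * real (Suc n) * (real n * t) ^ Suc n"
    by (simp add: power_mult_distrib)
  finally show ?case unfolding tn by simp
qed simp

text \<open>Rankin's trick: every point of the simplex has weight at least
  \<open>\<beta> ^ B\<close>, so the count is at most the total weight divided by the minimal weight
  of a tuple. The bound on the coordinate sum can then be dropped, and since \<open>Q\<close>
  constrains each coordinate separately the total weight becomes an n-th power.\<close>

lemma card_le_weighted_rows:
  fixes \<beta> :: real
  assumes "finite I" "0 < \<beta>" "\<beta> \<le> 1"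
  shows "real (card {x \<in> I \<rightarrow>\<^sub>E simplex_points n B. \<forall>\<rho><n. Q (\<lambda>i\<in>I. x i \<rho>)}) \<le>
     ((1 / \<beta>) ^ B) ^ card I * (\<Sum>w | w \<in> I \<rightarrow>\<^sub>E {1..B} \<and> Q w. \<Prod>i\<in>I. \<beta> ^ w i) ^ n"
proof -
  let ?A = "{x \<in> I \<rightarrow>\<^sub>E simplex_points n B. \<forall>\<rho><n. Q (\<lambda>i\<in>I. x i \<rho>)}"
  let ?W = "{w. w \<in> I \<rightarrow>\<^sub>E {1..B} \<and> Q w}"
  \<comment> \<open>Transposition: a tuple of points becomes a sequence of n rows.\<close>
  define T where "T x = (\<lambda>\<rho>\<in>{..<n}. \<lambda>i\<in>I. x i \<rho>)" for x :: "'a \<Rightarrow> nat \<Rightarrow> nat"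
  have finA: "finite ?A"
    by (rule finite_subset[of _ "I \<rightarrow>\<^sub>E simplex_points n B"]) (use assms in \<open>auto intro: finite_PiE\<close>)
  have finW: "finite ?W"
    by (rule finite_subset[of _ "I \<rightarrow>\<^sub>E {1..B}"]) (use assms in \<open>auto intro: finite_PiE\<close>)
  have one: "1 \<le> ((1 / \<beta>) ^ B) ^ card I * (\<Prod>\<rho><n. \<Prod>i\<in>I. \<beta> ^ T x \<rho> i)" if x: "x \<in> ?A" for x
  proof -
    have "(\<Prod>\<rho><n. \<Prod>i\<in>I. \<beta> ^ T x \<rho> i) = (\<Prod>\<rho><n. \<Prod>i\<in>I. \<beta> ^ x i \<rho>)"
      by (simp add: T_def)
    also have "\<dots> = (\<Prod>i\<in>I. \<beta> ^ (\<Sum>\<rho><n. x i \<rho>))"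
      by (subst prod.swap) (simp add: power_sum)
    also have "\<dots> \<ge> (\<Prod>i\<in>I. \<beta> ^ B)"
    proof (rule prod_mono, intro conjI)
      fix i assume "i \<in> I"
      then have "x i \<in> simplex_points n B" using x by auto
      then have "(\<Sum>\<rho><n. x i \<rho>) \<le> B" by (simp add: simplex_points_def)
      then show "\<beta> ^ B \<le> \<beta> ^ (\<Sum>\<rho><n. x i \<rho>)" using assms by (intro power_decreasing) auto
    qed (use assms in simp)
    finally have "(\<Prod>i\<in>I. \<beta> ^ B) \<le> (\<Prod>\<rho><n. \<Prod>i\<in>I. \<beta> ^ T x \<rho> i)" by simp
    then have "((1 / \<beta>) ^ B) ^ card I * (\<beta> ^ B) ^ card I \<le>
        ((1 / \<beta>) ^ B) ^ card I * (\<Prod>\<rho><n. \<Prod>i\<in>I. \<beta> ^ T x \<rho> i)"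
      using assms by (intro mult_left_mono) auto
    then show ?thesis using assms by (simp add: power_mult_distrib[symmetric])
  qed
  have inj: "inj_on T ?A"
  proof (rule inj_onI)
    fix x y assume x: "x \<in> ?A" and y: "y \<in> ?A" and eq: "T x = T y"
    have "x i \<rho> = y i \<rho>" if "i \<in> I" for i \<rho>
    proof (cases "\<rho> < n")
      case True
      then show ?thesis using fun_cong[OF fun_cong[OF eq, of \<rho>], of i] that by (simp add: T_def)
    next
      case False
      have "x i \<in> simplex_points n B" "y i \<in> simplex_points n B" using x y that by auto
      then show ?thesis using False by (auto simp: simplex_points_def PiE_iff extensional_def)
    qed
    then show "x = y" using x y by (intro extensionalityI[of _ I]) (auto simp: PiE_def)
  qed
  have sub: "T ` ?A \<subseteq> {..<n} \<rightarrow>\<^sub>E ?W"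
  proof
    fix t assume "t \<in> T ` ?A"
    then obtain x where x: "x \<in> ?A" "t = T x" by blast
    have "x i \<rho> \<in> {1..B}" if "i \<in> I" "\<rho> < n" for i \<rho>
      using simplex_points_coord[of "x i" n B \<rho>] x(1) that by auto
    then show "t \<in> {..<n} \<rightarrow>\<^sub>E ?W" using x by (auto simp: T_def)
  qed
  have "real (card ?A) = (\<Sum>x\<in>?A. 1)" by simp
  also have "\<dots> \<le> (\<Sum>x\<in>?A. ((1 / \<beta>) ^ B) ^ card I * (\<Prod>\<rho><n. \<Prod>i\<in>I. \<beta> ^ T x \<rho> i))"
    by (rule sum_mono) (use one in blast)
  also have "\<dots> = ((1 / \<beta>) ^ B) ^ card I * (\<Sum>w\<in>T ` ?A. \<Prod>\<rho><n. \<Prod>i\<in>I. \<beta> ^ w \<rho> i)"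
    by (simp add: sum.reindex[OF inj] sum_distrib_left)
  also have "\<dots> \<le> ((1 / \<beta>) ^ B) ^ card I * (\<Sum>w\<in>{..<n} \<rightarrow>\<^sub>E ?W. \<Prod>\<rho><n. \<Prod>i\<in>I. \<beta> ^ w \<rho> i)"
    using assms finW sub
    by (intro mult_left_mono sum_mono2) (auto intro!: finite_PiE prod_nonneg)
  also have "(\<Sum>w\<in>{..<n} \<rightarrow>\<^sub>E ?W. \<Prod>\<rho><n. \<Prod>i\<in>I. \<beta> ^ w \<rho> i) = (\<Sum>w\<in>?W. \<Prod>i\<in>I. \<beta> ^ w i) ^ n"
    using prod_sum_PiE[of "{..<n}" "\<lambda>_. ?W" "\<lambda>_ w. \<Prod>i\<in>I. \<beta> ^ w i"] finW by simp
  finally show ?thesis .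
qed

text \<open>The quotients \<open>w div q\<close> are distinct, so a geometric series of ratio
  \<open>\<beta> ^ q\<close> dominates; Bernoulli's inequality for
  \<open>1 / \<beta> = 1 + n / B\<close> estimates its sum. With this \<beta> a geometric variable
  has mean about \<open>B / n\<close>, so that n coordinates add up to about B, which keeps Rankin's
  bound nearly sharp.\<close>

lemma sum_power_residue_class_le:
  fixes n B q :: nat
  defines "\<beta> \<equiv> real B / (real B + real n)"
  assumes "n > 0" "B > 0" "q > 0" "D \<subseteq> {1..B}" "\<And>w w'. w \<in> D \<Longrightarrow> w' \<in> D \<Longrightarrow> w mod q = w' mod q"
  shows "(\<Sum>w\<in>D. \<beta> ^ w) \<le> 1 + real B / (real n * real q)"
proof -
  have \<beta>: "0 < \<beta>" "\<beta> < 1" using assms by (auto simp: \<beta>_def)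
  have finD: "finite D" using assms(5) finite_subset by blast
  have inj: "inj_on (\<lambda>w. w div q) D"
    by (rule inj_onI) (metis assms(6) div_mult_mod_eq)
  have b1: "\<beta> ^ q < 1" using \<beta> assms(4) by (simp add: power_less_one_iff)
  have "(\<Sum>w\<in>D. \<beta> ^ w) \<le> (\<Sum>w\<in>D. (\<beta> ^ q) ^ (w div q))"
    using \<beta> by (intro sum_mono) (auto simp: power_mult[symmetric] intro!: power_decreasing)
  also have "\<dots> = (\<Sum>k\<in>(\<lambda>w. w div q) ` D. (\<beta> ^ q) ^ k)"
    by (simp add: sum.reindex[OF inj])
  also have "\<dots> \<le> (\<Sum>k<Suc B. (\<beta> ^ q) ^ k)"
  proof (rule sum_mono2)
    show "(\<lambda>w. w div q) ` D \<subseteq> {..<Suc B}"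
    proof clarify
      fix w assume "w \<in> D"
      then have "w \<le> B" using assms(5) by auto
      then show "w div q < Suc B" using div_le_dividend[of w q] by linarith
    qed
  qed (use \<beta> in auto)
  also have "\<dots> \<le> 1 / (1 - \<beta> ^ q)"
    using b1 \<beta> by (subst sum_gp_strict) (auto intro!: divide_right_mono)
  also have "\<dots> \<le> 1 + real B / (real n * real q)"
  proof -
    define t where "t = real q * (real n / real B)"
    have t: "t > 0" using assms by (simp add: t_def)
    have "1 + t \<le> (1 + real n / real B) ^ q"
      unfolding t_def by (intro Bernoulli_inequality) (simp add: order_trans[of _ 0])
    also have "1 + real n / real B = 1 / \<beta>" using assms by (simp add: \<beta>_def field_simps)
    finally have "\<beta> ^ q \<le> 1 / (1 + t)" using \<beta> t by (simp add: field_simps power_divide)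
    moreover have "1 - 1 / (1 + t) = t / (1 + t)" using t by (simp add: field_simps)
    ultimately have "t / (1 + t) \<le> 1 - \<beta> ^ q" by linarith
    then have "1 / (1 - \<beta> ^ q) \<le> 1 / (t / (1 + t))" using t by (intro divide_left_mono) (auto intro!: mult_pos_pos simp: b1)
    also have "\<dots> = 1 + 1 / t" using t by (simp add: field_simps)
    finally show ?thesis by (simp add: t_def field_simps)
  qed
  finally show ?thesis .
qed

lemma sum_power_interval:
  fixes n B :: nat
  defines "\<beta> \<equiv> real B / (real B + real n)"
  assumes "n > 0" "B > 0"
  shows "(\<Sum>w\<in>{1..B}. \<beta> ^ w) \<le> real B / real n"
proof -
  have \<beta>: "0 < \<beta>" "\<beta> < 1" using assms by (auto simp: \<beta>_def)
  have "(\<Sum>w\<in>{1..B}. \<beta> ^ w) = \<beta> * (\<Sum>w<B. \<beta> ^ w)"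
    unfolding sum_distrib_left
    by (rule sum.reindex_bij_witness[where i = Suc and j = "\<lambda>w. w - 1"]) (auto simp flip: power_Suc)
  also have "\<dots> \<le> \<beta> * (1 / (1 - \<beta>))"
    using \<beta> by (intro mult_left_mono, subst sum_gp_strict) (auto intro!: divide_right_mono)
  also have "1 - \<beta> = real n / (real B + real n)" using assms by (simp add: \<beta>_def field_simps)
  also have "\<beta> * (1 / (real n / (real B + real n))) = real B / real n"
    using assms by (simp add: \<beta>_def)
  finally show ?thesis .
qed

text \<open>With the other coordinates fixed, the congruence determines \<open>w i0\<close> modulo
  \<open>q div gcd (m i0) q\<close>. Hence the sum over this one coordinate shrinks by the factor
  \<open>1 / q'\<close>, up to the discretisation error \<open>n / B\<close>.\<close>

lemma weighted_rows_modular: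
  fixes n B q :: nat and m :: "'i \<Rightarrow> nat"
  defines "\<beta> \<equiv> real B / (real B + real n)"
  assumes "n > 0" "B > 0" "q > 0" "finite I" "i0 \<in> I" and q': "q' = q div gcd (m i0) q"
  shows "(\<Sum>w | w \<in> I \<rightarrow>\<^sub>E {1..B} \<and> q dvd (\<Sum>i\<in>I. m i * w i). \<Prod>i\<in>I. \<beta> ^ w i)
     \<le> (real B / real n) ^ card I * (1 / real q' + real n / real B)"
proof -
  let ?I = "I - {i0}"
  have \<beta>: "0 < \<beta>" "\<beta> < 1" using assms by (auto simp: \<beta>_def)
  have q'0: "q' > 0" using assms(4) by (simp add: q' div_greater_zero_iff dvd_imp_le)
  let ?W = "{w. w \<in> I \<rightarrow>\<^sub>E {1..B} \<and> q dvd (\<Sum>i\<in>I. m i * w i)}"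
  define D where "D y = {u\<in>{1..B}. q dvd (m i0 * u + (\<Sum>i\<in>?I. m i * y i))}" for y
  have res: "u mod q' = u' mod q'" if u: "u \<in> D y" "u' \<in> D y" for u u' y
  proof -
    have "int q dvd int (m i0 * u + (\<Sum>i\<in>?I. m i * y i)) - int (m i0 * u' + (\<Sum>i\<in>?I. m i * y i))"
      using u unfolding D_def by (intro dvd_diff) (auto simp only: int_dvd_int_iff mem_Collect_eq)
    then have "int q dvd int (m i0) * (int u - int u')" by (simp add: algebra_simps)
    then have "int q' dvd int u - int u'"
    proof -
      let ?g = "gcd (int (m i0)) (int q)"
      have g0: "?g \<noteq> 0" using assms(4) by simp
      have qq: "int q' = int q div ?g" by (simp add: q' zdiv_int)
      have "coprime (int q div ?g) (int (m i0) div ?g)"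
        using div_gcd_coprime[of "int (m i0)" "int q"] assms(4) by (simp add: coprime_commute)
      moreover have "int q div ?g dvd (int (m i0) div ?g) * (int u - int u')"
      proof -
        have "?g * (int q div ?g) dvd ?g * ((int (m i0) div ?g) * (int u - int u'))"
          using \<open>int q dvd int (m i0) * (int u - int u')\<close>
          by (metis dvd_mult_div_cancel gcd_dvd1 gcd_dvd2 mult.assoc)
        then show ?thesis using dvd_times_left_cancel_iff[OF g0] by blast
      qed
      ultimately show ?thesis unfolding qq by (simp add: coprime_dvd_mult_right_iff)
    qed
    then have "int u mod int q' = int u' mod int q'" by (simp add: mod_eq_dvd_iff)
    then show ?thesis by (metis of_nat_eq_iff zmod_int)
  qed
  have "(\<Sum>w\<in>?W. \<Prod>i\<in>I. \<beta> ^ w i) = (\<Sum>(y, u)\<in>(SIGMA y:(?I \<rightarrow>\<^sub>E {1..B}). D y). \<beta> ^ u * (\<Prod>i\<in>?I. \<beta> ^ y i))"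
  proof (rule sum.reindex_bij_witness[where i = "\<lambda>(y, u). y(i0 := u)" and j = "\<lambda>w. (restrict w ?I, w i0)"])
    fix w assume w: "w \<in> ?W"
    have "(\<Sum>i\<in>I. m i * w i) = m i0 * w i0 + (\<Sum>i\<in>?I. m i * restrict w ?I i)"
      using assms by (simp add: sum.remove[of I i0])
    then show "(restrict w ?I, w i0) \<in> (SIGMA y:(?I \<rightarrow>\<^sub>E {1..B}). D y)"
      using w assms by (auto simp: D_def)
    show "(case (restrict w ?I, w i0) of (y, u) \<Rightarrow> y(i0 := u)) = w"
      using w assms by (auto simp: fun_eq_iff PiE_iff extensional_def restrict_def)
    show "(case (restrict w ?I, w i0) of (y, u) \<Rightarrow> \<beta> ^ u * (\<Prod>i\<in>?I. \<beta> ^ y i)) = (\<Prod>i\<in>I. \<beta> ^ w i)"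
      using assms by (simp add: prod.remove[of I i0])
  next
    fix t assume t: "t \<in> (SIGMA y:(?I \<rightarrow>\<^sub>E {1..B}). D y)"
    then obtain y u where yu: "t = (y, u)" "y \<in> ?I \<rightarrow>\<^sub>E {1..B}" "u \<in> D y" by blast
    show "(\<lambda>w. (restrict w ?I, w i0)) (case t of (y, u) \<Rightarrow> y(i0 := u)) = t"
      using yu by (auto simp: fun_eq_iff PiE_iff extensional_def restrict_def)
    have "(\<Sum>i\<in>I. m i * (y(i0 := u)) i) = m i0 * u + (\<Sum>i\<in>?I. m i * y i)"
      using assms by (simp add: sum.remove[of I i0])
    then show "(case t of (y, u) \<Rightarrow> y(i0 := u)) \<in> ?W"
      using yu assms by (auto simp: D_def PiE_iff extensional_def)
  qed
  also have "\<dots> = (\<Sum>y\<in>?I \<rightarrow>\<^sub>E {1..B}. \<Sum>u\<in>D y. \<beta> ^ u * (\<Prod>i\<in>?I. \<beta> ^ y i))"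
    by (rule sum.Sigma[symmetric]) (use assms in \<open>auto intro: finite_PiE simp: D_def\<close>)
  also have "\<dots> = (\<Sum>y\<in>?I \<rightarrow>\<^sub>E {1..B}. (\<Prod>i\<in>?I. \<beta> ^ y i) * (\<Sum>u\<in>D y. \<beta> ^ u))"
    unfolding sum_distrib_left by (intro sum.cong refl) (rule mult.commute)
  also have "\<dots> \<le> (\<Sum>y\<in>?I \<rightarrow>\<^sub>E {1..B}. (\<Prod>i\<in>?I. \<beta> ^ y i) * (1 + real B / (real n * real q')))"
    unfolding \<beta>_def
    by (intro sum_mono mult_left_mono sum_power_residue_class_le prod_nonneg)
       (use assms(2,3) q'0 res in \<open>auto simp: D_def\<close>)
  also have "\<dots> = (\<Sum>w\<in>{1..B}. \<beta> ^ w) ^ card ?I * (1 + real B / (real n * real q'))"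
    using prod_sum_PiE[of ?I "\<lambda>_. {1..B}" "\<lambda>_ w. \<beta> ^ w"] assms(5) by (simp add: sum_distrib_right)
  also have "\<dots> \<le> (real B / real n) ^ card ?I * (1 + real B / (real n * real q'))"
    using sum_power_interval[OF assms(2,3)] \<beta>
    by (intro mult_right_mono power_mono) (auto simp: \<beta>_def intro!: sum_nonneg)
  also have "1 + real B / (real n * real q') = real B / real n * (1 / real q' + real n / real B)"
    using assms q'0 by (simp add: field_simps)
  also have "(real B / real n) ^ card ?I * \<dots> = (real B / real n) ^ card I * (1 / real q' + real n / real B)"
  proof -
    have "card I = Suc (card ?I)" by (rule card.remove[OF assms(5,6)])
    then show ?thesis by simp
  qed
  finally show ?thesis .
qed

text \<open>The discrete form of the probability 3/4 for exponential variables. Summing the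
  geometric series over \<open>w 2\<close> first leaves, after normalisation,
  \<open>1 - \<beta> / (1 + \<beta>)\<^sup>2\<close>, which tends to 3/4 as \<beta> tends to
  1.\<close>

lemma weighted_rows_energy:
  fixes n B :: nat
  defines "\<beta> \<equiv> real B / (real B + real n)"
  assumes "n > 0" "B > 0"
  shows "(\<Sum>w | w \<in> {0, 1, 2::nat} \<rightarrow>\<^sub>E {1..B} \<and> w 2 < w 0 + w 1. \<Prod>i\<in>{0, 1, 2}. \<beta> ^ w i)
     \<le> (real B / real n) ^ 3 * (3 / 4 + (real n / real B)\<^sup>2)"
proof -
  have \<beta>: "0 < \<beta>" "\<beta> < 1" using assms by (auto simp: \<beta>_def)
  define g where "g = (\<Sum>u\<in>{1..B}. \<beta> ^ u)"
  define g2 where "g2 = (\<Sum>u\<in>{1..B}. (\<beta>\<^sup>2) ^ u)"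
  have gp: "(1 - b) * (\<Sum>u\<in>{1..B}. b ^ u) = b * (1 - b ^ B)" for b :: real
  proof (induction B)
    case (Suc B)
    have "(1 - b) * (\<Sum>u\<in>{1..Suc B}. b ^ u) = (1 - b) * (\<Sum>u\<in>{1..B}. b ^ u) + (1 - b) * b ^ Suc B"
      by (simp add: distrib_left)
    also have "\<dots> = b * (1 - b ^ Suc B)" unfolding Suc by (simp add: algebra_simps)
    finally show ?case .
  qed simp
  have inner: "(\<Sum>w\<in>{w\<in>{1..B}. w < m}. \<beta> ^ w) \<le> (\<beta> - \<beta> ^ m) / (1 - \<beta>)" if "m > 0" for m
  proof -
    have eq: "(1 - \<beta>) * (\<Sum>w\<in>{1..<m}. \<beta> ^ w) = \<beta> - \<beta> ^ m"
      using that
    proof (induction m rule: nat_induct_non_zero)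
      case (Suc m)
      have "(1 - \<beta>) * (\<Sum>w\<in>{1..<Suc m}. \<beta> ^ w) = (1 - \<beta>) * (\<Sum>w\<in>{1..<m}. \<beta> ^ w) + (1 - \<beta>) * \<beta> ^ m"
        using Suc.hyps by (simp add: distrib_left)
      also have "\<dots> = \<beta> - \<beta> ^ Suc m" unfolding Suc.IH by (simp add: algebra_simps)
      finally show ?case .
    qed simp
    have "(\<Sum>w\<in>{w\<in>{1..B}. w < m}. \<beta> ^ w) \<le> (\<Sum>w\<in>{1..<m}. \<beta> ^ w)"
      using \<beta> by (intro sum_mono2) auto
    also have "\<dots> = (\<beta> - \<beta> ^ m) / (1 - \<beta>)" using eq \<beta> by (simp add: field_simps)
    finally show ?thesis .
  qed
  have "(\<Sum>w | w \<in> {0, 1, 2::nat} \<rightarrow>\<^sub>E {1..B} \<and> w 2 < w 0 + w 1. \<Prod>i\<in>{0, 1, 2}. \<beta> ^ w i) =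
     (\<Sum>(p, w)\<in>(SIGMA p:({1..B} \<times> {1..B}). {w\<in>{1..B}. w < fst p + snd p}). \<beta> ^ (fst p + snd p) * \<beta> ^ w)"
    by (rule sum.reindex_bij_witness[where j = "\<lambda>w. ((w 0, w 1), w 2)" and
          i = "\<lambda>((u, v), w). (\<lambda>i\<in>{0, 1, 2}. if i = 0 then u else if i = 1 then v else w)"])
       (auto simp: PiE_iff extensional_def fun_eq_iff power_add)
  also have "\<dots> = (\<Sum>p\<in>{1..B} \<times> {1..B}. \<Sum>w\<in>{w\<in>{1..B}. w < fst p + snd p}. \<beta> ^ (fst p + snd p) * \<beta> ^ w)"
    by (rule sum.Sigma[symmetric]) auto
  also have "\<dots> \<le> (\<Sum>p\<in>{1..B} \<times> {1..B}. \<beta> ^ (fst p + snd p) * ((\<beta> - \<beta> ^ (fst p + snd p)) / (1 - \<beta>)))"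
    unfolding sum_distrib_left[symmetric]
    by (intro sum_mono mult_left_mono inner) (use \<beta> in auto)
  also have "\<dots> = (\<Sum>u\<in>{1..B}. \<Sum>v\<in>{1..B}. (\<beta> * (\<beta> ^ u * \<beta> ^ v) - (\<beta>\<^sup>2) ^ u * (\<beta>\<^sup>2) ^ v) / (1 - \<beta>))"
    unfolding sum.cartesian_product
    by (intro sum.cong) (auto simp: power_add power_mult[symmetric] power_mult_distrib power2_eq_square algebra_simps)
  also have "\<dots> = (\<beta> * g\<^sup>2 - g2\<^sup>2) / (1 - \<beta>)"
    by (simp add: sum_divide_distrib[symmetric] sum_subtractf sum_distrib_left[symmetric]
        sum_distrib_right[symmetric] g_def g2_def power2_eq_square)
  \<comment> \<open>\<open>g2\<close> enters with a negative sign and needs a lower bound. Factoring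
    \<open>1 - \<beta> ^ (2 * B)\<close> relates the two truncated series exactly:
    \<open>g2 * (1 + \<beta>) = g * \<beta> * (1 + \<beta> ^ B)\<close>.\<close>
  also have "\<dots> \<le> (\<beta> * g\<^sup>2 - (g * (\<beta> / (1 + \<beta>)))\<^sup>2) / (1 - \<beta>)"
  proof -
    have g0: "g \<ge> 0" using \<beta> by (auto simp: g_def intro!: sum_nonneg)
    have "(1 - \<beta>) * (g2 * (1 + \<beta>)) = \<beta>\<^sup>2 * (1 - (\<beta>\<^sup>2) ^ B)"
      using gp[of "\<beta>\<^sup>2"] by (simp add: g2_def power2_eq_square algebra_simps)
    also have "\<dots> = (1 - \<beta>) * (g * \<beta> * (1 + \<beta> ^ B))"
    proof -
      have "(1 - \<beta>) * (g * \<beta> * (1 + \<beta> ^ B)) = ((1 - \<beta>) * g) * (\<beta> * (1 + \<beta> ^ B))" by simp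
      also have "\<dots> = \<beta> * (1 - \<beta> ^ B) * (\<beta> * (1 + \<beta> ^ B))" unfolding g_def gp ..
      finally show ?thesis by (simp add: power2_eq_square power_mult_distrib algebra_simps)
    qed
    finally have "g2 * (1 + \<beta>) = g * \<beta> * (1 + \<beta> ^ B)" using \<beta> by simp
    also have "\<dots> \<ge> g * \<beta> * 1" using \<beta> g0 by (intro mult_left_mono) auto
    finally have "g * (\<beta> / (1 + \<beta>)) \<le> g2" using \<beta> by (simp add: field_simps)
    then have "(g * (\<beta> / (1 + \<beta>)))\<^sup>2 \<le> g2\<^sup>2" using g0 \<beta> by (intro power_mono) auto
    then show ?thesis using \<beta> by (intro divide_right_mono) auto
  qed
  also have "\<dots> = g\<^sup>2 * ((\<beta> / (1 - \<beta>)) * (1 - \<beta> / (1 + \<beta>)\<^sup>2))"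
    by (simp add: power_mult_distrib power_divide power2_eq_square algebra_simps diff_divide_distrib)
  also have "\<dots> \<le> (real B / real n)\<^sup>2 * ((real B / real n) * (3 / 4 + (real n / real B)\<^sup>2))"
  proof (intro mult_mono power_mono)
    show "g \<le> real B / real n" using sum_power_interval[OF assms(2,3)] by (simp add: g_def \<beta>_def)
    have "1 - \<beta> = real n / (real B + real n)" using assms by (simp add: \<beta>_def field_simps)
    then show "\<beta> / (1 - \<beta>) \<le> real B / real n" using assms by (simp add: \<beta>_def)
    define s where "s = (1 + \<beta>)\<^sup>2"
    have s: "s > 0" "(1 - \<beta>)\<^sup>2 = s - 4 * \<beta>"
      using \<beta> by (simp add: s_def) (simp add: s_def power2_eq_square algebra_simps)
    \<comment> \<open>The deviation from 3/4 is of second order, since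
      \<open>1 / 4 - \<beta> / (1 + \<beta>)\<^sup>2\<close> equals
      \<open>(1 - \<beta>)\<^sup>2 / (4 * (1 + \<beta>)\<^sup>2)\<close>.\<close>
    have "3 / 4 + (1 - \<beta>)\<^sup>2 - (1 - \<beta> / (1 + \<beta>)\<^sup>2) = (1 - \<beta>)\<^sup>2 - (1 - \<beta>)\<^sup>2 / (4 * (1 + \<beta>)\<^sup>2)"
      unfolding s(2) s_def[symmetric] using s(1) by (simp add: field_simps)
    moreover have "(1 - \<beta>)\<^sup>2 / (4 * (1 + \<beta>)\<^sup>2) \<le> (1 - \<beta>)\<^sup>2 / 1"
    proof (rule divide_left_mono)
      have "1 \<le> (1 + \<beta>)\<^sup>2" using \<beta> by (intro one_le_power) simp
      then show "1 \<le> 4 * (1 + \<beta>)\<^sup>2" "0 < 4 * (1 + \<beta>)\<^sup>2 * 1" by linarith+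
    qed simp
    moreover have "(1 - \<beta>)\<^sup>2 \<le> (real n / real B)\<^sup>2"
      using assms by (intro power_mono) (auto simp: \<beta>_def field_simps)
    ultimately show "1 - \<beta> / (1 + \<beta>)\<^sup>2 \<le> 3 / 4 + (real n / real B)\<^sup>2" by simp
    have "\<beta> \<le> s" using s \<beta> by (smt (verit) zero_le_power2)
    then show nonneg: "0 \<le> 1 - \<beta> / (1 + \<beta>)\<^sup>2" using s(1) unfolding s_def[symmetric] by simp
    show "0 \<le> \<beta> / (1 - \<beta>) * (1 - \<beta> / (1 + \<beta>)\<^sup>2)"
      using \<beta> by (intro mult_nonneg_nonneg[OF _ nonneg]) auto
  qed (use \<beta> in \<open>auto simp: g_def intro!: sum_nonneg\<close>)
  also have "\<dots> = (real B / real n) ^ 3 * (3 / 4 + (real n / real B)\<^sup>2)"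
    by (simp add: power3_eq_cube power2_eq_square)
  finally show ?thesis .
qed

section \<open>Torsion elements of large order\<close>

definition primitive_modular :: "nat \<Rightarrow> 'i set \<Rightarrow> ('i \<Rightarrow> nat) \<Rightarrow> bool" where
  "primitive_modular q I m \<longleftrightarrow> (\<forall>D. (\<forall>i\<in>I. q dvd D * m i) \<longrightarrow> q dvd D)"

text \<open>Take an element of maximal order q. An element is determined by its order, at most q,
  and by its \<open>card I\<close> numerators over that order, which gives
  \<open>card H \<le> q * q ^ card I\<close> without any structure theory. The numerators
  \<open>m\<close> of the chosen element have exact order q as a vector modulo q, which is what
  \<open>primitive_modular\<close> expresses.\<close>

lemma fractional_relation_of_large_order:
  fixes v :: "'i \<Rightarrow> 'r \<Rightarrow> real" and R :: "'r set" and I :: "'i set"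
  defines "H \<equiv> fractional_relations R I v"
  assumes "finite I" "finite (H)" "card (H) > 1"
    and ints: "\<And>i \<rho>. i \<in> I \<Longrightarrow> \<rho> \<in> R \<Longrightarrow> v i \<rho> \<in> \<int>"
  obtains q m where "2 \<le> q" "q \<le> card (H)" "card (H) \<le> q ^ (card I + 1)"
    "m \<in> I \<rightarrow>\<^sub>E {..<q}" "primitive_modular q I m"
    "\<And>\<rho>. \<rho> \<in> R \<Longrightarrow> (\<Sum>i\<in>I. real (m i) * v i \<rho>) / real q \<in> \<int>"
proof -
  define annih where "annih c q \<longleftrightarrow> q > 0 \<and> (\<forall>i\<in>I. real q * c i \<in> \<int>)" for c :: "'i \<Rightarrow> real" and q :: nat
  define ord where "ord c = (LEAST q. annih c q)" for c
  have ex: "\<exists>q\<le>card (H). annih c q" if c: "c \<in> H" for c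
  proof -
    \<comment> \<open>The multiples of \<open>c\<close> modulo 1 stay in the finite set
      \<open>H\<close>, so two of the first \<open>card H + 1\<close> coincide and the difference of
      their indices annihilates \<open>c\<close>.\<close>
    define f where "f t = (\<lambda>i\<in>I. frac (real t * c i))" for t :: nat
    have "f t \<in> H" for t
      unfolding f_def H_def
    proof (rule frac_fractional_relation[OF ints])
      fix \<rho> assume "\<rho> \<in> R"
      then have "(\<Sum>i\<in>I. c i * v i \<rho>) \<in> \<int>" using c by (simp add: H_def fractional_relations_def)
      then have "real t * (\<Sum>i\<in>I. c i * v i \<rho>) \<in> \<int>" by (intro Ints_mult) auto
      then show "(\<Sum>i\<in>I. real t * c i * v i \<rho>) \<in> \<int>" by (simp add: sum_distrib_left mult.assoc)
    qed
    then have "f ` {0..card (H)} \<subseteq> H" by auto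
    then have "\<not> inj_on f {0..card (H)}"
      using assms(3) card_inj_on_le[of f "{0..card (H)}" "H"] by auto
    then obtain s t where st: "s < t" "t \<le> card (H)" "f s = f t"
      unfolding inj_on_def by (metis atLeastAtMost_iff linorder_neqE_nat)
    have "real (t - s) * c i \<in> \<int>" if "i \<in> I" for i
    proof -
      have "frac (real s * c i) = frac (real t * c i)"
        using fun_cong[OF st(3), of i] that by (simp add: f_def)
      then have "real t * c i - real s * c i = of_int (\<lfloor>real t * c i\<rfloor> - \<lfloor>real s * c i\<rfloor>)"
        unfolding frac_def by simp
      then have "real t * c i - real s * c i \<in> \<int>" by (metis Ints_of_int)
      then show ?thesis using st by (simp add: of_nat_diff algebra_simps)
    qed
    then have "annih c (t - s)" using st by (auto simp: annih_def)
    moreover have "t - s \<le> card (H)" using st by simp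
    ultimately show ?thesis by blast
  qed
  have ord: "annih c (ord c)" "ord c \<le> card (H)" if c: "c \<in> H" for c
  proof -
    obtain q where q: "q \<le> card (H)" "annih c q" using ex[OF c] by blast
    show "annih c (ord c)" unfolding ord_def by (rule LeastI[of _ q]) (rule q)
    have "ord c \<le> q" unfolding ord_def by (rule Least_le) (rule q)
    then show "ord c \<le> card (H)" using q by simp
  qed
  have Hne: "H \<noteq> {}" using assms(4) by auto
  define q where "q = Max (ord ` H)"
  have "q \<in> ord ` H" unfolding q_def using assms(3) Hne by (intro Max_in) auto
  then obtain c where c: "c \<in> H" "ord c = q" by auto
  have le_q: "ord c' \<le> q" if "c' \<in> H" for c'
    unfolding q_def using assms(3) that by (intro Max_ge) auto
  have range: "0 \<le> c' i" "c' i < 1" if "c' \<in> H" "i \<in> I" for c' i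
    using that by (auto simp: H_def fractional_relations_def PiE_iff)
  have ext: "c' \<in> extensional I" if "c' \<in> H" for c'
    using that by (auto simp: H_def fractional_relations_def PiE_def)
  define num where "num c' = (\<lambda>i\<in>I. nat \<lfloor>real (ord c') * c' i\<rfloor>)" for c'
  have num: "real (num c' i) = real (ord c') * c' i" if "c' \<in> H" "i \<in> I" for c' i
  proof -
    have "real (ord c') * c' i \<in> \<int>" using ord(1)[OF that(1)] that(2) unfolding annih_def by blast
    then obtain z where z: "real (ord c') * c' i = of_int z" by (auto elim: Ints_cases)
    have "0 \<le> real (ord c') * c' i" using range[OF that] by simp
    then have "0 \<le> z" unfolding z by simp
    then show ?thesis using that(2) by (simp add: num_def z)
  qed
  have num_less: "num c' i < ord c'" if "c' \<in> H" "i \<in> I" for c' i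
  proof -
    have "real (num c' i) < real (ord c') * 1"
      unfolding num[OF that] using range[OF that] ord(1)[OF that(1)]
      by (intro mult_strict_left_mono) (auto simp: annih_def)
    then show ?thesis by simp
  qed
  have pos: "ord c' > 0" if "c' \<in> H" for c' using ord(1)[OF that] by (simp add: annih_def)
  show ?thesis
  proof (rule that)
    show "2 \<le> q"
    proof (rule ccontr)
      assume "\<not> 2 \<le> q"
      then have one: "ord c' = 1" if "c' \<in> H" for c' using le_q[OF that] pos[OF that] by simp
      have "H \<subseteq> {\<lambda>i\<in>I. 0}"
      proof
        fix c' assume c': "c' \<in> H"
        have "c' i = 0" if "i \<in> I" for i
          using num[OF c' that] num_less[OF c' that] one[OF c'] by simp
        then have "c' = (\<lambda>i\<in>I. 0)" using ext[OF c'] by (intro extensionalityI[of _ I]) auto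
        then show "c' \<in> {\<lambda>i\<in>I. 0}" by simp
      qed
      then have "card (H) \<le> 1" using card_mono[of "{\<lambda>i\<in>I. 0}" "H"] by simp
      then show False using assms(4) by simp
    qed
    show "q \<le> card (H)" using ord(2)[OF c(1)] c(2) by simp
    have "inj_on (\<lambda>c'. (ord c', num c')) (H)"
    proof (rule inj_onI)
      fix c1 c2 assume h: "c1 \<in> H" "c2 \<in> H" "(ord c1, num c1) = (ord c2, num c2)"
      have "c1 i = c2 i" if "i \<in> I" for i
        using num[OF h(1) that] num[OF h(2) that] h(3) pos[OF h(1)] by simp
      then show "c1 = c2" using ext[OF h(1)] ext[OF h(2)] by (intro extensionalityI[of _ I]) auto
    qed
    moreover have "(\<lambda>c'. (ord c', num c')) ` H \<subseteq> {1..q} \<times> (I \<rightarrow>\<^sub>E {..<q})"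
    proof
      fix p assume "p \<in> (\<lambda>c'. (ord c', num c')) ` H"
      then obtain c' where c': "c' \<in> H" "p = (ord c', num c')" by blast
      have "num c' i < q" if "i \<in> I" for i
        using num_less[OF c'(1) that] le_q[OF c'(1)] by simp
      then show "p \<in> {1..q} \<times> (I \<rightarrow>\<^sub>E {..<q})"
        using c'(2) pos[OF c'(1)] le_q[OF c'(1)] by (auto simp: num_def Suc_le_eq)
    qed
    ultimately have "card (H) \<le> card ({1..q} \<times> (I \<rightarrow>\<^sub>E {..<q}))"
      using assms(2) by (intro card_inj_on_le) (auto intro: finite_PiE)
    then show "card (H) \<le> q ^ (card I + 1)" using assms(2) by (simp add: card_PiE card_cartesian_product)
    show "num c \<in> I \<rightarrow>\<^sub>E {..<q}"
      using num_less[OF c(1)] c(2) by (auto simp: num_def)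
    show "primitive_modular q I (num c)"
      unfolding primitive_modular_def
    proof (intro allI impI)
      fix D assume D: "\<forall>i\<in>I. q dvd D * num c i"
      \<comment> \<open>If q did not divide \<open>D\<close>, then \<open>D mod q\<close> would be
        an annihilator of \<open>c\<close> smaller than its order q.\<close>
      have "real (D mod q) * c i \<in> \<int>" if i: "i \<in> I" for i
      proof -
        obtain k where k: "D * num c i = q * k" using D i by blast
        have "real D * real (num c i) = real q * real k" using k by (metis of_nat_mult)
        then have "real q * (real D * c i) = real q * real k"
          using num[OF c(1) i] c(2) by (simp add: algebra_simps)
        then have "real D * c i = real k" using pos[OF c(1)] c(2) by simp
        moreover have "real D = real (D div q) * real q + real (D mod q)"
          by (metis div_mult_mod_eq of_nat_add of_nat_mult)
        ultimately have "real (D mod q) * c i = real k - real (D div q) * real (num c i)"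
          using num[OF c(1) i] c(2) by (simp add: algebra_simps)
        then show ?thesis by simp
      qed
      then have "\<not> D mod q > 0"
        using not_less_Least[of "D mod q" "annih c"] c pos[OF c(1)] unfolding annih_def ord_def[symmetric]
        by (metis annih_def mod_less_divisor not_less_Least ord_def)
      then show "q dvd D" by (simp add: dvd_eq_mod_eq_0)
    qed
    fix \<rho> assume \<rho>: "\<rho> \<in> R"
    have "(\<Sum>i\<in>I. real (num c i) * v i \<rho>) / real q = (\<Sum>i\<in>I. c i * v i \<rho>)"
      using num[OF c(1)] c(2) pos[OF c(1)] by (simp add: sum_divide_distrib)
    also have "\<dots> \<in> \<int>" using c(1) \<rho> by (simp add: H_def fractional_relations_def)
    finally show "(\<Sum>i\<in>I. real (num c i) * v i \<rho>) / real q \<in> \<int>" .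
  qed
qed

text \<open>The product of the orders \<open>q div gcd (m i) q\<close> of the entries annihilates
  all of \<open>m\<close> and is therefore divisible by q, so the largest of these orders is at
  least the \<open>card I\<close>-th root of q.\<close>

lemma primitive_modular_index:
  assumes "finite I" "2 \<le> q" "primitive_modular q I m"
  obtains i where "i \<in> I" "q \<le> (q div gcd (m i) q) ^ card I" "2 \<le> q div gcd (m i) q"
proof -
  define r where "r i = q div gcd (m i) q" for i
  have rpos: "r i > 0" for i using assms(2) by (simp add: r_def div_greater_zero_iff dvd_imp_le)
  have "I \<noteq> {}"
  proof
    assume "I = {}"
    then have "q dvd 1" using assms(3) unfolding primitive_modular_def by blast
    then show False using assms(2) by simp
  qed
  then have "Max (r ` I) \<in> r ` I" using assms(1) by (intro Max_in) auto
  then obtain i where i: "i \<in> I" "r i = Max (r ` I)" by auto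
  have le: "r j \<le> r i" if "j \<in> I" for j using assms(1) that i by simp
  have "q dvd (\<Prod>j\<in>I. r j) * m j" if j: "j \<in> I" for j
  proof -
    have "gcd (m j) q * r j dvd m j * r j" by (intro mult_dvd_mono) auto
    moreover have "gcd (m j) q * r j = q" by (simp add: r_def)
    ultimately have "q dvd r j * m j" by (metis mult.commute)
    moreover have "r j dvd (\<Prod>j\<in>I. r j)" using assms(1) j by (intro dvd_prodI)
    ultimately show ?thesis by (meson dvd_refl dvd_trans mult_dvd_mono)
  qed
  then have "q dvd (\<Prod>j\<in>I. r j)" using assms(3) unfolding primitive_modular_def by blast
  then have "q \<le> (\<Prod>j\<in>I. r j)" using rpos by (intro dvd_imp_le prod_pos) auto
  also have "\<dots> \<le> (\<Prod>j\<in>I. r i)" using le by (intro prod_mono) auto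
  finally have qle: "q \<le> r i ^ card I" by simp
  have "r i \<noteq> 1"
  proof
    assume "r i = 1"
    then show False using qle assms(2) by simp
  qed
  then have "2 \<le> r i" using rpos[of i] by linarith
  then show ?thesis using that i(1) qle by (simp add: r_def)
qed

text \<open>Up to a factor \<open>O(n)\<close> this is the number of points of the simplex.\<close>

definition chernoff_volume :: "nat \<Rightarrow> nat \<Rightarrow> real" where
  "chernoff_volume n B = (1 + real n / real B) ^ B * (real B / real n) ^ n"

lemma chernoff_volume_nonneg [simp]: "0 \<le> chernoff_volume n B"
  by (simp add: chernoff_volume_def)

text \<open>The power \<open>(1 + n / B) ^ B\<close> is at most \<open>exp n\<close>, which
  Stirling's bound \<open>fact_exp_le\<close> compares with \<open>n ^ n / fact n\<close>. The
  constant 6 is 3 times 2: \<open>exp 1 \<le> 3\<close>, and \<open>card_simplex_points_ge\<close>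
  loses a factor 2.\<close>

lemma chernoff_volume_le:
  assumes "n > 0" "2 * n\<^sup>2 \<le> B"
  shows "chernoff_volume n B \<le> 6 * real n * real (card (simplex_points n B))"
proof -
  have B: "B > 0" using assms by (cases "B = 0") auto
  have "(1 + real n / real B) ^ B \<le> exp (real n / real B) ^ B"
    by (intro power_mono exp_ge_add_one_self) auto
  also have "\<dots> = exp (real n)" using B by (simp flip: exp_of_nat_mult)
  finally have "chernoff_volume n B \<le> exp (real n) * (real B / real n) ^ n"
    unfolding chernoff_volume_def by (intro mult_right_mono) auto
  also have "\<dots> = (fact n * exp (real n)) * (real B ^ n / (real n ^ n * fact n))"
    by (simp add: power_divide)
  also have "\<dots> \<le> (exp 1 * real n * real n ^ n) * (real B ^ n / (real n ^ n * fact n))"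
    using assms by (intro mult_right_mono fact_exp_le) auto
  also have "\<dots> = exp 1 * real n * 2 * (real B ^ n / (2 * fact n))" using assms by simp
  also have "\<dots> \<le> 3 * real n * 2 * real (card (simplex_points n B))"
    using card_simplex_points_ge[OF assms(2)] exp_le by (intro mult_mono) auto
  finally show ?thesis by simp
qed

section \<open>Tuples with congruences or additive relations\<close>

lemma inverse_beta:
  assumes "B > 0"
  shows "1 / (real B / (real B + real n)) = 1 + real n / real B"
  using assms by (simp add: field_simps)

lemma card_modular_points_le:
  fixes m :: "'i \<Rightarrow> nat"
  assumes "n > 0" "B > 0" "q > 0" "finite I" "i0 \<in> I"
  shows "real (card {x \<in> I \<rightarrow>\<^sub>E simplex_points n B. \<forall>\<rho><n. q dvd (\<Sum>i\<in>I. m i * x i \<rho>)})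
     \<le> chernoff_volume n B ^ card I * (1 / real (q div gcd (m i0) q) + real n / real B) ^ n"
proof -
  define \<beta> where "\<beta> = real B / (real B + real n)"
  have \<beta>: "0 < \<beta>" "\<beta> \<le> 1" using assms by (auto simp: \<beta>_def)
  have ib: "1 / \<beta> = 1 + real n / real B" unfolding \<beta>_def by (rule inverse_beta[OF assms(2)])
  have "real (card {x \<in> I \<rightarrow>\<^sub>E simplex_points n B. \<forall>\<rho><n. q dvd (\<Sum>i\<in>I. m i * (\<lambda>i\<in>I. x i \<rho>) i)}) \<le>
     ((1 / \<beta>) ^ B) ^ card I * (\<Sum>w | w \<in> I \<rightarrow>\<^sub>E {1..B} \<and> q dvd (\<Sum>i\<in>I. m i * w i). \<Prod>i\<in>I. \<beta> ^ w i) ^ n"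
    by (rule card_le_weighted_rows[OF assms(4) \<beta>, of n B "\<lambda>w. q dvd (\<Sum>i\<in>I. m i * w i)"])
  also have "\<dots> \<le> ((1 / \<beta>) ^ B) ^ card I *
      ((real B / real n) ^ card I * (1 / real (q div gcd (m i0) q) + real n / real B)) ^ n"
    using weighted_rows_modular[OF assms(1-5) refl, of m] \<beta>
    by (intro mult_left_mono power_mono) (auto simp: \<beta>_def intro!: sum_nonneg prod_nonneg)
  also have "\<dots> = chernoff_volume n B ^ card I * (1 / real (q div gcd (m i0) q) + real n / real B) ^ n"
    unfolding ib chernoff_volume_def
    by (simp add: power_mult_distrib power_mult[symmetric] mult.commute mult.left_commute)
  finally show ?thesis by simp
qed

text \<open>The additive energy of the simplex. Storing quadruples as pairs of pairs exhibits them
  as collisions of the map taking (a, b) to a + b.\<close>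

definition energy_pairs :: "nat \<Rightarrow> nat \<Rightarrow> (((nat \<Rightarrow> nat) \<times> (nat \<Rightarrow> nat)) \<times> ((nat \<Rightarrow> nat) \<times> (nat \<Rightarrow> nat))) set" where
  "energy_pairs n B = {((a, b), (c, d)). a \<in> simplex_points n B \<and> b \<in> simplex_points n B \<and>
      c \<in> simplex_points n B \<and> d \<in> simplex_points n B \<and> (\<forall>\<rho><n. a \<rho> + b \<rho> = c \<rho> + d \<rho>)}"

text \<open>The point \<open>d\<close> is determined by the other three. Because its coordinates are
  positive, the equation leaves \<open>c < a + b\<close> in every coordinate, and only this
  inequality is kept.\<close>

lemma card_energy_pairs_le:
  assumes "n > 0" "B > 0"
  shows "real (card (energy_pairs n B)) \<le> chernoff_volume n B ^ 3 * (3 / 4 + (real n / real B)\<^sup>2) ^ n"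
proof -
  define \<beta> where "\<beta> = real B / (real B + real n)"
  have \<beta>: "0 < \<beta>" "\<beta> \<le> 1" using assms by (auto simp: \<beta>_def)
  have ib: "1 / \<beta> = 1 + real n / real B" unfolding \<beta>_def by (rule inverse_beta[OF assms(2)])
  let ?I = "{0, 1, 2::nat}"
  let ?X = "{x \<in> ?I \<rightarrow>\<^sub>E simplex_points n B.
      \<forall>\<rho><n. (\<lambda>i\<in>?I. x i \<rho>) 2 < (\<lambda>i\<in>?I. x i \<rho>) 0 + (\<lambda>i\<in>?I. x i \<rho>) 1}"
  define f where "f = (\<lambda>((a, b), (c, d :: nat \<Rightarrow> nat)). (\<lambda>i\<in>?I. if i = 0 then a else if i = 1 then b else (c :: nat \<Rightarrow> nat)))"
  have "card (energy_pairs n B) \<le> card ?X"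
  proof (rule card_inj_on_le[of f])
    show "inj_on f (energy_pairs n B)"
    proof (rule inj_onI)
      fix s t assume s: "s \<in> energy_pairs n B" and t: "t \<in> energy_pairs n B" and eq: "f s = f t"
      obtain a b c d where s': "s = ((a, b), (c, d))" by (metis surj_pair)
      obtain a' b' c' d' where t': "t = ((a', b'), (c', d'))" by (metis surj_pair)
      have abc: "a = a'" "b = b'" "c = c'"
        using fun_cong[OF eq, of 0] fun_cong[OF eq, of 1] fun_cong[OF eq, of 2] by (auto simp: f_def s' t')
      have "d \<rho> = d' \<rho>" if "\<rho> < n" for \<rho>
        using s t that abc unfolding energy_pairs_def s' t' by (auto dest!: spec[of _ \<rho>])
      then have "d = d'" using s t unfolding energy_pairs_def s' t'
        by (intro extensionalityI[of _ "{..<n}"]) (auto simp: simplex_points_def PiE_def)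
      then show "s = t" using abc s' t' by simp
    qed
    show "f ` energy_pairs n B \<subseteq> ?X"
    proof (rule image_subsetI)
      fix s assume s: "s \<in> energy_pairs n B"
      obtain a b c d where s': "s = ((a, b), (c, d))" by (metis surj_pair)
      have h: "((a, b), (c, d)) \<in> energy_pairs n B" using s unfolding s' .
      have "c \<rho> < a \<rho> + b \<rho>" if "\<rho> < n" for \<rho>
      proof -
        have "1 \<le> d \<rho>" using h that by (intro simplex_points_coord) (auto simp: energy_pairs_def)
        then show ?thesis using h that unfolding energy_pairs_def by (auto dest!: spec[of _ \<rho>])
      qed
      then show "f s \<in> ?X" unfolding s' using h by (auto simp: f_def energy_pairs_def)
    qed
    show "finite ?X"
      by (rule finite_subset[of _ "?I \<rightarrow>\<^sub>E simplex_points n B"]) (auto intro: finite_PiE)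
  qed
  then have "real (card (energy_pairs n B)) \<le> real (card ?X)" by simp
  also have "\<dots> \<le> ((1 / \<beta>) ^ B) ^ card ?I * (\<Sum>w | w \<in> ?I \<rightarrow>\<^sub>E {1..B} \<and> w 2 < w 0 + w 1. \<Prod>i\<in>?I. \<beta> ^ w i) ^ n"
    by (rule card_le_weighted_rows[OF _ \<beta>, of ?I n B "\<lambda>w. w 2 < w 0 + w 1"]) simp
  also have "\<dots> \<le> ((1 / \<beta>) ^ B) ^ card ?I * ((real B / real n) ^ 3 * (3 / 4 + (real n / real B)\<^sup>2)) ^ n"
    unfolding \<beta>_def
    by (intro mult_left_mono power_mono weighted_rows_energy[OF assms])
       (auto intro!: sum_nonneg prod_nonneg)
  also have "\<dots> = chernoff_volume n B ^ 3 * (3 / 4 + (real n / real B)\<^sup>2) ^ n"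
  proof -
    have "card ?I = 3" by simp
    then show ?thesis
      unfolding ib chernoff_volume_def
      by (simp only: power_mult_distrib power_mult[symmetric] mult.commute[of 3 n] mult.assoc)
  qed
  finally show ?thesis .
qed

text \<open>If \<open>r\<close> is the number of preimages under \<open>f\<close>, the left side is
  the correlation of \<open>r\<close> with its translate by \<open>g\<close>. The inequality between
  arithmetic and geometric means bounds it by the sum of the squares of \<open>r\<close>, since
  \<open>g\<close> is injective.\<close>

lemma card_shifted_collisions_le:
  fixes f :: "'a \<Rightarrow> 'v" and g :: "'v \<Rightarrow> 'v"
  assumes "finite A" "inj g"
  shows "card {(s, t) \<in> A \<times> A. g (f s) = f t} \<le> card {(s, t) \<in> A \<times> A. f s = f t}"
proof -
  define r where "r y = card {s\<in>A. f s = y}" for y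
  have fin: "finite {s\<in>A. f s = y}" for y using assms by simp
  have cardsum: "card {(s, t) \<in> A \<times> A. h (f s) = f t} = (\<Sum>y\<in>f ` A. r y * r (h y))" for h
  proof -
    have "{(s, t) \<in> A \<times> A. h (f s) = f t} = (\<Union>y\<in>f ` A. {s\<in>A. f s = y} \<times> {t\<in>A. f t = h y})" by force
    also have "card \<dots> = (\<Sum>y\<in>f ` A. card ({s\<in>A. f s = y} \<times> {t\<in>A. f t = h y}))"
      using assms(1) by (intro card_UN_disjoint) auto
    finally show ?thesis by (simp add: r_def card_cartesian_product)
  qed
  have "real (\<Sum>y\<in>f ` A. r y * r (g y)) \<le> (\<Sum>y\<in>f ` A. (real (r y) ^ 2 + real (r (g y)) ^ 2) / 2)"
  proof (simp only: of_nat_sum, rule sum_mono)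
    fix y show "real (r y * r (g y)) \<le> (real (r y) ^ 2 + real (r (g y)) ^ 2) / 2"
      using sum_squares_bound[of "real (r y)" "real (r (g y))"] by simp
  qed
  also have "\<dots> = ((\<Sum>y\<in>f ` A. real (r y) ^ 2) + (\<Sum>y\<in>f ` A. real (r (g y)) ^ 2)) / 2"
    by (simp add: sum.distrib sum_divide_distrib[symmetric] add_divide_distrib)
  also have "(\<Sum>y\<in>f ` A. real (r (g y)) ^ 2) \<le> (\<Sum>y\<in>f ` A. real (r y) ^ 2)"
  proof -
    have "(\<Sum>y\<in>f ` A. real (r (g y)) ^ 2) = (\<Sum>y\<in>g ` f ` A. real (r y) ^ 2)"
      using sum.reindex[OF inj_on_subset[OF assms(2), of "f ` A"], of "\<lambda>y. real (r y) ^ 2"] by simp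
    also have "\<dots> = (\<Sum>y\<in>g ` f ` A \<inter> f ` A. real (r y) ^ 2)"
    proof (rule sum.mono_neutral_right)
      show "\<forall>i\<in>g ` f ` A - g ` f ` A \<inter> f ` A. (real (r i))\<^sup>2 = 0"
        by (auto simp: r_def card_eq_0_iff) (metis imageI)
    qed (use assms in auto)
    also have "\<dots> \<le> (\<Sum>y\<in>f ` A. real (r y) ^ 2)" using assms by (intro sum_mono2) auto
    finally show ?thesis .
  qed
  finally have "real (\<Sum>y\<in>f ` A. r y * r (g y)) \<le> (\<Sum>y\<in>f ` A. real (r y) ^ 2)" by simp
  also have "\<dots> = real (\<Sum>y\<in>f ` A. r y * r y)" by (simp add: power2_eq_square)
  finally show ?thesis
    using cardsum[of g] cardsum[of "\<lambda>y. y"] by (simp only: of_nat_le_iff)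
qed

text \<open>The additional coordinate 1 makes linear relations between the points affine.\<close>

definition homogeneous :: "nat \<Rightarrow> ('i \<Rightarrow> nat \<Rightarrow> nat) \<Rightarrow> 'i \<Rightarrow> nat \<Rightarrow> real" where
  "homogeneous n x i \<rho> = (if \<rho> < n then real (x i \<rho>) else 1)"

text \<open>The zero relation is always present, so a cardinality above 1 means that the group of
  fractional relations is not trivial.\<close>

definition torsion_tuples :: "nat \<Rightarrow> nat \<Rightarrow> 'i set \<Rightarrow> ('i \<Rightarrow> nat \<Rightarrow> nat) set" where
  "torsion_tuples n B I = {y \<in> I \<rightarrow>\<^sub>E simplex_points n B. independent_rows {..n} I (homogeneous n y) \<and>
     card (fractional_relations {..n} I (homogeneous n y)) > 1}"

text \<open>The three indices bring the relation into the shape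
  \<open>x + y i3 = y i1 + y i2 + rest\<close>. With the other points fixed it is then a shifted
  instance of the additive energy.\<close>

definition additive_tuples :: "nat \<Rightarrow> nat \<Rightarrow> 'i set \<Rightarrow> ('i \<Rightarrow> nat \<Rightarrow> nat) set" where
  "additive_tuples n B I = {y \<in> I \<rightarrow>\<^sub>E simplex_points n B. \<exists>c\<in>I \<rightarrow>\<^sub>E {-1, 0, 1::int}.
     (\<exists>i1\<in>I. \<exists>i2\<in>I. \<exists>i3\<in>I. i1 \<noteq> i2 \<and> c i1 = 1 \<and> c i2 = 1 \<and> c i3 = -1) \<and>
     (\<exists>x\<in>simplex_points n B. \<forall>\<rho><n. int (x \<rho>) = (\<Sum>i\<in>I. c i * int (y i \<rho>)))}"

lemma finite_tuples [simp]: "finite I \<Longrightarrow> finite (I \<rightarrow>\<^sub>E simplex_points n B)"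
  by (intro finite_PiE) auto

lemma finite_torsion_tuples [simp]: "finite I \<Longrightarrow> finite (torsion_tuples n B I)"
  unfolding torsion_tuples_def by simp

lemma finite_additive_tuples [simp]: "finite I \<Longrightarrow> finite (additive_tuples n B I)"
  unfolding additive_tuples_def by simp

lemma homogeneous_bounds:
  assumes "x i \<in> simplex_points n B" "B > 0"
  shows "0 \<le> homogeneous n x i \<rho> \<and> homogeneous n x i \<rho> \<le> real B"
  using simplex_points_coord[OF assms(1), of \<rho>] assms(2) by (auto simp: homogeneous_def)

lemma homogeneous_Ints [simp]: "homogeneous n x i \<rho> \<in> \<int>"
  by (simp add: homogeneous_def)

lemma divide_Ints_imp_dvd:
  assumes "real a / real q \<in> \<int>" "q > 0"
  shows "q dvd a"
proof -
  obtain z where "real a / real q = of_int z" using assms(1) by (rule Ints_cases)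
  then have "real a = real q * of_int z" using assms(2) by (simp add: field_simps)
  then have "of_int (int a) = (of_int (int q * z) :: real)" by simp
  then have "int a = int q * z" by (simp only: of_int_eq_iff)
  then have "int q dvd int a" by simp
  then show ?thesis by simp
qed

lemma one_plus_divide_power_le:
  assumes "n > 0"
  shows "(1 + real c / real n) ^ n \<le> 3 ^ c"
proof -
  have "(1 + real c / real n) ^ n \<le> exp (real c / real n) ^ n"
    by (intro power_mono exp_ge_add_one_self) auto
  also have "\<dots> = exp 1 ^ c" using assms by (simp flip: exp_of_nat_mult)
  also have "\<dots> \<le> 3 ^ c" using exp_le by (intro power_mono) auto
  finally show ?thesis .
qed

text \<open>For \<open>t \<le> B / n\<^sup>2\<close> the term \<open>1 / t\<close> dominates and
  leaves \<open>t ^ F / t ^ n\<close>, which is largest at t = 2. For larger t both terms are at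
  most \<open>n\<^sup>2 / B\<close>, while \<open>t ^ F\<close> grows like a power of B with
  exponent below n; the surplus factor \<open>1 / B\<close> absorbs everything that depends on
  n.\<close>

lemma modular_weight_bound:
  assumes "n > 0" "J * F + 1 \<le> n" "F \<le> n" "(4 * n\<^sup>2) ^ n * (J + 1) ^ (J * F) \<le> B"
    "2 \<le> t" "t \<le> (J * B + 1) ^ J"
  shows "real t ^ F * (1 / real t + real n / real B) ^ n \<le> 3 * 2 ^ F / 2 ^ n"
proof -
  have B: "B > 0" using assms(1,4) by (cases "B = 0") auto
  show ?thesis
  proof (cases "t * n\<^sup>2 \<le> B")
    case True
    have "real n / real B \<le> 1 / real t * (1 / real n)"
    proof -
      have "real (t * n\<^sup>2) \<le> real B" using True by (simp only: of_nat_le_iff)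
      then show ?thesis using assms(1,5) B by (simp add: field_simps power2_eq_square)
    qed
    then have "(1 / real t + real n / real B) ^ n \<le> (1 / real t * (1 + 1 / real n)) ^ n"
      by (intro power_mono) (auto simp: distrib_left)
    also have "\<dots> = (1 / real t) ^ n * (1 + 1 / real n) ^ n" by (rule power_mult_distrib)
    also have "(1 + 1 / real n) ^ n \<le> 3" using one_plus_divide_power_le[OF assms(1), of 1] by simp
    finally have "real t ^ F * (1 / real t + real n / real B) ^ n \<le> real t ^ F * ((1 / real t) ^ n * 3)"
      by (intro mult_left_mono) (auto simp: mult_left_mono)
    also have "\<dots> = 3 * (1 / real t) ^ (n - F)"
    proof -
      have "real t ^ n = real t ^ F * real t ^ (n - F)" using assms(3) by (simp flip: power_add)
      then show ?thesis using assms(5) by (simp add: power_divide field_simps)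
    qed
    also have "\<dots> \<le> 3 * (1 / 2) ^ (n - F)"
      using assms(5) by (intro mult_left_mono power_mono) (auto simp: field_simps)
    also have "\<dots> = 3 * 2 ^ F / 2 ^ n"
    proof -
      have "(2::real) ^ n = 2 ^ F * 2 ^ (n - F)" using assms(3) by (simp flip: power_add)
      then show ?thesis by (simp add: power_divide field_simps)
    qed
    finally show ?thesis .
  next
    case False
    then have lt: "real B \<le> real t * real n ^ 2" by (simp flip: of_nat_mult of_nat_power)
    have nn: "real n \<le> real n ^ 2" using assms(1) by (simp add: power2_eq_square)
    have "1 / real t \<le> real n ^ 2 / real B" using lt assms(5) B by (simp add: field_simps)
    moreover have "real n / real B \<le> real n ^ 2 / real B" using nn by (intro divide_right_mono) auto
    ultimately have "1 / real t + real n / real B \<le> 2 * real n ^ 2 / real B" by simp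
    then have 1: "(1 / real t + real n / real B) ^ n \<le> (2 * real n ^ 2 / real B) ^ n"
      by (intro power_mono) auto
    have "t ^ F \<le> ((J * B + 1) ^ J) ^ F" using assms(6) by (intro power_mono) auto
    also have "\<dots> \<le> ((J + 1) * B) ^ (J * F)"
      unfolding power_mult[symmetric] using B by (intro power_mono) auto
    finally have "real (t ^ F) \<le> real (((J + 1) * B) ^ (J * F))" by (simp only: of_nat_le_iff)
    then have 2: "real t ^ F \<le> real (J + 1) ^ (J * F) * real B ^ (J * F)"
      by (simp only: power_mult_distrib of_nat_power of_nat_mult)
    have "real t ^ F * (1 / real t + real n / real B) ^ n \<le>
        (real (J + 1) ^ (J * F) * real B ^ (J * F)) * (2 * real n ^ 2 / real B) ^ n"
      using 1 2 by (intro mult_mono) auto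
    also have "\<dots> = real (J + 1) ^ (J * F) * (2 * real n ^ 2) ^ n * (real B ^ (J * F) / real B ^ n)"
      by (simp add: power_divide)
    also have "real B ^ (J * F) / real B ^ n \<le> 1 / real B"
    proof -
      have "real B ^ (J * F) * real B \<le> real B ^ n"
        using power_increasing[OF assms(2), of "real B"] B by (simp add: mult.commute)
      then show ?thesis using B by (simp add: field_simps)
    qed
    \<comment> \<open>Here \<open>4 * n\<^sup>2\<close> is twice the \<open>2 * n\<^sup>2\<close>
      that has to be absorbed; the extra 2 produces the gain \<open>1 / 2 ^ n\<close>.\<close>
    also have "1 / real B \<le> 1 / real ((4 * n\<^sup>2) ^ n * (J + 1) ^ (J * F))"
    proof (intro divide_left_mono)
      show "real ((4 * n\<^sup>2) ^ n * (J + 1) ^ (J * F)) \<le> real B" using assms(4) by (simp only: of_nat_le_iff)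
      have "0 < (4 * n\<^sup>2) ^ n * (J + 1) ^ (J * F)" using assms(1) by simp
      then show "0 < real B * real ((4 * n\<^sup>2) ^ n * (J + 1) ^ (J * F))"
        using B by (simp only: of_nat_0_less_iff mult_pos_pos)
    qed simp
    also have "real (J + 1) ^ (J * F) * (2 * real n ^ 2) ^ n * \<dots> = 1 / 2 ^ n"
    proof -
      have "real ((4 * n\<^sup>2) ^ n * (J + 1) ^ (J * F)) = (2 * (2 * real n ^ 2)) ^ n * real (J + 1) ^ (J * F)"
        by simp
      also have "\<dots> = 2 ^ n * (2 * real n ^ 2) ^ n * real (J + 1) ^ (J * F)"
        by (simp only: power_mult_distrib[of 2])
      finally have "real ((4 * n\<^sup>2) ^ n * (J + 1) ^ (J * F)) =
          2 ^ n * (2 * real n ^ 2) ^ n * real (J + 1) ^ (J * F)" .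
      moreover have "(2 * real n ^ 2) ^ n > 0" "real (J + 1) ^ (J * F) > 0" using assms(1) by auto
      moreover have "Z * Y * (1 / (X * Y * Z)) = 1 / X" if "Y > 0" "Z > 0" for X Y Z :: real
        using that by simp
      ultimately show ?thesis by (simp only:)
    qed
    also have "\<dots> \<le> 3 * 2 ^ F / 2 ^ n"
    proof (intro divide_right_mono)
      have "(1::real) \<le> 2 ^ F" by simp
      then show "(1::real) \<le> 3 * 2 ^ F" by linarith
    qed simp
    finally show ?thesis by (simp add: mult_left_mono)
  qed
qed

lemma sum_inverse_squares_le: "(\<Sum>q\<in>{2..M}. 1 / real q ^ 2) \<le> 1"
proof (cases "M \<ge> 1")
  case True
  then have "(\<Sum>q\<in>{2..M}. 1 / real q ^ 2) \<le> 1 - 1 / real M"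
  proof (induction M rule: dec_induct)
    case (step M)
    have M: "{2..Suc M} = insert (Suc M) {2..M}" using step by auto
    have "(\<Sum>q\<in>{2..Suc M}. 1 / real q ^ 2) \<le> 1 / real (Suc M) ^ 2 + (1 - 1 / real M)"
      unfolding M using step by simp
    also have "1 / real (Suc M) ^ 2 \<le> 1 / (real M * real (Suc M))"
      using step by (intro divide_left_mono) (auto simp: power2_eq_square)
    also have "1 / (real M * real (Suc M)) = 1 / real M - 1 / real (Suc M)"
      using step by (simp add: field_simps)
    finally show ?case by simp
  qed simp
  also have "\<dots> \<le> 1" by simp
  finally show ?thesis .
qed simp

text \<open>Each tuple is charged to a pair (q, m) witnessing its torsion, with weight
  \<open>q ^ ((J + 1) * E)\<close>, which dominates the summand. There are at most
  \<open>q ^ J\<close> vectors m, so a saving of \<open>q ^ (J + 2)\<close> for each pair leaves the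
  convergent sum of \<open>1 / q\<^sup>2\<close>. Some entry of m has order t with
  \<open>q \<le> t ^ J\<close>; expressing all these powers of q by t gives the exponent F.\<close>

lemma sum_torsion_tuples_le:
  fixes I :: "'i set"
  assumes I: "finite I" "card I \<le> J" and n: "n > 0" "J * F + 1 \<le> n" "F \<le> n"
    and F: "F = J * ((J + 1) * E + J + 2)"
    and B: "(4 * n\<^sup>2) ^ n * (J + 1) ^ (J * F) \<le> B"
  shows "(\<Sum>y\<in>torsion_tuples n B I. real (card (fractional_relations {..n} I (homogeneous n y))) ^ E)
     \<le> chernoff_volume n B ^ card I * (3 * 2 ^ F / 2 ^ n)"
proof -
  let ?H = "\<lambda>y. fractional_relations {..n} I (homogeneous n y)"
  let ?T = "torsion_tuples n B I"
  define X where "X = (\<lambda>(q, m). {x \<in> I \<rightarrow>\<^sub>E simplex_points n B. \<forall>\<rho><n. q dvd (\<Sum>i\<in>I. m i * x i \<rho>)})"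
  define M where "M q = {m \<in> I \<rightarrow>\<^sub>E {..<q}. primitive_modular q I m}" for q
  define Qm where "Qm = (J * B + 1) ^ J"
  have B0: "B > 0" using B n(1) by (cases "B = 0") auto
  let ?PP = "SIGMA q:{2..Qm}. M q"
  have finM: "finite (M q)" for q
    unfolding M_def using I by (intro finite_subset[OF _ finite_PiE[of I "\<lambda>_. {..<q}"]]) auto
  have cardM: "card (M q) \<le> q ^ J" if "q \<ge> 2" for q
  proof -
    have "card (M q) \<le> card (I \<rightarrow>\<^sub>E {..<q})"
      using I unfolding M_def by (intro card_mono finite_PiE) auto
    also have "\<dots> = q ^ card I" using I by (simp add: card_PiE)
    also have "\<dots> \<le> q ^ J" using that I by (intro power_increasing) auto
    finally show ?thesis .
  qed
  have finPP: "finite ?PP" using finM by auto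
  have pick: "real (card (?H y)) ^ E \<le> (\<Sum>p\<in>?PP. if y \<in> X p then real (fst p) ^ ((J + 1) * E) else 0)"
    if y: "y \<in> ?T" for y
  proof -
    have ind: "independent_rows {..n} I (homogeneous n y)" and c1: "card (?H y) > 1"
      and yS: "y \<in> I \<rightarrow>\<^sub>E simplex_points n B"
      using y by (auto simp: torsion_tuples_def)
    have bd: "0 \<le> homogeneous n y i \<rho> \<and> homogeneous n y i \<rho> \<le> real B" if "i \<in> I" for i \<rho>
      using yS that B0 by (intro homogeneous_bounds) auto
    have finH: "finite (?H y)" and cardH: "card (?H y) \<le> (card I * B + 1) ^ card I"
      using fractional_relations_card[OF I(1) ind, of B] bd by auto
    obtain q m where qm: "2 \<le> q" "q \<le> card (?H y)" "card (?H y) \<le> q ^ (card I + 1)"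
      "m \<in> I \<rightarrow>\<^sub>E {..<q}" "primitive_modular q I m"
      "\<And>\<rho>. \<rho> \<in> {..n} \<Longrightarrow> (\<Sum>i\<in>I. real (m i) * homogeneous n y i \<rho>) / real q \<in> \<int>"
      using fractional_relation_of_large_order[OF I(1) finH c1 homogeneous_Ints] by blast
    have "(card I * B + 1) ^ card I \<le> (J * B + 1) ^ card I" using I by (intro power_mono) auto
    also have "\<dots> \<le> Qm" unfolding Qm_def using I by (intro power_increasing) auto
    finally have qQ: "q \<le> Qm" using cardH qm by linarith
    have "q dvd (\<Sum>i\<in>I. m i * y i \<rho>)" if "\<rho> < n" for \<rho>
    proof (rule divide_Ints_imp_dvd)
      have "(\<Sum>i\<in>I. real (m i) * homogeneous n y i \<rho>) = real (\<Sum>i\<in>I. m i * y i \<rho>)"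
        using that by (simp add: homogeneous_def)
      then show "real (\<Sum>i\<in>I. m i * y i \<rho>) / real q \<in> \<int>" using qm(6)[of \<rho>] that by simp
    qed (use qm in simp)
    then have yX: "y \<in> X (q, m)" using yS by (simp add: X_def)
    have p: "(q, m) \<in> ?PP" using qm qQ by (simp add: M_def)
    have "card (?H y) ^ E \<le> (q ^ (card I + 1)) ^ E" using qm by (intro power_mono) auto
    also have "\<dots> \<le> q ^ ((J + 1) * E)"
      unfolding power_mult[symmetric] using qm I by (intro power_increasing mult_right_mono) auto
    finally have "real (card (?H y) ^ E) \<le> real (q ^ ((J + 1) * E))" by (simp only: of_nat_le_iff)
    then have "real (card (?H y)) ^ E \<le> (if y \<in> X (q, m) then real (fst (q, m)) ^ ((J + 1) * E) else 0)"
      using yX by simp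
    also have "\<dots> \<le> (\<Sum>p\<in>?PP. if y \<in> X p then real (fst p) ^ ((J + 1) * E) else 0)"
      using member_le_sum[OF p, of "\<lambda>p. if y \<in> X p then real (fst p) ^ ((J + 1) * E) else 0"] finPP by simp
    finally show ?thesis .
  qed
  let ?K = "chernoff_volume n B ^ card I * (3 * 2 ^ F / 2 ^ n)"
  have each: "real q ^ ((J + 1) * E) * real (card (X (q, m))) \<le> ?K / real q ^ (J + 2)"
    if qm: "(q, m) \<in> ?PP" for q m
  proof -
    have q2: "2 \<le> q" and qQ: "q \<le> Qm" and prim: "primitive_modular q I m" using qm by (auto simp: M_def)
    obtain i where i: "i \<in> I" "q \<le> (q div gcd (m i) q) ^ card I" "2 \<le> q div gcd (m i) q"
      using primitive_modular_index[OF I(1) q2 prim] by blast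
    define t where "t = q div gcd (m i) q"
    have "t \<le> q" by (simp add: t_def)
    then have tQ: "t \<le> (J * B + 1) ^ J" using qQ by (simp add: Qm_def)
    have "q \<le> t ^ card I" using i(2) by (simp only: t_def)
    also have "t ^ card I \<le> t ^ J" using i(3) I(2) unfolding t_def by (intro power_increasing) auto
    finally have qt: "q \<le> t ^ J" .
    have "q ^ ((J + 1) * E) * q ^ (J + 2) = q ^ ((J + 1) * E + J + 2)" by (simp add: power_add)
    also have "\<dots> \<le> (t ^ J) ^ ((J + 1) * E + J + 2)" using qt by (intro power_mono) auto
    also have "\<dots> = t ^ F" by (simp only: F power_mult)
    finally have "real (q ^ ((J + 1) * E) * q ^ (J + 2)) \<le> real (t ^ F)" by (simp only: of_nat_le_iff)
    then have qF: "real q ^ ((J + 1) * E) * real q ^ (J + 2) \<le> real t ^ F" by simp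
    have "real q ^ ((J + 1) * E) * real q ^ (J + 2) * real (card (X (q, m)))
       \<le> real t ^ F * (chernoff_volume n B ^ card I * (1 / real t + real n / real B) ^ n)"
      using card_modular_points_le[OF n(1) B0 _ I(1) i(1), of q m] q2 qF
      by (intro mult_mono) (auto simp: X_def t_def)
    also have "\<dots> = chernoff_volume n B ^ card I * (real t ^ F * (1 / real t + real n / real B) ^ n)" by simp
    also have "\<dots> \<le> ?K"
      using modular_weight_bound[OF n B _ tQ] i(3) by (intro mult_left_mono) (auto simp: t_def)
    finally show ?thesis using q2 by (simp add: field_simps)
  qed
  have "(\<Sum>y\<in>?T. real (card (?H y)) ^ E) \<le>
      (\<Sum>y\<in>?T. \<Sum>p\<in>?PP. if y \<in> X p then real (fst p) ^ ((J + 1) * E) else 0)"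
    by (intro sum_mono pick)
  also have "\<dots> = (\<Sum>p\<in>?PP. \<Sum>y\<in>?T. if y \<in> X p then real (fst p) ^ ((J + 1) * E) else 0)"
    by (rule sum.swap)
  also have "\<dots> = (\<Sum>p\<in>?PP. real (fst p) ^ ((J + 1) * E) * real (card (?T \<inter> X p)))"
    using I by (simp add: sum.If_cases Int_def mult.commute)
  also have "\<dots> \<le> (\<Sum>p\<in>?PP. real (fst p) ^ ((J + 1) * E) * real (card (X p)))"
  proof (intro sum_mono mult_left_mono)
    fix p assume "p \<in> ?PP"
    have "finite (X p)" using I by (cases p) (simp add: X_def)
    then show "real (card (?T \<inter> X p)) \<le> real (card (X p))" by (simp add: card_mono)
  qed simp
  also have "\<dots> \<le> (\<Sum>p\<in>?PP. ?K / real (fst p) ^ (J + 2))"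
  proof (rule sum_mono)
    fix p assume "p \<in> ?PP"
    then show "real (fst p) ^ ((J + 1) * E) * real (card (X p)) \<le> ?K / real (fst p) ^ (J + 2)"
      using each[of "fst p" "snd p"] by simp
  qed
  also have "\<dots> = (\<Sum>q\<in>{2..Qm}. \<Sum>m\<in>M q. ?K / real q ^ (J + 2))"
    using finM by (subst sum.Sigma) (auto simp: case_prod_unfold)
  also have "\<dots> \<le> (\<Sum>q\<in>{2..Qm}. ?K * (1 / real q ^ 2))"
  proof (rule sum_mono)
    fix q assume q: "q \<in> {2..Qm}"
    have "real (card (M q)) \<le> real (q ^ J)" using cardM[of q] q by (simp only: of_nat_le_iff) simp
    then have "real (card (M q)) * (?K / real q ^ (J + 2)) \<le> real q ^ J * (?K / real q ^ (J + 2))"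
      by (intro mult_right_mono) auto
    also have "\<dots> = ?K * (1 / real q ^ 2)" using q by (simp add: power_add power2_eq_square)
    finally show "(\<Sum>m\<in>M q. ?K / real q ^ (J + 2)) \<le> ?K * (1 / real q ^ 2)" by simp
  qed
  also have "\<dots> = ?K * (\<Sum>q\<in>{2..Qm}. 1 / real q ^ 2)" by (rule sum_distrib_left[symmetric])
  also have "\<dots> \<le> ?K * 1" by (intro mult_left_mono sum_inverse_squares_le) auto
  finally show ?thesis by simp
qed

text \<open>There are at most \<open>3 ^ J\<close> coefficient vectors. For a given one, fixing all
  points but three leaves \<open>y i1 + y i2 + shift = y i3 + x\<close>, which by
  \<open>card_shifted_collisions_le\<close> has at most as many solutions as without the
  shift.\<close>

lemma card_additive_tuples_le:
  fixes I :: "'i set"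
  assumes I: "finite I" "card I \<le> J" and n: "n > 0" "B > 0"
  shows "real (card (additive_tuples n B I)) \<le>
     3 ^ J * real (card (simplex_points n B)) ^ (card I - 3) *
       (chernoff_volume n B ^ 3 * (3 / 4 + (real n / real B)\<^sup>2) ^ n)"
proof -
  let ?S = "simplex_points n B"
  define good where "good c \<longleftrightarrow> (\<exists>i1\<in>I. \<exists>i2\<in>I. \<exists>i3\<in>I. i1 \<noteq> i2 \<and> c i1 = 1 \<and> c i2 = 1 \<and> c i3 = -1)"
    for c :: "'i \<Rightarrow> int"
  define Y where "Y c = {y \<in> I \<rightarrow>\<^sub>E ?S. \<exists>x\<in>?S. \<forall>\<rho><n. int (x \<rho>) = (\<Sum>i\<in>I. c i * int (y i \<rho>))}" for c
  let ?C = "{c \<in> I \<rightarrow>\<^sub>E {-1, 0, 1::int}. good c}"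
  have finC: "finite ?C" using I by (intro finite_subset[OF _ finite_PiE[of I "\<lambda>_. {-1, 0, 1::int}"]]) auto
  have "card ?C \<le> card (I \<rightarrow>\<^sub>E {-1, 0, 1::int})" using I by (intro card_mono finite_PiE) auto
  also have "\<dots> = 3 ^ card I" using I by (simp add: card_PiE numeral_3_eq_3)
  also have "\<dots> \<le> 3 ^ J" using I by (intro power_increasing) auto
  finally have cardC: "card ?C \<le> 3 ^ J" .
  have fiber: "card (Y c) \<le> card ?S ^ (card I - 3) * card (energy_pairs n B)" if c: "c \<in> ?C" for c
  proof -
    obtain i1 i2 i3 where i: "i1 \<in> I" "i2 \<in> I" "i3 \<in> I" "i1 \<noteq> i2" "c i1 = 1" "c i2 = 1" "c i3 = -1"
      using c by (auto simp: good_def)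
    have i': "i3 \<noteq> i1" "i3 \<noteq> i2" using i by auto
    let ?I = "I - {i1, i2, i3}"
    have cI: "card ?I = card I - 3" using i i' I by (simp add: card_Diff_subset)
    have "card (Y c) \<le> card (?I \<rightarrow>\<^sub>E ?S) * card (energy_pairs n B)"
    proof (rule card_le_fibers[where f = "\<lambda>y. restrict y ?I"])
      show "finite (Y c)" using I by (simp add: Y_def)
      show "finite (?I \<rightarrow>\<^sub>E ?S)" using I by simp
      show "(\<lambda>y. restrict y ?I) ` Y c \<subseteq> ?I \<rightarrow>\<^sub>E ?S" by (auto simp: Y_def PiE_iff restrict_def extensional_def split: if_splits)
      fix z assume "z \<in> ?I \<rightarrow>\<^sub>E ?S"
      \<comment> \<open>The value 0 beyond the n coordinates makes equality of these functions the
        same as equality on \<open>{..<n}\<close>, although the points themselves are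
        \<open>undefined\<close> there.\<close>
      define f where "f = (\<lambda>(a :: nat \<Rightarrow> nat, b :: nat \<Rightarrow> nat) \<rho>. if \<rho> < n then int (a \<rho>) + int (b \<rho>) else 0)"
      define g where "g h \<rho> = h \<rho> + (if \<rho> < n then (\<Sum>i\<in>?I. c i * int (z i \<rho>)) else 0)" for h :: "nat \<Rightarrow> int" and \<rho>
      have "inj g" by (auto simp: inj_def g_def fun_eq_iff)
      let ?A = "?S \<times> ?S"
      let ?F = "{y \<in> Y c. restrict y ?I = z}"
      define pick where "pick y = (SOME x. x \<in> ?S \<and> (\<forall>\<rho><n. int (x \<rho>) = (\<Sum>i\<in>I. c i * int (y i \<rho>))))" for y
      have pick: "pick y \<in> ?S" "\<And>\<rho>. \<rho> < n \<Longrightarrow> int (pick y \<rho>) = (\<Sum>i\<in>I. c i * int (y i \<rho>))" if "y \<in> Y c" for y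
      proof -
        have "\<exists>x. x \<in> ?S \<and> (\<forall>\<rho><n. int (x \<rho>) = (\<Sum>i\<in>I. c i * int (y i \<rho>)))" using that by (auto simp: Y_def)
        then have "pick y \<in> ?S \<and> (\<forall>\<rho><n. int (pick y \<rho>) = (\<Sum>i\<in>I. c i * int (y i \<rho>)))"
          unfolding pick_def by (rule someI_ex)
        then show "pick y \<in> ?S" "\<And>\<rho>. \<rho> < n \<Longrightarrow> int (pick y \<rho>) = (\<Sum>i\<in>I. c i * int (y i \<rho>))" by auto
      qed
      define h where "h y = ((y i1, y i2), (y i3, pick y))" for y
      have "card ?F \<le> card {(s, t) \<in> ?A \<times> ?A. g (f s) = f t}"
      proof (rule card_inj_on_le[of h])
        show "inj_on h ?F"
        proof (rule inj_onI)
          fix y y' assume y: "y \<in> ?F" "y' \<in> ?F" "h y = h y'"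
          have "y i = y' i" if "i \<in> I" for i
          proof (cases "i \<in> ?I")
            case True
            have "restrict y ?I = restrict y' ?I" using y by simp
            from fun_cong[OF this, of i] show ?thesis using True by simp
          next
            case False
            then show ?thesis using y(3) that by (auto simp: h_def)
          qed
          then show "y = y'" using y(1,2)
            by (intro extensionalityI[of _ I]) (auto simp: Y_def PiE_def)
        qed
        show "h ` ?F \<subseteq> {(s, t) \<in> ?A \<times> ?A. g (f s) = f t}"
        proof (rule image_subsetI)
          fix y assume y: "y \<in> ?F"
          then have yS: "\<And>i. i \<in> I \<Longrightarrow> y i \<in> ?S" and yY: "y \<in> Y c" by (auto simp: Y_def)
          have "g (f (y i1, y i2)) \<rho> = f (y i3, pick y) \<rho>" for \<rho>
          proof (cases "\<rho> < n")
            case True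
            have zy: "(\<Sum>i\<in>?I. c i * int (z i \<rho>)) = (\<Sum>i\<in>?I. c i * int (y i \<rho>))"
              using y by (intro sum.cong) auto
            have "(\<Sum>i\<in>I. c i * int (y i \<rho>)) =
                int (y i1 \<rho>) + int (y i2 \<rho>) - int (y i3 \<rho>) + (\<Sum>i\<in>?I. c i * int (y i \<rho>))"
            proof -
              have II: "I = insert i1 (insert i2 (insert i3 ?I))" using i by auto
              show ?thesis by (subst II) (use I i i' in simp)
            qed
            then show ?thesis using pick(2)[OF yY True] True by (simp add: f_def g_def zy)
          qed (simp add: f_def g_def)
          then show "h y \<in> {(s, t) \<in> ?A \<times> ?A. g (f s) = f t}"
            using yS i pick(1)[OF yY] by (auto simp: h_def fun_eq_iff)
        qed
        show "finite {(s, t) \<in> ?A \<times> ?A. g (f s) = f t}"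
          by (rule finite_subset[of _ "?A \<times> ?A"]) auto
      qed
      also have "\<dots> \<le> card {(s, t) \<in> ?A \<times> ?A. f s = f t}"
        by (rule card_shifted_collisions_le[OF _ \<open>inj g\<close>]) simp
      also have "{(s, t) \<in> ?A \<times> ?A. f s = f t} = energy_pairs n B"
      proof -
        have "f (a, b) = f (a', b') \<longleftrightarrow> (\<forall>\<rho><n. a \<rho> + b \<rho> = a' \<rho> + b' \<rho>)" for a b a' b'
        proof -
          have "f (a, b) = f (a', b') \<longleftrightarrow> (\<forall>\<rho><n. int (a \<rho> + b \<rho>) = int (a' \<rho> + b' \<rho>))"
            by (auto simp: f_def fun_eq_iff)
          then show ?thesis by (simp only: of_nat_eq_iff)
        qed
        then show ?thesis by (auto simp: energy_pairs_def)
      qed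
      finally show "card ?F \<le> card (energy_pairs n B)" .
    qed
    then show ?thesis using I cI by (simp add: card_PiE)
  qed
  have "additive_tuples n B I \<subseteq> (\<Union>c\<in>?C. Y c)"
    unfolding additive_tuples_def good_def Y_def by blast
  then have "card (additive_tuples n B I) \<le> card (\<Union>c\<in>?C. Y c)"
    using finC I by (intro card_mono) (auto simp: Y_def)
  also have "\<dots> \<le> (\<Sum>c\<in>?C. card (Y c))" by (rule card_UN_le[OF finC])
  also have "\<dots> \<le> (\<Sum>c\<in>?C. card ?S ^ (card I - 3) * card (energy_pairs n B))"
    by (rule sum_mono) (rule fiber)
  also have "\<dots> \<le> 3 ^ J * (card ?S ^ (card I - 3) * card (energy_pairs n B))"
    using cardC by simp
  finally have "real (card (additive_tuples n B I)) \<le> real (3 ^ J * (card ?S ^ (card I - 3) * card (energy_pairs n B)))"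
    by (simp only: of_nat_le_iff)
  also have "\<dots> = 3 ^ J * real (card ?S) ^ (card I - 3) * real (card (energy_pairs n B))" by simp
  also have "\<dots> \<le> 3 ^ J * real (card ?S) ^ (card I - 3) *
       (chernoff_volume n B ^ 3 * (3 / 4 + (real n / real B)\<^sup>2) ^ n)"
    by (intro mult_left_mono card_energy_pairs_le n) auto
  finally show ?thesis .
qed

section \<open>Classification of relations\<close>

lemma fractional_relations_cong:
  "(\<And>i. i \<in> I \<Longrightarrow> v i = w i) \<Longrightarrow> fractional_relations R I v = fractional_relations R I w"
  unfolding fractional_relations_def by (intro Collect_cong) (simp cong: sum.cong)

lemma independent_rows_cong:
  assumes "\<And>i. i \<in> I \<Longrightarrow> v i = w i"
  shows "independent_rows R I v = independent_rows R I w"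
proof -
  have "(\<Sum>i\<in>I. c i * v i \<rho>) = (\<Sum>i\<in>I. c i * w i \<rho>)" for c \<rho>
    using assms by (intro sum.cong) auto
  then show ?thesis unfolding independent_rows_def by simp
qed

lemma homogeneous_restrict: "i \<in> I \<Longrightarrow> homogeneous n (restrict x I) i = homogeneous n x i"
  by (simp add: homogeneous_def fun_eq_iff)

lemma fractional_relations_restrict:
  "fractional_relations R I (homogeneous n (restrict x I)) = fractional_relations R I (homogeneous n x)"
  by (intro fractional_relations_cong homogeneous_restrict)

lemma bounded_basis_mono:
  "bounded_basis K R L I v \<Longrightarrow> K \<le> K' \<Longrightarrow> bounded_basis K' R L I v"
  unfolding bounded_basis_def bounded_combination_def by (meson order_trans)

text \<open>Steinitz exchange: solving for \<open>v i\<close> divides by \<open>c i\<close>, and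
  \<open>1 \<le> \<bar>c i\<bar>\<close> keeps the new coordinates
  \<open>a j - a i * c j / c i\<close> within \<open>K + K * K\<close>.\<close>

lemma bounded_basis_exchange:
  fixes v :: "'i \<Rightarrow> 'r \<Rightarrow> real"
  assumes bas: "bounded_basis K R L I v" and fin: "finite L" and l: "l \<in> L" "l \<notin> I" and i: "i \<in> I"
    and coef: "\<And>j. j \<in> I \<Longrightarrow> \<bar>c j\<bar> \<le> K" "\<And>\<rho>. \<rho> \<in> R \<Longrightarrow> v l \<rho> = (\<Sum>j\<in>I. c j * v j \<rho>)"
    and ci: "1 \<le> \<bar>c i\<bar>"
  shows "bounded_basis (K + K * K) R L (insert l (I - {i})) v"
proof -
  let ?J = "I - {i}"
  have IL: "I \<subseteq> L" using bas by (simp add: bounded_basis_def)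
  have finI: "finite I" using IL fin finite_subset by blast
  have lJ: "l \<notin> ?J" using l by simp
  have K: "1 \<le> K" using coef(1)[OF i] ci by linarith
  have ci0: "c i \<noteq> 0" using ci by auto
  obtain P where P: "P \<subseteq> R" "finite P" "card P \<le> card I"
      "\<And>a. (\<forall>\<rho>\<in>P. (\<Sum>j\<in>I. a j * v j \<rho>) = 0) \<Longrightarrow> (\<forall>j\<in>I. a j = 0)"
    using bas unfolding bounded_basis_def independent_rows_def by blast
  have sumJ: "(\<Sum>j\<in>insert l ?J. a j * v j \<rho>) = a l * v l \<rho> + (\<Sum>j\<in>?J. a j * v j \<rho>)" for a \<rho>
    using finI lJ by simp
  have sumI: "(\<Sum>j\<in>I. a j * v j \<rho>) = a i * v i \<rho> + (\<Sum>j\<in>?J. a j * v j \<rho>)" for a \<rho>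
    using finI i by (rule sum.remove)
  have "independent_rows R (insert l ?J) v"
    unfolding independent_rows_def
  proof (intro exI[of _ P] conjI allI impI)
    show "card P \<le> card (insert l ?J)"
      using P(3) finI lJ card.remove[OF finI i] by simp
    fix a assume a: "\<forall>\<rho>\<in>P. (\<Sum>j\<in>insert l ?J. a j * v j \<rho>) = 0"
    define b where "b j = a l * c j + (if j = i then 0 else a j)" for j
    have "\<forall>\<rho>\<in>P. (\<Sum>j\<in>I. b j * v j \<rho>) = 0"
    proof
      fix \<rho> assume \<rho>: "\<rho> \<in> P"
      have "(\<Sum>j\<in>?J. b j * v j \<rho>) = (\<Sum>j\<in>?J. a l * (c j * v j \<rho>) + a j * v j \<rho>)"
        by (intro sum.cong) (auto simp: b_def algebra_simps)
      also have "\<dots> = a l * (\<Sum>j\<in>?J. c j * v j \<rho>) + (\<Sum>j\<in>?J. a j * v j \<rho>)"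
        by (simp add: sum.distrib sum_distrib_left)
      finally have "(\<Sum>j\<in>I. b j * v j \<rho>) = a l * (\<Sum>j\<in>I. c j * v j \<rho>) + (\<Sum>j\<in>?J. a j * v j \<rho>)"
        unfolding sumI by (simp add: b_def algebra_simps)
      also have "\<dots> = 0"
      proof -
        have "\<rho> \<in> R" using \<rho> P(1) by blast
        then have "(\<Sum>j\<in>I. c j * v j \<rho>) = v l \<rho>" using coef(2) by simp
        then show ?thesis using a \<rho> unfolding sumJ by simp
      qed
      finally show "(\<Sum>j\<in>I. b j * v j \<rho>) = 0" .
    qed
    then have b0: "\<forall>j\<in>I. b j = 0" by (rule P(4))
    have "a l * c i = 0" using b0 i by (auto simp: b_def)
    then have al: "a l = 0" using ci0 by simp
    have "a j = 0" if "j \<in> ?J" for j using b0 that al by (auto simp: b_def)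
    then show "\<forall>j\<in>insert l ?J. a j = 0" using al by auto
  qed (use P in auto)
  moreover have "bounded_combination (K + K * K) R (insert l ?J) v (v m)" if m: "m \<in> L" for m
  proof -
    obtain a where a: "\<And>j. j \<in> I \<Longrightarrow> \<bar>a j\<bar> \<le> K" "\<And>\<rho>. \<rho> \<in> R \<Longrightarrow> v m \<rho> = (\<Sum>j\<in>I. a j * v j \<rho>)"
      using bas m unfolding bounded_basis_def bounded_combination_def by blast
    define b where "b j = (if j = l then a i / c i else a j - a i * c j / c i)" for j
    have quot: "\<bar>a i * t / c i\<bar> \<le> K * \<bar>t\<bar>" for t
    proof -
      have "\<bar>a i * t / c i\<bar> = \<bar>a i\<bar> * \<bar>t\<bar> / \<bar>c i\<bar>" by (simp add: abs_mult)
      also have "\<dots> \<le> \<bar>a i\<bar> * \<bar>t\<bar> / 1" using ci by (intro divide_left_mono) auto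
      also have "\<dots> \<le> K * \<bar>t\<bar>" using a(1)[OF i] by (simp add: mult_right_mono)
      finally show ?thesis .
    qed
    have "\<bar>b j\<bar> \<le> K + K * K" if "j \<in> insert l ?J" for j
    proof (cases "j = l")
      case True
      then have "\<bar>b j\<bar> \<le> K * \<bar>1\<bar>" using quot[of 1] by (simp add: b_def)
      then show ?thesis using K by (simp add: add_increasing2)
    next
      case False
      then have j: "j \<in> I" using that by auto
      have "\<bar>a i * c j / c i\<bar> \<le> K * \<bar>c j\<bar>" by (rule quot)
      also have "\<dots> \<le> K * K" using coef(1)[OF j] K by (intro mult_left_mono) auto
      finally show ?thesis using a(1)[OF j] False by (auto simp: b_def abs_if split: if_splits)
    qed
    moreover have "v m \<rho> = (\<Sum>j\<in>insert l ?J. b j * v j \<rho>)" if \<rho>: "\<rho> \<in> R" for \<rho>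
    proof -
      have "(\<Sum>j\<in>?J. b j * v j \<rho>) = (\<Sum>j\<in>?J. a j * v j \<rho> - a i / c i * (c j * v j \<rho>))"
        using lJ by (intro sum.cong) (auto simp: b_def algebra_simps)
      also have "\<dots> = (\<Sum>j\<in>?J. a j * v j \<rho>) - a i / c i * (\<Sum>j\<in>?J. c j * v j \<rho>)"
        by (simp add: sum_subtractf sum_distrib_left)
      finally have J: "(\<Sum>j\<in>?J. b j * v j \<rho>) = (\<Sum>j\<in>?J. a j * v j \<rho>) - a i / c i * (\<Sum>j\<in>?J. c j * v j \<rho>)" .
      have "(\<Sum>j\<in>insert l ?J. b j * v j \<rho>) = a i / c i * (c i * v i \<rho>) + (\<Sum>j\<in>?J. a j * v j \<rho>)"
        unfolding sumJ J coef(2)[OF \<rho>] sumI[of c] by (simp add: b_def algebra_simps)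
      also have "\<dots> = v m \<rho>" unfolding a(2)[OF \<rho>] sumI[of a] using ci0 by simp
      finally show ?thesis by simp
    qed
    ultimately show ?thesis unfolding bounded_combination_def by blast
  qed
  ultimately show ?thesis unfolding bounded_basis_def using IL l by auto
qed

lemma finite_fractional_relations_homogeneous:
  assumes "finite I" "\<And>i. i \<in> I \<Longrightarrow> x i \<in> simplex_points n B" "B > 0"
    and "independent_rows {..n} I (homogeneous n x)"
  shows "finite (fractional_relations {..n} I (homogeneous n x))"
proof (rule fractional_relations_card(1)[OF assms(1,4)])
  show "0 \<le> homogeneous n x i \<rho> \<and> homogeneous n x i \<rho> \<le> real B" if "i \<in> I" for i \<rho>
    using assms(2)[OF that] assms(3) by (rule homogeneous_bounds)
qed

lemma torsion_tupleI:
  fixes x :: "'i \<Rightarrow> nat \<Rightarrow> nat"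
  assumes "finite I" "\<And>i. i \<in> I \<Longrightarrow> x i \<in> simplex_points n B" "B > 0"
    and ind: "independent_rows {..n} I (homogeneous n x)"
    and c: "c \<in> fractional_relations {..n} I (homogeneous n x)" "i \<in> I" "c i \<noteq> 0"
  shows "restrict x I \<in> torsion_tuples n B I"
proof -
  let ?H = "fractional_relations {..n} I (homogeneous n x)"
  have fin: "finite ?H"
    by (rule finite_fractional_relations_homogeneous[OF assms(1-3) ind])
  have "c \<noteq> (\<lambda>i\<in>I. 0)" using c by auto
  then have "card {c, \<lambda>i\<in>I. 0} = 2" by simp
  moreover have "{c, \<lambda>i\<in>I. 0} \<subseteq> ?H" using c zero_fractional_relation by blast
  ultimately have "2 \<le> card ?H" using card_mono[OF fin] by metis
  then have "1 < card ?H" by simp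
  moreover have "independent_rows {..n} I (homogeneous n (restrict x I))"
    using ind independent_rows_cong[of I "homogeneous n (restrict x I)" "homogeneous n x"]
    by (simp add: homogeneous_restrict)
  ultimately show ?thesis
    using assms(2) unfolding torsion_tuples_def by (simp add: fractional_relations_restrict)
qed

text \<open>Without torsion all coordinates with respect to the basis are integers. One of absolute
  value at least 2 creates torsion after an exchange. Otherwise all are -1, 0 or 1 and add up to 1,
  so a coordinate -1 forces two coordinates 1 and thereby an additive relation. If no -1 occurs,
  every point outside the basis repeats a basis point. A basis point repeated nowhere would have a
  coefficient divisible by \<open>N\<close>, against \<open>0 < c l < N\<close>; hence every basis
  point is repeated and the basis comprises at most half of \<open>L\<close>.\<close>

lemma relation_classification:
  fixes x :: "'i \<Rightarrow> nat \<Rightarrow> nat" and n :: nat and L :: "'i set"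
  defines "v \<equiv> homogeneous n x"
  assumes L: "finite L" "x \<in> L \<rightarrow>\<^sub>E simplex_points n B" and B: "B > 0" and N: "N > 0"
    and c: "c \<in> modular_relations N {..n} L v" "\<And>l. l \<in> L \<Longrightarrow> c l > 0"
  defines "K0 \<equiv> real (elimination_bound (card L))"
  shows "\<exists>I. bounded_basis (K0 + K0 * K0) {..n} L I v \<and> (restrict x I \<in> torsion_tuples n B I \<or>
     card (fractional_relations {..n} I v) = 1 \<and> (restrict x I \<in> additive_tuples n B I \<or> 2 * card I \<le> card L))"
proof -
  have K0: "K0 \<ge> 0" by (simp add: K0_def)
  obtain I where bas: "bounded_basis K0 {..n} L I v"
    using bounded_basis_exists[OF L(1)] unfolding K0_def by blast
  have IL: "I \<subseteq> L" and ind: "independent_rows {..n} I v" using bas by (auto simp: bounded_basis_def)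
  have finI: "finite I" using IL L(1) finite_subset by blast
  have xS: "x l \<in> simplex_points n B" if "l \<in> L" for l using L(2) that by auto
  have bas': "bounded_basis (K0 + K0 * K0) {..n} L I v" using bas K0 by (auto intro: bounded_basis_mono)
  let ?H = "fractional_relations {..n} I v"
  have finH: "finite ?H"
    unfolding v_def
    by (rule finite_fractional_relations_homogeneous[OF finI _ B ind[unfolded v_def]]) (use xS IL in blast)
  have vI: "v i \<rho> \<in> \<int>" for i \<rho> by (simp add: v_def)
  show ?thesis
  proof (cases "card ?H = 1")
    case False
    have "card ?H \<noteq> 0" using finH zero_fractional_relation by (metis card_0_eq empty_iff)
    then have "card ?H > 1" using False by simp
    moreover have "independent_rows {..n} I (homogeneous n (restrict x I))"
      using ind independent_rows_cong[of I "homogeneous n (restrict x I)" "homogeneous n x"]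
      by (simp add: homogeneous_restrict v_def)
    ultimately have "restrict x I \<in> torsion_tuples n B I"
      using IL xS unfolding torsion_tuples_def v_def by (auto simp: fractional_relations_restrict)
    then show ?thesis using bas' by blast
  next
    case True
    then obtain h where "?H = {h}" by (auto simp: card_1_singleton_iff)
    then have H: "?H = {\<lambda>i\<in>I. 0}" using zero_fractional_relation[of I "{..n}" v] by simp
    have frac0: "a i \<in> \<int>"
      if "\<And>\<rho>. \<rho> \<in> {..n} \<Longrightarrow> (\<Sum>i\<in>I. a i * v i \<rho>) \<in> \<int>" "i \<in> I" for a i
    proof -
      have "(\<lambda>i\<in>I. frac (a i)) \<in> ?H" by (rule frac_fractional_relation) (use vI that in auto)
      then have "(\<lambda>i\<in>I. frac (a i)) = (\<lambda>i\<in>I. 0)" unfolding H by simp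
      from fun_cong[OF this, of i] show ?thesis using that(2) by (simp add: frac_eq_0_iff)
    qed
    have "\<forall>l\<in>L. \<exists>a. (\<forall>i\<in>I. \<bar>a i\<bar> \<le> K0) \<and> (\<forall>\<rho>\<in>{..n}. v l \<rho> = (\<Sum>i\<in>I. a i * v i \<rho>))"
      using bas unfolding bounded_basis_def bounded_combination_def by blast
    from bchoice[OF this] obtain a where a: "\<And>l i. l \<in> L \<Longrightarrow> i \<in> I \<Longrightarrow> \<bar>a l i\<bar> \<le> K0"
      "\<And>l \<rho>. l \<in> L \<Longrightarrow> \<rho> \<in> {..n} \<Longrightarrow> v l \<rho> = (\<Sum>i\<in>I. a l i * v i \<rho>)" by blast
    have aI: "a l i \<in> \<int>" if "l \<in> L" "i \<in> I" for l i
    proof (rule frac0[OF _ that(2)])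
      fix \<rho> assume "\<rho> \<in> {..n}"
      then have "(\<Sum>i\<in>I. a l i * v i \<rho>) = v l \<rho>" using a(2)[OF that(1)] by simp
      then show "(\<Sum>i\<in>I. a l i * v i \<rho>) \<in> \<int>" using vI by simp
    qed
    \<comment> \<open>This is row \<open>n\<close>, the additional coordinate 1.\<close>
    have sum1: "(\<Sum>i\<in>I. a l i) = 1" if "l \<in> L" for l
      using a(2)[OF that, of n] by (simp add: v_def homogeneous_def)
    show ?thesis
    proof (cases "\<exists>l\<in>L - I. \<exists>i\<in>I. 2 \<le> \<bar>a l i\<bar>")
      case True
      \<comment> \<open>Exchanging \<open>i\<close> for \<open>l\<close> turns the large coefficient into a denominator, that is, into torsion.\<close>
      then obtain l i where li: "l \<in> L" "l \<notin> I" "i \<in> I" "2 \<le> \<bar>a l i\<bar>" by blast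
      let ?J = "insert l (I - {i})"
      have bas'': "bounded_basis (K0 + K0 * K0) {..n} L ?J v"
        by (rule bounded_basis_exchange[OF bas L(1) li(1-3), of "a l"]) (use a li in auto)
      have JL: "?J \<subseteq> L" and ind': "independent_rows {..n} ?J v"
        using bas'' by (auto simp: bounded_basis_def)
      have finJ: "finite ?J" using finI by simp
      define b where "b j = (if j = l then 1 / a l i else - a l j / a l i)" for j
      have "(\<Sum>j\<in>?J. b j * v j \<rho>) \<in> \<int>" if \<rho>: "\<rho> \<in> {..n}" for \<rho>
      proof -
        have "(\<Sum>j\<in>I - {i}. b j * v j \<rho>) = (\<Sum>j\<in>I - {i}. - (1 / a l i) * (a l j * v j \<rho>))"
          using li by (intro sum.cong) (auto simp: b_def)
        also have "\<dots> = - (1 / a l i) * (\<Sum>j\<in>I - {i}. a l j * v j \<rho>)" by (rule sum_distrib_left[symmetric])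
        finally have "(\<Sum>j\<in>?J. b j * v j \<rho>) = 1 / a l i * (v l \<rho> - (\<Sum>j\<in>I - {i}. a l j * v j \<rho>))"
          using finI li by (simp add: b_def right_diff_distrib)
        also have "v l \<rho> = a l i * v i \<rho> + (\<Sum>j\<in>I - {i}. a l j * v j \<rho>)"
          using a(2)[OF li(1) \<rho>] sum.remove[OF finI li(3), of "\<lambda>j. a l j * v j \<rho>"] by simp
        finally have "(\<Sum>j\<in>?J. b j * v j \<rho>) = v i \<rho>" using li(4) by simp
        then show ?thesis using vI by simp
      qed
      then have "(\<lambda>j\<in>?J. frac (b j)) \<in> fractional_relations {..n} ?J (homogeneous n x)"
        using vI unfolding v_def by (intro frac_fractional_relation) auto
      moreover have "(\<lambda>j\<in>?J. frac (b j)) l \<noteq> 0"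
      proof -
        have "1 / a l i \<notin> \<int>"
        proof
          assume "1 / a l i \<in> \<int>"
          then obtain z where z: "1 / a l i = of_int z" by (rule Ints_cases)
          have "\<bar>1 / a l i\<bar> < 1" "1 / a l i \<noteq> 0" using li(4) by (auto simp: divide_less_eq)
          then show False unfolding z by auto
        qed
        then show ?thesis by (simp add: b_def frac_eq_0_iff)
      qed
      ultimately have "restrict x ?J \<in> torsion_tuples n B ?J"
        using torsion_tupleI[OF finJ _ B ind'[unfolded v_def], of _ l] xS JL by blast
      then show ?thesis using bas'' by blast
    next
      case False
      have small: "a l i \<in> {-1, 0, 1}" if "l \<in> L - I" "i \<in> I" for l i
      proof -
        have "a l i \<in> \<int>" using aI that by blast
        then obtain z where z: "a l i = of_int z" by (rule Ints_cases)
        have "\<bar>a l i\<bar> < 2" using False that by (meson not_le)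
        then have "\<bar>z\<bar> < 2" unfolding z by linarith
        then have "z = -1 \<or> z = 0 \<or> z = 1" by linarith
        then show ?thesis unfolding z by auto
      qed
      show ?thesis
      proof (cases "\<exists>l\<in>L - I. \<exists>i\<in>I. a l i = -1")
        case True
        then obtain l i3 where l: "l \<in> L - I" "i3 \<in> I" "a l i3 = -1" by blast
        define b where "b = (\<lambda>i\<in>I. \<lfloor>a l i\<rfloor>)"
        have ab: "a l i = of_int (b i)" if "i \<in> I" for i
        proof -
          have "a l i \<in> \<int>" using aI[of l i] l that by blast
          then obtain z where "a l i = of_int z" by (rule Ints_cases)
          then show ?thesis using that by (simp add: b_def)
        qed
        have bE: "b \<in> I \<rightarrow>\<^sub>E {-1, 0, 1}"
        proof (rule PiE_I)
          fix i assume i: "i \<in> I"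
          have "of_int (b i) \<in> {-1, 0, 1 :: real}" using small[OF l(1) i] ab[OF i] by simp
          then show "b i \<in> {-1, 0, 1}" by simp linarith
        qed (simp add: b_def)
        have "\<exists>i1\<in>I. \<exists>i2\<in>I. i1 \<noteq> i2 \<and> b i1 = 1 \<and> b i2 = 1"
        proof (rule ccontr)
          assume no: "\<not> ?thesis"
          let ?P = "{i\<in>I. b i = 1}"
          have "card ?P \<le> 1" using no finI by (subst One_nat_def, subst card_le_Suc0_iff_eq) auto
          have "(\<Sum>i\<in>I. b i) = b i3 + (\<Sum>i\<in>I - {i3}. b i)" using finI l(2) by (rule sum.remove)
          also have "(\<Sum>i\<in>I - {i3}. b i) \<le> (\<Sum>i\<in>I - {i3}. if b i = 1 then 1 else 0)"
          proof (rule sum_mono)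
            fix i assume "i \<in> I - {i3}"
            then have "b i \<in> {-1, 0, 1}" using PiE_mem[OF bE, of i] by simp
            then show "b i \<le> (if b i = 1 then 1 else 0)" by auto
          qed
          also have "\<dots> \<le> (\<Sum>i\<in>I. if b i = 1 then 1 else 0)"
            using finI by (intro sum_mono2) auto
          also have "\<dots> = int (card ?P)" using finI by (simp add: sum.If_cases Int_def)
          also have "\<dots> \<le> 1" using \<open>card ?P \<le> 1\<close> by simp
          also have "b i3 = -1" using ab[OF l(2)] l(3) by linarith
          finally have "(\<Sum>i\<in>I. b i) \<le> 0" by simp
          moreover have "of_int (\<Sum>i\<in>I. b i) = (1::real)" using sum1[of l] l(1) ab by simp
          ultimately show False by linarith
        qed
        moreover have "b i3 = -1" using ab[OF l(2)] l(3) by linarith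
        moreover have "\<forall>\<rho><n. int (x l \<rho>) = (\<Sum>i\<in>I. b i * int (restrict x I i \<rho>))"
        proof (intro allI impI)
          fix \<rho> assume \<rho>: "\<rho> < n"
          have "real (x l \<rho>) = (\<Sum>i\<in>I. a l i * real (x i \<rho>))"
            using a(2)[of l \<rho>] l(1) \<rho> by (simp add: v_def homogeneous_def)
          also have "\<dots> = of_int (\<Sum>i\<in>I. b i * int (restrict x I i \<rho>))" using ab by simp
          finally show "int (x l \<rho>) = (\<Sum>i\<in>I. b i * int (restrict x I i \<rho>))" by linarith
        qed
        moreover have "restrict x I \<in> I \<rightarrow>\<^sub>E simplex_points n B" using xS IL by auto
        moreover have "x l \<in> simplex_points n B" using xS l(1) by blast
        ultimately have "restrict x I \<in> additive_tuples n B I"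
          using bE l(2) unfolding additive_tuples_def mem_Collect_eq by blast
        then show ?thesis using bas' \<open>card ?H = 1\<close> by blast
      next
        case False
        have "\<exists>i\<in>I. \<forall>j\<in>I. a l j = (if j = i then 1 else 0)" if l: "l \<in> L - I" for l
        proof -
          have a01: "a l i = 0 \<or> a l i = 1" if "i \<in> I" for i
            using small[OF l that] False l that by auto
          have "\<exists>i\<in>I. a l i \<noteq> 0" using sum1[of l] l by (metis DiffD1 sum.neutral zero_neq_one)
          then obtain i where i: "i \<in> I" "a l i = 1" using a01 by blast
          have "(\<Sum>j\<in>I - {i}. a l j) = 0"
            using sum1[of l] l i sum.remove[OF finI i(1), of "a l"] by simp
          then have "\<forall>j\<in>I - {i}. a l j = 0"
            using a01 finI by (subst (asm) sum_nonneg_eq_0_iff) (auto, metis order_refl zero_le_one)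
          then show ?thesis using i by (intro bexI[of _ i]) auto
        qed
        then obtain s where s: "\<And>l. l \<in> L - I \<Longrightarrow> s l \<in> I"
          "\<And>l j. l \<in> L - I \<Longrightarrow> j \<in> I \<Longrightarrow> a l j = (if j = s l then 1 else 0)" by metis
        have vs: "v l \<rho> = v (s l) \<rho>" if "l \<in> L - I" "\<rho> \<in> {..n}" for l \<rho>
        proof -
          have "v l \<rho> = (\<Sum>j\<in>I. (if j = s l then 1 else 0) * v j \<rho>)"
            using a(2)[of l \<rho>] that s(2)[OF that(1)] by simp
          also have "\<dots> = v (s l) \<rho>"
            using finI s(1)[OF that(1)] by (simp add: if_distrib[of "\<lambda>t. t * _"] cong: if_cong)
          finally show ?thesis .
        qed
        have "I \<subseteq> s ` (L - I)"
        proof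
          fix i assume i: "i \<in> I"
          show "i \<in> s ` (L - I)"
          proof (rule ccontr)
            assume no: "i \<notin> s ` (L - I)"
            \<comment> \<open>The coefficients of the repetitions are collected at the basis point
              they repeat. Nothing is collected at \<open>i\<close>, so \<open>d i\<close> is
              \<open>c i / N\<close>.\<close>
            define e where "e j = (\<Sum>l\<in>{l\<in>L - I. s l = j}. real (c l))" for j
            define d where "d j = (real (c j) + e j) / real N" for j
            have "d i \<in> \<int>"
            proof (rule frac0[OF _ i])
              fix \<rho> assume \<rho>: "\<rho> \<in> {..n}"
              have "(\<Sum>l\<in>L - I. real (c l) * v l \<rho>) = (\<Sum>l\<in>L - I. real (c l) * v (s l) \<rho>)"
                using vs \<rho> by (intro sum.cong) auto
              also have "\<dots> = (\<Sum>j\<in>I. \<Sum>l\<in>{l\<in>L - I. s l = j}. real (c l) * v (s l) \<rho>)"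
                using L(1) finI s(1) by (intro sum.group[symmetric]) auto
              also have "\<dots> = (\<Sum>j\<in>I. e j * v j \<rho>)"
                unfolding e_def by (simp add: sum_distrib_right)
              finally have "(\<Sum>l\<in>L. real (c l) * v l \<rho>) = (\<Sum>j\<in>I. (real (c j) + e j) * v j \<rho>)"
                using sum.subset_diff[OF IL L(1), of "\<lambda>l. real (c l) * v l \<rho>"]
                by (simp add: sum.distrib distrib_right)
              then have "(\<Sum>l\<in>L. real (c l) * v l \<rho>) / real N = (\<Sum>j\<in>I. d j * v j \<rho>)"
                by (simp add: d_def sum_divide_distrib)
              moreover have "(\<Sum>l\<in>L. real (c l) * v l \<rho>) / real N \<in> \<int>"
                using c(1) \<rho> unfolding modular_relations_def by blast
              ultimately show "(\<Sum>j\<in>I. d j * v j \<rho>) \<in> \<int>" by simp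
            qed
            moreover have "e i = 0" unfolding e_def using no by (intro sum.neutral) blast
            ultimately have "real (c i) / real N \<in> \<int>" unfolding d_def by simp
            then have "N dvd c i" using N by (rule divide_Ints_imp_dvd)
            moreover have "0 < c i" "c i < N" using c i IL by (auto simp: modular_relations_def)
            ultimately show False by (auto dest: dvd_imp_le)
          qed
        qed
        then have "card I \<le> card (L - I)" using L(1) by (meson finite_Diff surj_card_le)
        then have "2 * card I \<le> card L" using IL L(1) card_mono[OF L(1) IL] by (simp add: card_Diff_subset finI)
        then show ?thesis using bas' \<open>card ?H = 1\<close> by blast
      qed
    qed
  qed
qed

section \<open>Counting tuples together with their relations\<close>

definition relation_pairs :: "nat \<Rightarrow> nat \<Rightarrow> nat \<Rightarrow> 'i set \<Rightarrow> (('i \<Rightarrow> nat \<Rightarrow> nat) \<times> ('i \<Rightarrow> nat)) set" where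
  "relation_pairs n B N L = (SIGMA x:(L \<rightarrow>\<^sub>E simplex_points n B).
     {c \<in> modular_relations N {..n} L (homogeneous n x). \<forall>l\<in>L. 0 < c l})"

lemma finite_modular_relations [simp]: "finite L \<Longrightarrow> finite (modular_relations N R L v)"
  unfolding modular_relations_def
  by (rule finite_subset[OF _ finite_PiE[of L "\<lambda>_. {..<N}"]]) auto

text \<open>The coordinates of a further point split into integer parts, with at most
  \<open>2 * K + 1\<close> values each, and fractional parts, which form a fractional relation of
  \<open>y\<close>.\<close>

lemma card_bounded_extensions_le:
  fixes y :: "'i \<Rightarrow> nat \<Rightarrow> nat" and n K :: nat
  defines "H \<equiv> \<lambda>I. fractional_relations {..n} I (homogeneous n y)"
  assumes L: "finite L" "I \<subseteq> L" and fin: "finite (H I)"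
  shows "card {x \<in> L \<rightarrow>\<^sub>E simplex_points n B. restrict x I = y \<and>
       bounded_basis (real K) {..n} L I (homogeneous n x)}
     \<le> ((2 * K + 1) ^ card I * card (H I)) ^ card (L - I)"
proof -
  let ?S = "simplex_points n B"
  define hom where "hom w \<rho> = (if \<rho> < n then real (w \<rho>) else 1)" for w :: "nat \<Rightarrow> nat" and \<rho>
  have hom: "homogeneous n x i = hom (x i)" for x :: "'i \<Rightarrow> nat \<Rightarrow> nat" and i
    by (simp add: homogeneous_def hom_def fun_eq_iff)
  have finI: "finite I" using L finite_subset by blast
  define G where "G = {w \<in> ?S. bounded_combination (real K) {..n} I (homogeneous n y) (hom w)}"
  have finG: "finite G" by (simp add: G_def)
  define co where "co w = (SOME c. (\<forall>i\<in>I. \<bar>c i\<bar> \<le> real K) \<and>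
      (\<forall>\<rho>\<in>{..n}. hom w \<rho> = (\<Sum>i\<in>I. c i * homogeneous n y i \<rho>)))" for w
  have co: "\<And>i. i \<in> I \<Longrightarrow> \<bar>co w i\<bar> \<le> real K"
    "\<And>\<rho>. \<rho> \<le> n \<Longrightarrow> hom w \<rho> = (\<Sum>i\<in>I. co w i * homogeneous n y i \<rho>)" if "w \<in> G" for w
  proof -
    have "\<exists>c. (\<forall>i\<in>I. \<bar>c i\<bar> \<le> real K) \<and> (\<forall>\<rho>\<in>{..n}. hom w \<rho> = (\<Sum>i\<in>I. c i * homogeneous n y i \<rho>))"
      using that unfolding G_def bounded_combination_def by blast
    then have "(\<forall>i\<in>I. \<bar>co w i\<bar> \<le> real K) \<and> (\<forall>\<rho>\<in>{..n}. hom w \<rho> = (\<Sum>i\<in>I. co w i * homogeneous n y i \<rho>))"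
      unfolding co_def by (rule someI_ex)
    then show "\<And>i. i \<in> I \<Longrightarrow> \<bar>co w i\<bar> \<le> real K"
      "\<And>\<rho>. \<rho> \<le> n \<Longrightarrow> hom w \<rho> = (\<Sum>i\<in>I. co w i * homogeneous n y i \<rho>)" by auto
  qed
  define g where "g w = ((\<lambda>i\<in>I. \<lfloor>co w i\<rfloor>), (\<lambda>i\<in>I. frac (co w i)))" for w
  have "card G \<le> card ((I \<rightarrow>\<^sub>E {- int K..int K}) \<times> H I)"
  proof (rule card_inj_on_le[of g])
    show "inj_on g G"
    proof (rule inj_onI)
      fix w w' assume w: "w \<in> G" "w' \<in> G" "g w = g w'"
      have "co w i = co w' i" if "i \<in> I" for i
      proof -
        have "(\<lambda>i\<in>I. \<lfloor>co w i\<rfloor>) = (\<lambda>i\<in>I. \<lfloor>co w' i\<rfloor>)" "(\<lambda>i\<in>I. frac (co w i)) = (\<lambda>i\<in>I. frac (co w' i))"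
          using w(3) by (simp_all add: g_def)
        from fun_cong[OF this(1), of i] fun_cong[OF this(2), of i]
        show ?thesis using that by (simp add: frac_def)
      qed
      then have "hom w \<rho> = hom w' \<rho>" if "\<rho> \<le> n" for \<rho>
        using co(2)[OF w(1) that] co(2)[OF w(2) that] by simp
      from this[OF less_imp_le] have "w \<rho> = w' \<rho>" if "\<rho> < n" for \<rho>
        using that by (simp add: hom_def)
      then show "w = w'" using w(1,2)
        by (intro extensionalityI[of _ "{..<n}"]) (auto simp: G_def simplex_points_def PiE_def)
    qed
    show "g ` G \<subseteq> (I \<rightarrow>\<^sub>E {- int K..int K}) \<times> H I"
    proof (rule image_subsetI)
      fix w assume w: "w \<in> G"
      have "\<lfloor>co w i\<rfloor> \<in> {- int K..int K}" if "i \<in> I" for i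
        using co(1)[OF w that] by (simp add: abs_le_iff le_floor_iff floor_le_iff)
      moreover have "(\<lambda>i\<in>I. frac (co w i)) \<in> H I"
        unfolding H_def
      proof (rule frac_fractional_relation)
        fix \<rho> assume "\<rho> \<in> {..n}"
        then have "(\<Sum>i\<in>I. co w i * homogeneous n y i \<rho>) = hom w \<rho>" using co(2)[OF w] by simp
        then show "(\<Sum>i\<in>I. co w i * homogeneous n y i \<rho>) \<in> \<int>" by (simp add: hom_def)
      qed simp
      ultimately show "g w \<in> (I \<rightarrow>\<^sub>E {- int K..int K}) \<times> H I" by (simp add: g_def)
    qed
    show "finite ((I \<rightarrow>\<^sub>E {- int K..int K}) \<times> H I)" using finI fin by (auto intro: finite_PiE)
  qed
  also have "\<dots> = (2 * K + 1) ^ card I * card (H I)"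
  proof -
    have "nat (1 + (int K + int K)) = 2 * K + 1" by simp
    then show ?thesis using finI by (simp add: card_PiE card_cartesian_product add.commute)
  qed
  finally have cardG: "card G \<le> (2 * K + 1) ^ card I * card (H I)" .
  let ?X = "{x \<in> L \<rightarrow>\<^sub>E ?S. restrict x I = y \<and> bounded_basis (real K) {..n} L I (homogeneous n x)}"
  have "card ?X \<le> card ((L - I) \<rightarrow>\<^sub>E G)"
  proof (rule card_inj_on_le[of "\<lambda>x. restrict x (L - I)"])
    show "inj_on (\<lambda>x. restrict x (L - I)) ?X"
    proof (rule inj_onI)
      fix x x' assume x: "x \<in> ?X" "x' \<in> ?X" "restrict x (L - I) = restrict x' (L - I)"
      show "x = x'"
        by (rule eq_if_restrict_eq[OF _ _ _ x(3)]) (use x(1,2) in \<open>auto simp: PiE_def\<close>)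
    qed
    show "(\<lambda>x. restrict x (L - I)) ` ?X \<subseteq> (L - I) \<rightarrow>\<^sub>E G"
    proof (rule image_subsetI)
      fix x assume x: "x \<in> ?X"
      have "x l \<in> G" if l: "l \<in> L" for l
      proof -
        have y: "homogeneous n y i = homogeneous n x i" if "i \<in> I" for i
          using x that homogeneous_restrict[of i I n x] by auto
        have "bounded_combination (real K) {..n} I (homogeneous n x) (hom (x l))"
          using x l unfolding bounded_basis_def hom by blast
        then have "bounded_combination (real K) {..n} I (homogeneous n y) (hom (x l))"
          unfolding bounded_combination_def using y by (simp cong: sum.cong)
        then show ?thesis using x l by (auto simp: G_def)
      qed
      then show "restrict x (L - I) \<in> (L - I) \<rightarrow>\<^sub>E G" by auto
    qed
    show "finite ((L - I) \<rightarrow>\<^sub>E G)" using L finG by (auto intro: finite_PiE)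
  qed
  also have "\<dots> = card G ^ card (L - I)" using L by (simp add: card_PiE)
  also have "\<dots> \<le> ((2 * K + 1) ^ card I * card (H I)) ^ card (L - I)"
    using cardG by (intro power_mono) auto
  finally show ?thesis .
qed

text \<open>Let h be the number of fractional relations of a basis. There are at most a constant
  times \<open>h ^ card (L - I)\<close> extensions to all of \<open>L\<close>, and each admits at
  most \<open>N ^ card (L - I) * h\<close> modular relations; together this explains the exponent
  \<open>J + 1\<close>. In the two cases without torsion h is 1 and only tuples have to be
  counted.\<close>

lemma card_relation_pairs_le:
  fixes L :: "'i set"
  assumes L: "finite L" and B: "B > 0" and N: "N > 0"
  defines "J \<equiv> card L" and "K \<equiv> elimination_bound (card L) + elimination_bound (card L) * elimination_bound (card L)"
  shows "card (relation_pairs n B N L) \<le> (\<Sum>I\<in>Pow L. N ^ card (L - I) * (2 * K + 1) ^ (J * J) *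
     ((\<Sum>y\<in>torsion_tuples n B I. card (fractional_relations {..n} I (homogeneous n y)) ^ (J + 1)) +
      card (additive_tuples n B I) + (if 2 * card I \<le> J then card (simplex_points n B) ^ card I else 0)))"
proof -
  let ?S = "simplex_points n B"
  define h where "h I y = card (fractional_relations {..n} I (homogeneous n y))" for I and y :: "'i \<Rightarrow> nat \<Rightarrow> nat"
  define A2 where "A2 I = {y \<in> additive_tuples n B I. h I y = 1}" for I
  define A3 where "A3 I = {y \<in> I \<rightarrow>\<^sub>E ?S. h I y = 1 \<and> 2 * card I \<le> J}" for I :: "'i set"
  define Good where "Good I = torsion_tuples n B I \<union> A2 I \<union> A3 I" for I
  define X where "X I y = {x \<in> L \<rightarrow>\<^sub>E ?S. restrict x I = y \<and> bounded_basis (real K) {..n} L I (homogeneous n x)}" for I y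
  define Z where "Z I = (SIGMA x:(\<Union>y\<in>Good I. X I y). modular_relations N {..n} L (homogeneous n x))" for I
  have finX: "finite (X I y)" for I y using L by (simp add: X_def)
  have fin: "finite (A2 I)" "finite (A3 I)" "finite (Good I)" if "I \<subseteq> L" for I
    using finite_subset[OF that L] by (simp_all add: A2_def A3_def Good_def)
  have hpos: "finite (fractional_relations {..n} I (homogeneous n y)) \<and> h I y \<ge> 1" if "y \<in> Good I" for I y
  proof -
    have "h I y \<ge> 1" using that by (auto simp: Good_def torsion_tuples_def A2_def A3_def h_def)
    then show ?thesis unfolding h_def by (metis card.infinite not_one_le_zero)
  qed
  have sub: "relation_pairs n B N L \<subseteq> (\<Union>I\<in>Pow L. Z I)"
  proof
    fix p assume p: "p \<in> relation_pairs n B N L"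
    obtain x c where xc: "p = (x, c)" "x \<in> L \<rightarrow>\<^sub>E ?S" "c \<in> modular_relations N {..n} L (homogeneous n x)"
        "\<And>l. l \<in> L \<Longrightarrow> 0 < c l"
      using p by (auto simp: relation_pairs_def)
    obtain I where bas: "bounded_basis (real K) {..n} L I (homogeneous n x)"
      and I: "restrict x I \<in> torsion_tuples n B I \<or>
        h I x = 1 \<and> (restrict x I \<in> additive_tuples n B I \<or> 2 * card I \<le> J)"
      using relation_classification[OF L xc(2) B N xc(3,4)] unfolding K_def J_def h_def by auto
    have IL: "I \<subseteq> L" using bas by (simp add: bounded_basis_def)
    have "h I (restrict x I) = h I x" unfolding h_def by (simp add: fractional_relations_restrict)
    moreover have "restrict x I \<in> I \<rightarrow>\<^sub>E ?S" using xc(2) IL by auto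
    ultimately have "restrict x I \<in> Good I" using I by (auto simp: Good_def A2_def A3_def)
    moreover have "x \<in> X I (restrict x I)" using xc(2) bas by (simp add: X_def)
    ultimately have "(x, c) \<in> Z I" using xc(3) by (auto simp: Z_def)
    then show "p \<in> (\<Union>I\<in>Pow L. Z I)" using IL xc(1) by blast
  qed
  have Zle: "card (Z I) \<le> N ^ card (L - I) * (2 * K + 1) ^ (J * J) * (\<Sum>y\<in>Good I. h I y ^ (J + 1))"
    if IL: "I \<subseteq> L" for I
  proof -
    have cI: "card I \<le> J" "card (L - I) \<le> J"
      using IL L card_mono[OF L] unfolding J_def by auto
    have "card (Z I) = (\<Sum>x\<in>(\<Union>y\<in>Good I. X I y). card (modular_relations N {..n} L (homogeneous n x)))"
      unfolding Z_def using L finX fin(3)[OF IL] by (intro card_SigmaI) auto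
    also have "\<dots> = (\<Sum>y\<in>Good I. \<Sum>x\<in>X I y. card (modular_relations N {..n} L (homogeneous n x)))"
      using finX fin(3)[OF IL] by (intro sum.UNION_disjoint) (auto simp: X_def)
    also have "\<dots> \<le> (\<Sum>y\<in>Good I. N ^ card (L - I) * (2 * K + 1) ^ (J * J) * h I y ^ (J + 1))"
    proof (rule sum_mono)
      fix y assume y: "y \<in> Good I"
      have each: "card (modular_relations N {..n} L (homogeneous n x)) \<le> N ^ card (L - I) * h I y" if x: "x \<in> X I y" for x
      proof -
        have y: "y = restrict x I" using x by (simp add: X_def)
        have eq: "fractional_relations {..n} I (homogeneous n x) = fractional_relations {..n} I (homogeneous n y)"
          unfolding y by (rule fractional_relations_restrict[symmetric])
        show ?thesis
          using modular_relations_card[OF L IL, of "{..n}" "homogeneous n x" N] hpos[OF \<open>y \<in> Good I\<close>] N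
          unfolding h_def eq by simp
      qed
      have "(\<Sum>x\<in>X I y. card (modular_relations N {..n} L (homogeneous n x))) \<le> card (X I y) * (N ^ card (L - I) * h I y)"
        using sum_bounded_above[of "X I y" _ "N ^ card (L - I) * h I y", OF each] by simp
      also have "\<dots> \<le> ((2 * K + 1) ^ card I * h I y) ^ card (L - I) * (N ^ card (L - I) * h I y)"
        using card_bounded_extensions_le[OF L IL, of n y B K] hpos[OF y]
        unfolding X_def h_def by (intro mult_right_mono) auto
      also have "\<dots> = N ^ card (L - I) * (2 * K + 1) ^ (card I * card (L - I)) * h I y ^ (card (L - I) + 1)"
        by (simp add: power_mult_distrib power_mult mult.commute mult.left_commute)
      also have "\<dots> \<le> N ^ card (L - I) * (2 * K + 1) ^ (J * J) * h I y ^ (J + 1)"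
        using cI hpos[OF y] N by (intro mult_mono power_increasing) auto
      finally show "(\<Sum>x\<in>X I y. card (modular_relations N {..n} L (homogeneous n x))) \<le>
          N ^ card (L - I) * (2 * K + 1) ^ (J * J) * h I y ^ (J + 1)" .
    qed
    finally show ?thesis by (simp add: sum_distrib_left)
  qed
  have Goodle: "(\<Sum>y\<in>Good I. h I y ^ (J + 1)) \<le> (\<Sum>y\<in>torsion_tuples n B I. h I y ^ (J + 1)) +
      card (additive_tuples n B I) + (if 2 * card I \<le> J then card ?S ^ card I else 0)" if IL: "I \<subseteq> L" for I
  proof -
    have finI: "finite I" using finite_subset[OF IL L] .
    have un: "(\<Sum>y\<in>P \<union> Q. h I y ^ (J + 1)) \<le> (\<Sum>y\<in>P. h I y ^ (J + 1)) + (\<Sum>y\<in>Q. h I y ^ (J + 1))"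
      if "finite P" "finite Q" for P Q
      using sum.union_inter[OF that, of "\<lambda>y. h I y ^ (J + 1)"] by linarith
    have "(\<Sum>y\<in>A2 I. h I y ^ (J + 1)) = card (A2 I)" by (simp add: A2_def)
    also have "\<dots> \<le> card (additive_tuples n B I)" using finI by (intro card_mono) (auto simp: A2_def)
    finally have 2: "(\<Sum>y\<in>A2 I. h I y ^ (J + 1)) \<le> card (additive_tuples n B I)" .
    have "(\<Sum>y\<in>A3 I. h I y ^ (J + 1)) = card (A3 I)" by (simp add: A3_def)
    also have "\<dots> \<le> (if 2 * card I \<le> J then card (I \<rightarrow>\<^sub>E ?S) else 0)"
      using finI by (auto simp: A3_def intro!: card_mono)
    also have "card (I \<rightarrow>\<^sub>E ?S) = card ?S ^ card I" using finI by (simp add: card_PiE)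
    finally have 3: "(\<Sum>y\<in>A3 I. h I y ^ (J + 1)) \<le> (if 2 * card I \<le> J then card ?S ^ card I else 0)" .
    have "(\<Sum>y\<in>Good I. h I y ^ (J + 1)) \<le> (\<Sum>y\<in>torsion_tuples n B I \<union> A2 I. h I y ^ (J + 1)) + (\<Sum>y\<in>A3 I. h I y ^ (J + 1))"
      unfolding Good_def by (rule un) (use finI fin[OF IL] in auto)
    also have "(\<Sum>y\<in>torsion_tuples n B I \<union> A2 I. h I y ^ (J + 1)) \<le>
       (\<Sum>y\<in>torsion_tuples n B I. h I y ^ (J + 1)) + (\<Sum>y\<in>A2 I. h I y ^ (J + 1))"
      by (rule un) (use finI fin[OF IL] in auto)
    finally show ?thesis using 2 3 by linarith
  qed
  have finZ: "finite (Z I)" if "I \<subseteq> L" for I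
    unfolding Z_def using L finX fin(3)[OF that] by auto
  have "card (relation_pairs n B N L) \<le> card (\<Union>I\<in>Pow L. Z I)"
    using sub finZ L by (intro card_mono) auto
  also have "\<dots> \<le> (\<Sum>I\<in>Pow L. card (Z I))" by (rule card_UN_le) (use L in simp)
  also have "\<dots> \<le> (\<Sum>I\<in>Pow L. N ^ card (L - I) * (2 * K + 1) ^ (J * J) *
     ((\<Sum>y\<in>torsion_tuples n B I. h I y ^ (J + 1)) +
      card (additive_tuples n B I) + (if 2 * card I \<le> J then card ?S ^ card I else 0)))"
  proof (rule sum_mono)
    fix I assume "I \<in> Pow L"
    then have IL: "I \<subseteq> L" by simp
    show "card (Z I) \<le> N ^ card (L - I) * (2 * K + 1) ^ (J * J) *
     ((\<Sum>y\<in>torsion_tuples n B I. h I y ^ (J + 1)) +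
      card (additive_tuples n B I) + (if 2 * card I \<le> J then card ?S ^ card I else 0))"
      by (rule order_trans[OF Zle[OF IL]]) (intro mult_left_mono Goodle[OF IL], simp)
  qed
  finally show ?thesis unfolding h_def .
qed

text \<open>Ensures that the difference \<open>card I - 3\<close> in the count of additive tuples is
  not truncated.\<close>

lemma additive_tuples_card_ge:
  assumes "finite I" "additive_tuples n B I \<noteq> {}"
  shows "3 \<le> card I"
proof -
  obtain c :: "'a \<Rightarrow> int" and i1 i2 i3 where i: "i1 \<in> I" "i2 \<in> I" "i3 \<in> I" "i1 \<noteq> i2" "c i1 = 1" "c i2 = 1" "c i3 = -1"
    using assms(2) unfolding additive_tuples_def by blast
  then have "i3 \<noteq> i1" "i3 \<noteq> i2" by auto
  then have "card {i1, i2, i3} = 3" using i by auto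
  moreover have "card {i1, i2, i3} \<le> card I" using i by (intro card_mono assms(1)) auto
  ultimately show ?thesis by simp
qed

lemma perturbed_three_quarters_power_le:
  assumes "n > 0" "2 * n\<^sup>2 \<le> B"
  shows "(3 / 4 + (real n / real B)\<^sup>2) ^ n \<le> 3 * (3 / 4) ^ n"
proof -
  have B: "0 < B" using assms by (cases "B = 0") auto
  have n2: "2 * real n ^ 2 \<le> real B" using assms(2) by (simp flip: of_nat_power of_nat_mult)
  have "real n / real B \<le> 1 / (2 * real n)"
    using n2 assms(1) B by (simp add: field_simps power2_eq_square)
  then have "(real n / real B)\<^sup>2 \<le> (1 / (2 * real n))\<^sup>2" by (intro power_mono) auto
  also have "\<dots> \<le> 3 / 4 * (1 / real n)"
    using assms(1) by (simp add: power2_eq_square field_simps)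
  finally have "(3 / 4 + (real n / real B)\<^sup>2) ^ n \<le> (3 / 4 * (1 + 1 / real n)) ^ n"
    by (intro power_mono) (auto simp: algebra_simps)
  also have "\<dots> = (3 / 4) ^ n * (1 + 1 / real n) ^ n" by (rule power_mult_distrib)
  also have "(1 + 1 / real n) ^ n \<le> 3" using one_plus_divide_power_le[OF assms(1), of 1] by simp
  finally show ?thesis by (simp add: mult.commute)
qed

text \<open>Let s be the number of points. Because of \<open>N \<le> s\<close>, the product
  \<open>N ^ (J - card I) * s ^ card I\<close> is at most \<open>s ^ J\<close>, and even at most
  \<open>N ^ k * s ^ k\<close> when the basis has at most k elements. The power of n pays for
  \<open>chernoff_volume\<close>: up to J factors for torsion and three for additive
  relations.\<close>

lemma relation_pairs_bound:
  fixes k :: nat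
  obtains C n0 where "C > 0" "\<And>n. n \<ge> n0 \<Longrightarrow> \<exists>B0. \<forall>B\<ge>B0. \<forall>N. 0 < N \<and> N \<le> card (simplex_points n B) \<longrightarrow>
     real (card (relation_pairs n B N {..<2 * k})) \<le>
       C * (real N ^ k * real (card (simplex_points n B)) ^ k +
         real n ^ (2 * k + 3) * (3 / 4) ^ n * real (card (simplex_points n B)) ^ (2 * k))"
proof -
  define J where "J = 2 * k"
  define F where "F = J * ((J + 1) * (J + 1) + J + 2)"
  define K where "K = elimination_bound J + elimination_bound J * elimination_bound J"
  define C1 where "C1 = real ((2 * K + 1) ^ (J * J))"
  define C2 where "C2 = (6 ^ J * 3 * 2 ^ F + 3 ^ J * 6 ^ 3 * 3 :: real)"
  have C1: "C1 > 0" by (simp add: C1_def)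
  have C2: "C2 > 0" by (simp add: C2_def add_pos_pos)
  show ?thesis
  proof (rule that[of "2 ^ J * (C1 * (C2 + 1))" "J * F + F + 1"])
    show "0 < 2 ^ J * (C1 * (C2 + 1))" using C1 C2 by simp
    fix n assume n: "J * F + F + 1 \<le> n"
    then have n': "n > 0" "J * F + 1 \<le> n" "F \<le> n" by simp_all
    show "\<exists>B0. \<forall>B\<ge>B0. \<forall>N. 0 < N \<and> N \<le> card (simplex_points n B) \<longrightarrow>
     real (card (relation_pairs n B N {..<2 * k})) \<le>
       2 ^ J * (C1 * (C2 + 1)) * (real N ^ k * real (card (simplex_points n B)) ^ k +
         real n ^ (2 * k + 3) * (3 / 4) ^ n * real (card (simplex_points n B)) ^ (2 * k))"
    proof (intro exI[of _ "max (2 * n\<^sup>2) ((4 * n\<^sup>2) ^ n * (J + 1) ^ (J * F))"] allI impI)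
      fix B N assume B: "max (2 * n\<^sup>2) ((4 * n\<^sup>2) ^ n * (J + 1) ^ (J * F)) \<le> B"
        and N: "0 < N \<and> N \<le> card (simplex_points n B)"
      have B': "2 * n\<^sup>2 \<le> B" "(4 * n\<^sup>2) ^ n * (J + 1) ^ (J * F) \<le> B" using B by simp_all
      have B0: "B > 0" using B' n'(1) by (cases "B = 0") auto
      let ?S = "simplex_points n B" and ?L = "{..<2 * k}"
      define s where "s = real (card ?S)"
      define \<nu> where "\<nu> = real N"
      have \<nu>: "0 \<le> \<nu>" "\<nu> \<le> s" using N by (auto simp: \<nu>_def s_def)
      have s1: "s \<ge> 1" using N by (simp add: s_def)
      have n1: "real n \<ge> 1" using n' by simp
      define T1 where "T1 I = (\<Sum>y\<in>torsion_tuples n B I. real (card (fractional_relations {..n} I (homogeneous n y))) ^ (J + 1))"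
        for I :: "nat set"
      define T3 where "T3 I = (if 2 * card I \<le> J then s ^ card I else 0)" for I :: "nat set"
      define X where "X = real n ^ (J + 3) * (3 / 4) ^ n * s ^ J"
      have chern: "chernoff_volume n B \<le> 6 * real n * s"
        unfolding s_def by (rule chernoff_volume_le[OF n'(1) B'(1)])
      have each: "\<nu> ^ card (?L - I) * C1 * (T1 I + real (card (additive_tuples n B I)) + T3 I) \<le>
          C1 * (C2 + 1) * (\<nu> ^ k * s ^ k + X)" if IL: "I \<subseteq> ?L" for I
      proof -
        have finI: "finite I" using IL finite_subset by blast
        have cI: "card I \<le> J" using card_mono[OF _ IL] by (simp add: J_def)
        have cLI: "card (?L - I) = J - card I" using IL finI by (simp add: card_Diff_subset J_def)
        have mono: "\<nu> ^ (J - card I) * s ^ card I \<le> s ^ J"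
        proof -
          have "\<nu> ^ (J - card I) * s ^ card I \<le> s ^ (J - card I) * s ^ card I"
            using \<nu> s1 by (intro mult_right_mono power_mono) auto
          also have "\<dots> = s ^ J" using cI by (simp flip: power_add)
          finally show ?thesis .
        qed
        have "T1 I \<le> chernoff_volume n B ^ card I * (3 * 2 ^ F / 2 ^ n)"
          unfolding T1_def by (rule sum_torsion_tuples_le[OF finI cI n' F_def B'(2)])
        also have "\<dots> \<le> (6 * real n * s) ^ card I * (3 * 2 ^ F * (3 / 4) ^ n)"
        proof (intro mult_mono power_mono chern)
          have "(1 / 2 :: real) ^ n \<le> (3 / 4) ^ n" by (intro power_mono) auto
          then show "3 * 2 ^ F / 2 ^ n \<le> 3 * 2 ^ F * (3 / 4 :: real) ^ n"
            by (simp add: power_divide field_simps)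
        qed (use s1 in auto)
        also have "\<dots> = (6 ^ card I * real n ^ card I) * (3 * 2 ^ F * (3 / 4) ^ n) * s ^ card I"
          by (simp add: power_mult_distrib)
        also have "\<dots> \<le> (6 ^ J * real n ^ (J + 3)) * (3 * 2 ^ F * (3 / 4) ^ n) * s ^ card I"
          using s1 n1 cI by (intro mult_right_mono mult_mono power_increasing) auto
        finally have "\<nu> ^ (J - card I) * T1 I \<le>
            \<nu> ^ (J - card I) * ((6 ^ J * real n ^ (J + 3)) * (3 * 2 ^ F * (3 / 4) ^ n) * s ^ card I)"
          using \<nu> by (intro mult_left_mono) auto
        also have "\<dots> = (6 ^ J * 3 * 2 ^ F) * (real n ^ (J + 3) * (3 / 4) ^ n) * (\<nu> ^ (J - card I) * s ^ card I)"
          by simp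
        also have "\<dots> \<le> (6 ^ J * 3 * 2 ^ F) * (real n ^ (J + 3) * (3 / 4) ^ n) * s ^ J"
          by (intro mult_left_mono mono) auto
        finally have 1: "\<nu> ^ (J - card I) * T1 I \<le> (6 ^ J * 3 * 2 ^ F) * X"
          by (simp add: X_def)
        have 2: "\<nu> ^ (J - card I) * real (card (additive_tuples n B I)) \<le> (3 ^ J * 6 ^ 3 * 3) * X"
        proof (cases "additive_tuples n B I = {}")
          case True
          then show ?thesis using s1 by (simp add: X_def)
        next
          case False
          then have c3: "3 \<le> card I" by (rule additive_tuples_card_ge[OF finI])
          have "real (card (additive_tuples n B I)) \<le> 3 ^ J * s ^ (card I - 3) *
              (chernoff_volume n B ^ 3 * (3 / 4 + (real n / real B)\<^sup>2) ^ n)"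
            unfolding s_def by (rule card_additive_tuples_le[OF finI cI n'(1) B0])
          also have "\<dots> \<le> 3 ^ J * s ^ (card I - 3) * ((6 * real n * s) ^ 3 * (3 * (3 / 4) ^ n))"
            using s1 by (intro mult_left_mono mult_mono power_mono chern
                perturbed_three_quarters_power_le n'(1) B'(1)) auto
          also have "\<dots> = (3 ^ J * 6 ^ 3 * 3) * (real n ^ 3 * (3 / 4) ^ n) * (s ^ (card I - 3) * s ^ 3)"
            by (simp add: power_mult_distrib)
          also have "s ^ (card I - 3) * s ^ 3 = s ^ card I" using c3 by (simp flip: power_add)
          also have "(3 ^ J * 6 ^ 3 * 3) * (real n ^ 3 * (3 / 4) ^ n) * s ^ card I \<le>
             (3 ^ J * 6 ^ 3 * 3) * (real n ^ (J + 3) * (3 / 4) ^ n) * s ^ card I"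
            using s1 n1 by (intro mult_right_mono mult_left_mono power_increasing) auto
          finally have "\<nu> ^ (J - card I) * real (card (additive_tuples n B I)) \<le>
             \<nu> ^ (J - card I) * ((3 ^ J * 6 ^ 3 * 3) * (real n ^ (J + 3) * (3 / 4) ^ n) * s ^ card I)"
            using \<nu> by (intro mult_left_mono) auto
          also have "\<dots> = (3 ^ J * 6 ^ 3 * 3) * (real n ^ (J + 3) * (3 / 4) ^ n) * (\<nu> ^ (J - card I) * s ^ card I)"
            by simp
          also have "\<dots> \<le> (3 ^ J * 6 ^ 3 * 3) * (real n ^ (J + 3) * (3 / 4) ^ n) * s ^ J"
            by (intro mult_left_mono mono) auto
          finally show ?thesis by (simp add: X_def)
        qed
        have 3: "\<nu> ^ (J - card I) * T3 I \<le> \<nu> ^ k * s ^ k"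
        proof (cases "2 * card I \<le> J")
          case True
          then have ik: "card I \<le> k" by (simp add: J_def)
          then have "\<nu> ^ (J - card I) * s ^ card I = \<nu> ^ k * (\<nu> ^ (k - card I) * s ^ card I)"
            by (simp add: J_def mult_2 flip: power_add mult.assoc)
          also have "\<dots> \<le> \<nu> ^ k * (s ^ (k - card I) * s ^ card I)"
            using \<nu> s1 by (intro mult_left_mono mult_right_mono power_mono) auto
          also have "s ^ (k - card I) * s ^ card I = s ^ k" using ik by (simp flip: power_add)
          finally show ?thesis using True by (simp add: T3_def)
        qed (use \<nu> s1 in \<open>simp add: T3_def\<close>)
        have X0: "X \<ge> 0" using s1 by (simp add: X_def)
        have "\<nu> ^ card (?L - I) * C1 * (T1 I + real (card (additive_tuples n B I)) + T3 I) =
          C1 * (\<nu> ^ (J - card I) * T1 I + \<nu> ^ (J - card I) * real (card (additive_tuples n B I)) + \<nu> ^ (J - card I) * T3 I)"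
          unfolding cLI by (simp add: algebra_simps)
        also have "\<dots> \<le> C1 * (C2 * X + \<nu> ^ k * s ^ k)"
          using 1 2 3 C1 by (intro mult_left_mono) (auto simp: C2_def algebra_simps)
        also have "C2 * X + \<nu> ^ k * s ^ k \<le> (C2 + 1) * (\<nu> ^ k * s ^ k + X)"
        proof -
          have "0 \<le> C2 * (\<nu> ^ k * s ^ k)" using C2 \<nu> s1 by simp
          then show ?thesis using X0 by (simp add: algebra_simps)
        qed
        finally show ?thesis using C1 by (simp add: mult_left_mono)
      qed
      have "real (card (relation_pairs n B N ?L)) \<le> real (\<Sum>I\<in>Pow ?L. N ^ card (?L - I) * (2 * K + 1) ^ (J * J) *
     ((\<Sum>y\<in>torsion_tuples n B I. card (fractional_relations {..n} I (homogeneous n y)) ^ (J + 1)) +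
      card (additive_tuples n B I) + (if 2 * card I \<le> J then card ?S ^ card I else 0)))"
        using card_relation_pairs_le[of ?L B N n] N B0 unfolding K_def J_def of_nat_le_iff by simp
      also have "\<dots> = (\<Sum>I\<in>Pow ?L. \<nu> ^ card (?L - I) * C1 * (T1 I + real (card (additive_tuples n B I)) + T3 I))"
        unfolding of_nat_sum \<nu>_def C1_def T1_def T3_def s_def by (intro sum.cong) auto
      also have "\<dots> \<le> (\<Sum>I\<in>Pow ?L. C1 * (C2 + 1) * (\<nu> ^ k * s ^ k + X))"
        by (intro sum_mono each) auto
      also have "\<dots> = 2 ^ J * (C1 * (C2 + 1)) * (\<nu> ^ k * s ^ k + X)"
        by (simp add: card_Pow J_def)
      finally show "real (card (relation_pairs n B N {..<2 * k})) \<le>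
       2 ^ J * (C1 * (C2 + 1)) * (real N ^ k * real (card ?S) ^ k +
         real n ^ (2 * k + 3) * (3 / 4) ^ n * real (card ?S) ^ (2 * k))"
        unfolding X_def \<nu>_def s_def J_def .
    qed
  qed
qed

text \<open>With \<open>e = ln (c' / c)\<close>, the single term of index j of the exponential
  series of \<open>e * n\<close> is at most \<open>(c' / c) ^ n\<close>.\<close>

lemma polynomial_times_geometric_le:
  fixes c c' :: real
  assumes "0 < c" "c < c'"
  obtains C where "C > 0" "\<And>n. real n ^ j * c ^ n \<le> C * c' ^ n"
proof -
  define e where "e = ln (c' / c)"
  have e: "e > 0" using assms by (simp add: e_def)
  show ?thesis
  proof (rule that[of "fact j / e ^ j"])
    show "fact j / e ^ j > 0" using e by simp
    fix n :: nat
    have "(e * real n) ^ j / fact j \<le> exp (e * real n)"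
      using sum_le_suminf[OF summable_exp_generic[of "e * real n"], of "{j}"] e
      by (simp add: exp_def divide_inverse mult.commute)
    also have "\<dots> = (c' / c) ^ n"
      using assms by (simp add: e_def exp_of_nat2_mult)
    finally have "(e * real n) ^ j / fact j * c ^ n \<le> (c' / c) ^ n * c ^ n"
      using assms by (intro mult_right_mono) auto
    also have "\<dots> = c' ^ n" using assms by (simp add: power_divide)
    finally show "real n ^ j * c ^ n \<le> fact j / e ^ j * c' ^ n"
      using e by (simp add: power_mult_distrib field_simps)
  qed
qed

section \<open>Relations between two distinct points\<close>

lemma independent_rows_pair:
  assumes "x \<in> {0, 1::nat} \<rightarrow>\<^sub>E simplex_points n B" "x 0 \<noteq> x 1"
  shows "independent_rows {..n} {0, 1} (homogeneous n x)"
proof -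
  have "x 0 \<in> extensional {..<n}" "x 1 \<in> extensional {..<n}"
    using PiE_mem[OF assms(1), of 0] PiE_mem[OF assms(1), of 1] by (auto simp: simplex_points_def PiE_def)
  then obtain \<rho> where \<rho>: "\<rho> < n" "x 0 \<rho> \<noteq> x 1 \<rho>"
    using assms(2) extensionalityI[of "x 0" "{..<n}" "x 1"] by auto
  show ?thesis
    unfolding independent_rows_def
  proof (intro exI[of _ "{n, \<rho>}"] conjI allI impI)
    show "card {n, \<rho>} \<le> card {0, 1::nat}" by (simp add: card_insert_if)
    fix c assume c: "\<forall>\<rho>\<in>{n, \<rho>}. (\<Sum>i\<in>{0, 1}. c i * homogeneous n x i \<rho>) = 0"
    then have 1: "c 0 = - c 1" by (simp add: homogeneous_def)
    have "c 0 * real (x 0 \<rho>) + c 1 * real (x 1 \<rho>) = 0" using c \<rho> by (simp add: homogeneous_def)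
    then have "c 1 * (real (x 1 \<rho>) - real (x 0 \<rho>)) = 0" unfolding 1 by (simp add: algebra_simps)
    then have "c 1 = 0" using \<rho> by simp
    then show "\<forall>i\<in>{0, 1}. c i = 0" using 1 by simp
  qed (use \<rho> in auto)
qed

text \<open>Two distinct points are independent, so in the absence of torsion zero is their only
  modular relation; this accounts for one square of the number of points. Torsion contributes a
  proportion of order \<open>n\<^sup>2 / 2 ^ n\<close>, hence at most a second square for large
  n.\<close>

lemma distinct_pair_relations_bound:
  obtains n0 where "\<And>n. n \<ge> n0 \<Longrightarrow> \<exists>B0. \<forall>B\<ge>B0. \<forall>N>0.
     real (\<Sum>x\<in>{x \<in> {0, 1::nat} \<rightarrow>\<^sub>E simplex_points n B. x 0 \<noteq> x 1}.
       card (modular_relations N {..n} {0, 1} (homogeneous n x))) \<le> 2 * real (card (simplex_points n B)) ^ 2"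
proof -
  obtain C where C: "C > 0" "\<And>n. real n ^ 2 * (1 / 2) ^ n \<le> C * (3 / 4 :: real) ^ n"
    using polynomial_times_geometric_le[of "1 / 2" "3 / 4" 2] by auto
  \<comment> \<open>14 is the exponent F of \<open>sum_torsion_tuples_le\<close> for J = 2 and E =
    1, and 36 is the square of the constant in \<open>chernoff_volume_le\<close>. The threshold 29
    below is \<open>J * F + 1\<close>.\<close>
  have "(\<lambda>n. 36 * 3 * 2 ^ 14 * C * (3 / 4 :: real) ^ n) \<longlonglongrightarrow> 36 * 3 * 2 ^ 14 * C * 0"
    by (intro tendsto_mult tendsto_const LIMSEQ_realpow_zero) auto
  then have "eventually (\<lambda>n. 36 * 3 * 2 ^ 14 * C * (3 / 4 :: real) ^ n < 1) sequentially"
    by (rule order_tendstoD) simp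
  then obtain n1 where n1: "\<And>n. n \<ge> n1 \<Longrightarrow> 36 * 3 * 2 ^ 14 * C * (3 / 4 :: real) ^ n < 1"
    unfolding eventually_sequentially by blast
  show ?thesis
  proof (rule that[of "max n1 29"])
    fix n assume "max n1 29 \<le> n"
    then have n: "n1 \<le> n" "n > 0" "2 * 14 + 1 \<le> n" "14 \<le> n" by auto
    show "\<exists>B0. \<forall>B\<ge>B0. \<forall>N>0.
     real (\<Sum>x\<in>{x \<in> {0, 1::nat} \<rightarrow>\<^sub>E simplex_points n B. x 0 \<noteq> x 1}.
       card (modular_relations N {..n} {0, 1} (homogeneous n x))) \<le> 2 * real (card (simplex_points n B)) ^ 2"
    proof (intro exI[of _ "max (2 * n\<^sup>2) ((4 * n\<^sup>2) ^ n * (2 + 1) ^ (2 * 14))"] allI impI)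
      fix B N :: nat
      assume B: "max (2 * n\<^sup>2) ((4 * n\<^sup>2) ^ n * (2 + 1) ^ (2 * 14)) \<le> B" and N: "0 < N"
      have B': "2 * n\<^sup>2 \<le> B" "(4 * n\<^sup>2) ^ n * (2 + 1) ^ (2 * 14) \<le> B" using B by simp_all
      have B0: "B > 0" using B' n by (cases "B = 0") auto
      let ?S = "simplex_points n B" and ?I = "{0, 1::nat}"
      let ?h = "\<lambda>x. card (fractional_relations {..n} ?I (homogeneous n x))"
      let ?D = "{x \<in> ?I \<rightarrow>\<^sub>E ?S. x 0 \<noteq> x 1}"
      have le: "card (modular_relations N {..n} ?I (homogeneous n x)) \<le>
          1 + (if x \<in> torsion_tuples n B ?I then ?h x else 0)" if x: "x \<in> ?D" for x
      proof -
        have ind: "independent_rows {..n} ?I (homogeneous n x)"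
        proof (rule independent_rows_pair[of x n B])
          show "x \<in> ?I \<rightarrow>\<^sub>E ?S" "x 0 \<noteq> x 1" using x by blast+
        qed
        have fin: "finite (fractional_relations {..n} ?I (homogeneous n x))"
        proof (rule finite_fractional_relations_homogeneous[OF _ _ B0 ind])
          have "x \<in> ?I \<rightarrow>\<^sub>E ?S" using x by blast
          then show "x i \<in> ?S" if "i \<in> ?I" for i using that by (rule PiE_mem)
        qed simp
        have "card (modular_relations N {..n} ?I (homogeneous n x)) \<le> ?h x"
          using modular_relations_card[OF _ _ fin N, of ?I] by simp
        also have "\<dots> \<le> 1 + (if x \<in> torsion_tuples n B ?I then ?h x else 0)"
        proof (cases "?h x \<le> 1")
          case False
          have "x \<in> ?I \<rightarrow>\<^sub>E ?S" using x by blast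
          then have "x \<in> torsion_tuples n B ?I" using ind False unfolding torsion_tuples_def by simp
          then show ?thesis by simp
        qed simp
        finally show ?thesis .
      qed
      have finD: "finite ?D" by simp
      have "(\<Sum>x\<in>?D. card (modular_relations N {..n} ?I (homogeneous n x))) \<le>
          (\<Sum>x\<in>?D. 1 + (if x \<in> torsion_tuples n B ?I then ?h x else 0))"
        by (rule sum_mono) (rule le)
      also have "\<dots> = card ?D + (\<Sum>x\<in>?D \<inter> torsion_tuples n B ?I. ?h x)"
        by (subst sum.distrib, subst sum.inter_restrict[OF finD], subst card_eq_sum[of ?D], rule refl)
      also have "\<dots> \<le> card (?I \<rightarrow>\<^sub>E ?S) + (\<Sum>x\<in>torsion_tuples n B ?I. ?h x)"
        by (intro add_mono card_mono sum_mono2) auto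
      also have "card (?I \<rightarrow>\<^sub>E ?S) = card ?S ^ 2" by (simp add: card_PiE power2_eq_square)
      finally have "real (\<Sum>x\<in>?D. card (modular_relations N {..n} ?I (homogeneous n x))) \<le>
          real (card ?S ^ 2 + (\<Sum>x\<in>torsion_tuples n B ?I. ?h x))" by (simp only: of_nat_le_iff)
      also have "\<dots> = real (card ?S) ^ 2 + (\<Sum>x\<in>torsion_tuples n B ?I. real (?h x) ^ 1)" by simp
      also have "(\<Sum>x\<in>torsion_tuples n B ?I. real (?h x) ^ 1) \<le> real (card ?S) ^ 2"
      proof -
        have "(\<Sum>x\<in>torsion_tuples n B ?I. real (?h x) ^ 1) \<le>
            chernoff_volume n B ^ card ?I * (3 * 2 ^ 14 / 2 ^ n)"
          by (rule sum_torsion_tuples_le[where J = 2]) (use n B' in auto)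
        also have "\<dots> \<le> (6 * real n * real (card ?S)) ^ 2 * (3 * 2 ^ 14 / 2 ^ n)"
        proof (rule mult_right_mono)
          have "card ?I = 2" by simp
          then show "chernoff_volume n B ^ card ?I \<le> (6 * real n * real (card ?S)) ^ 2"
            using chernoff_volume_le[OF n(2) B'(1)] by (simp only:) (intro power_mono, auto)
        qed simp
        also have "\<dots> = real (card ?S) ^ 2 * (36 * 3 * 2 ^ 14 * (real n ^ 2 * (1 / 2) ^ n))"
          by (simp add: power_mult_distrib power_divide)
        also have "\<dots> \<le> real (card ?S) ^ 2 * (36 * 3 * 2 ^ 14 * (C * (3 / 4) ^ n))"
          by (intro mult_left_mono C) auto
        also have "\<dots> \<le> real (card ?S) ^ 2 * 1"
          using n1[OF n(1)] by (intro mult_left_mono) auto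
        finally show ?thesis by simp
      qed
      finally show "real (\<Sum>x\<in>?D. card (modular_relations N {..n} ?I (homogeneous n x))) \<le> 2 * real (card ?S) ^ 2"
        by simp
    qed
  qed
qed

section \<open>Moments of the number of solutions\<close>

text \<open>Adding \<open>r\<close> keeps the condition within the natural numbers; the residue
  class that is counted is the one of \<open>- r\<close>.\<close>

definition hits :: "nat \<Rightarrow> nat \<Rightarrow> (nat \<Rightarrow> nat) set \<Rightarrow> (nat \<Rightarrow> nat) \<Rightarrow> nat \<Rightarrow> nat" where
  "hits n N S a r = card {x \<in> S. N dvd (\<Sum>\<rho><n. a \<rho> * x \<rho>) + r}"

definition residue_character :: "nat \<Rightarrow> nat \<Rightarrow> complex" where
  "residue_character N u = exp (2 * of_real pi * \<i> * of_nat u / of_nat N)"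

lemma residue_character_add: "residue_character N (u + v) = residue_character N u * residue_character N v"
  by (simp add: residue_character_def exp_add[symmetric] add_divide_distrib distrib_left)

lemma residue_character_0 [simp]: "residue_character N 0 = 1"
  by (simp add: residue_character_def)

lemma residue_character_mult: "residue_character N (t * u) = residue_character N u ^ t"
  by (induction t) (simp_all add: residue_character_add)

lemma residue_character_sum: "finite A \<Longrightarrow> residue_character N (\<Sum>i\<in>A. f i) = (\<Prod>i\<in>A. residue_character N (f i))"
  by (induction A rule: finite_induct) (simp_all add: residue_character_add)

lemma residue_character_eq_1_iff: "N > 0 \<Longrightarrow> residue_character N u = 1 \<longleftrightarrow> N dvd u"
  unfolding residue_character_def by (rule complex_root_unity_eq_1) simp

lemma sum_residue_character:
  assumes "N > 0"
  shows "(\<Sum>t<N. residue_character N (t * u)) = (if N dvd u then of_nat N else 0)"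
proof (cases "N dvd u")
  case True
  then have "residue_character N (t * u) = 1" for t
    using assms by (simp add: residue_character_eq_1_iff)
  then show ?thesis using True by simp
next
  case False
  let ?z = "residue_character N u"
  have "?z \<noteq> 1" using False assms by (simp add: residue_character_eq_1_iff)
  moreover have "?z ^ N = 1"
    unfolding residue_character_mult[symmetric] using assms by (simp add: residue_character_eq_1_iff)
  ultimately show ?thesis using False by (simp add: residue_character_mult geometric_sum)
qed

lemma hits_character_sum:
  assumes "finite S" "N > 0"
  shows "of_nat N * of_nat (hits n N S a r) - of_nat (card S) =
    (\<Sum>(c, x)\<in>{0<..<N} \<times> S. residue_character N (c * ((\<Sum>\<rho><n. a \<rho> * x \<rho>) + r)))"
proof -
  let ?u = "\<lambda>x. (\<Sum>\<rho><n. a \<rho> * x \<rho>) + r"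
  have "of_nat N * of_nat (hits n N S a r) = (\<Sum>x\<in>S. if N dvd ?u x then of_nat N else (0::complex))"
    using assms by (simp add: hits_def sum.If_cases Int_def mult.commute)
  also have "\<dots> = (\<Sum>x\<in>S. \<Sum>c<N. residue_character N (c * ?u x))"
    by (simp only: sum_residue_character[OF assms(2)])
  also have "\<dots> = (\<Sum>x\<in>S. 1 + (\<Sum>c\<in>{0<..<N}. residue_character N (c * ?u x)))"
  proof (rule sum.cong[OF refl])
    fix x
    have "{..<N} = insert 0 {0<..<N}" using assms by auto
    then show "(\<Sum>c<N. residue_character N (c * ?u x)) = 1 + (\<Sum>c\<in>{0<..<N}. residue_character N (c * ?u x))"
      by simp
  qed
  also have "\<dots> = of_nat (card S) + (\<Sum>(c, x)\<in>{0<..<N} \<times> S. residue_character N (c * ?u x))"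
    unfolding sum.distrib by (subst sum.swap) (simp add: sum.cartesian_product)
  finally show ?thesis by simp
qed

text \<open>These tuples survive when the j-th power of the character sum is averaged: the average
  over \<open>r\<close> produces the first divisibility, the averages over the coordinates of
  \<open>a\<close> the others. Frequency 0 is absent because it yields the mean, which has been
  subtracted.\<close>

definition dual_tuples :: "nat \<Rightarrow> nat \<Rightarrow> (nat \<Rightarrow> nat) set \<Rightarrow> nat \<Rightarrow> (nat \<Rightarrow> nat \<times> (nat \<Rightarrow> nat)) set" where
  "dual_tuples n N S j = {p \<in> {..<j} \<rightarrow>\<^sub>E {0<..<N} \<times> S. N dvd (\<Sum>l<j. fst (p l)) \<and>
     (\<forall>\<rho><n. N dvd (\<Sum>l<j. fst (p l) * snd (p l) \<rho>))}"

lemma hits_moment: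
  assumes "finite S" "N > 0"
  shows "(\<Sum>a\<in>{..<n} \<rightarrow>\<^sub>E {..<N}. \<Sum>r<N. (real N * real (hits n N S a r) - real (card S)) ^ j)
     = real N ^ (n + 1) * real (card (dual_tuples n N S j))"
proof -
  let ?e = "residue_character N"
  let ?P = "{..<j} \<rightarrow>\<^sub>E {0<..<N} \<times> S"
  let ?A = "{..<n} \<rightarrow>\<^sub>E {..<N}"
  define w where "w p \<rho> = (\<Sum>l<j. fst (p l) * snd (p l) \<rho>)" for p :: "nat \<Rightarrow> nat \<times> (nat \<Rightarrow> nat)" and \<rho>
  define u where "u p = (\<Sum>l<j. fst (p l))" for p :: "nat \<Rightarrow> nat \<times> (nat \<Rightarrow> nat)"
  have finP: "finite ?P" using assms by (intro finite_PiE) auto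
  have finA: "finite ?A" by (intro finite_PiE) auto
  have expand: "(of_nat N * of_nat (hits n N S a r) - of_nat (card S)) ^ j =
      (\<Sum>p\<in>?P. (\<Prod>\<rho><n. ?e (a \<rho> * w p \<rho>)) * ?e (r * u p))" for a r
  proof -
    let ?g = "\<lambda>(c, x). ?e (c * ((\<Sum>\<rho><n. a \<rho> * x \<rho>) + r))"
    have "(\<Sum>q\<in>{0<..<N} \<times> S. ?g q) ^ j = (\<Prod>l<j. \<Sum>q\<in>{0<..<N} \<times> S. ?g q)" by simp
    also have "\<dots> = (\<Sum>p\<in>?P. \<Prod>l<j. ?g (p l))" using assms by (intro prod_sum_PiE) auto
    also have "\<dots> = (\<Sum>p\<in>?P. (\<Prod>\<rho><n. ?e (a \<rho> * w p \<rho>)) * ?e (r * u p))"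
    proof (rule sum.cong[OF refl])
      fix p
      have "(\<Prod>l<j. ?g (p l)) = ?e (\<Sum>l<j. fst (p l) * ((\<Sum>\<rho><n. a \<rho> * snd (p l) \<rho>) + r))"
        by (simp add: residue_character_sum case_prod_unfold)
      also have "(\<Sum>l<j. fst (p l) * ((\<Sum>\<rho><n. a \<rho> * snd (p l) \<rho>) + r)) =
          (\<Sum>l<j. \<Sum>\<rho><n. a \<rho> * (fst (p l) * snd (p l) \<rho>)) + r * u p"
        by (simp add: u_def sum.distrib distrib_left sum_distrib_left mult.left_commute mult.commute)
      also have "(\<Sum>l<j. \<Sum>\<rho><n. a \<rho> * (fst (p l) * snd (p l) \<rho>)) = (\<Sum>\<rho><n. a \<rho> * w p \<rho>)"
        by (subst sum.swap) (simp add: w_def sum_distrib_left)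
      finally show "(\<Prod>l<j. ?g (p l)) = (\<Prod>\<rho><n. ?e (a \<rho> * w p \<rho>)) * ?e (r * u p)"
        by (simp add: residue_character_add residue_character_sum)
    qed
    finally show ?thesis unfolding hits_character_sum[OF assms] .
  qed
  have orth: "(\<Sum>a\<in>?A. \<Sum>r<N. (\<Prod>\<rho><n. ?e (a \<rho> * w p \<rho>)) * ?e (r * u p)) =
      (if N dvd u p \<and> (\<forall>\<rho><n. N dvd w p \<rho>) then of_nat N ^ (n + 1) else 0)" for p
  proof -
    have "(\<Sum>a\<in>?A. \<Sum>r<N. (\<Prod>\<rho><n. ?e (a \<rho> * w p \<rho>)) * ?e (r * u p)) =
       (\<Sum>a\<in>?A. \<Prod>\<rho><n. ?e (a \<rho> * w p \<rho>)) * (\<Sum>r<N. ?e (r * u p))"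
      by (simp only: sum_product)
    also have "(\<Sum>a\<in>?A. \<Prod>\<rho><n. ?e (a \<rho> * w p \<rho>)) = (\<Prod>\<rho><n. \<Sum>t<N. ?e (t * w p \<rho>))"
      by (rule prod_sum_PiE[symmetric]) auto
    also have "\<dots> * (\<Sum>r<N. ?e (r * u p)) =
        (\<Prod>\<rho><n. if N dvd w p \<rho> then of_nat N else 0) * (if N dvd u p then of_nat N else 0)"
      by (simp only: sum_residue_character[OF assms(2)])
    also have "\<dots> = (if N dvd u p \<and> (\<forall>\<rho><n. N dvd w p \<rho>) then of_nat N ^ (n + 1) else 0)"
      by (auto simp: mult.commute intro!: prod_zero)
    finally show ?thesis .
  qed
  have "complex_of_real (\<Sum>a\<in>?A. \<Sum>r<N. (real N * real (hits n N S a r) - real (card S)) ^ j) =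
     (\<Sum>a\<in>?A. \<Sum>r<N. \<Sum>p\<in>?P. (\<Prod>\<rho><n. ?e (a \<rho> * w p \<rho>)) * ?e (r * u p))"
    by (simp add: expand[symmetric])
  also have "\<dots> = (\<Sum>p\<in>?P. \<Sum>a\<in>?A. \<Sum>r<N. (\<Prod>\<rho><n. ?e (a \<rho> * w p \<rho>)) * ?e (r * u p))"
    by (simp only: sum.swap[of _ ?P "{..<N}"] sum.swap[of _ ?P ?A])
  also have "\<dots> = (\<Sum>p\<in>?P. if N dvd u p \<and> (\<forall>\<rho><n. N dvd w p \<rho>) then of_nat N ^ (n + 1) else 0)"
    by (simp only: orth)
  also have "\<dots> = of_nat N ^ (n + 1) * of_nat (card (dual_tuples n N S j))"
    using finP by (simp add: sum.If_cases dual_tuples_def u_def w_def Int_def mult.commute)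
  also have "\<dots> = complex_of_real (real N ^ (n + 1) * real (card (dual_tuples n N S j)))" by simp
  finally show ?thesis by (simp only: of_real_eq_iff)
qed

lemma finite_dual_tuples [simp]: "finite S \<Longrightarrow> finite (dual_tuples n N S j)"
  unfolding dual_tuples_def
  by (rule finite_subset[OF _ finite_PiE[of "{..<j}" "\<lambda>_. {0<..<N} \<times> S"]]) auto

lemma dual_tuples_modular_relation:
  assumes "p \<in> dual_tuples n N S j" "N > 0"
  shows "(\<lambda>l\<in>{..<j}. fst (p l)) \<in> modular_relations N {..n} {..<j} (homogeneous n (\<lambda>l\<in>{..<j}. snd (p l)))"
proof -
  have "(\<Sum>l<j. real (fst (p l)) * homogeneous n (\<lambda>l\<in>{..<j}. snd (p l)) l \<rho>) / real N \<in> \<int>" if "\<rho> \<le> n" for \<rho>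
  proof -
    have "N dvd (\<Sum>l<j. fst (p l) * (if \<rho> < n then snd (p l) \<rho> else 1))"
      using assms by (cases "\<rho> < n") (auto simp: dual_tuples_def)
    then obtain z where z: "(\<Sum>l<j. fst (p l) * (if \<rho> < n then snd (p l) \<rho> else 1)) = N * z" by blast
    have "(\<Sum>l<j. real (fst (p l)) * homogeneous n (\<lambda>l\<in>{..<j}. snd (p l)) l \<rho>) =
       real (\<Sum>l<j. fst (p l) * (if \<rho> < n then snd (p l) \<rho> else 1))"
      unfolding of_nat_sum by (intro sum.cong) (auto simp: homogeneous_def)
    then show ?thesis unfolding z using assms(2) by simp
  qed
  then show ?thesis
    using assms(1) unfolding modular_relations_def dual_tuples_def by (auto simp: PiE_iff mem_Times_iff)
qed

lemma card_dual_tuples_le: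
  assumes "N > 0"
  shows "card (dual_tuples n N (simplex_points n B) j) \<le> card (relation_pairs n B N {..<j})"
proof (rule card_inj_on_le[of "\<lambda>p. ((\<lambda>l\<in>{..<j}. snd (p l)), (\<lambda>l\<in>{..<j}. fst (p l)))"])
  let ?D = "dual_tuples n N (simplex_points n B) j"
  show "inj_on (\<lambda>p. ((\<lambda>l\<in>{..<j}. snd (p l)), (\<lambda>l\<in>{..<j}. fst (p l)))) ?D"
  proof (rule inj_onI)
    fix p q assume p: "p \<in> ?D" and q: "q \<in> ?D"
      and eq: "((\<lambda>l\<in>{..<j}. snd (p l)), (\<lambda>l\<in>{..<j}. fst (p l))) = ((\<lambda>l\<in>{..<j}. snd (q l)), (\<lambda>l\<in>{..<j}. fst (q l)))"
    have 1: "(\<lambda>l\<in>{..<j}. snd (p l)) = (\<lambda>l\<in>{..<j}. snd (q l))" and 2: "(\<lambda>l\<in>{..<j}. fst (p l)) = (\<lambda>l\<in>{..<j}. fst (q l))"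
      using eq by simp_all
    have "p l = q l" if "l < j" for l
      using fun_cong[OF 1, of l] fun_cong[OF 2, of l] that by (simp add: prod_eq_iff)
    then show "p = q" using p q by (intro extensionalityI[of _ "{..<j}"]) (auto simp: dual_tuples_def PiE_def)
  qed
  show "(\<lambda>p. ((\<lambda>l\<in>{..<j}. snd (p l)), (\<lambda>l\<in>{..<j}. fst (p l)))) ` ?D \<subseteq> relation_pairs n B N {..<j}"
  proof (rule image_subsetI)
    fix p assume p: "p \<in> ?D"
    then have "p l \<in> {0<..<N} \<times> simplex_points n B" if "l < j" for l
      using that unfolding dual_tuples_def by blast
    then have "0 < fst (p l)" "snd (p l) \<in> simplex_points n B" if "l < j" for l
      using that by (auto simp: mem_Times_iff)
    then show "((\<lambda>l\<in>{..<j}. snd (p l)), (\<lambda>l\<in>{..<j}. fst (p l))) \<in> relation_pairs n B N {..<j}"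
      using dual_tuples_modular_relation[OF p assms] by (auto simp: relation_pairs_def)
  qed
  show "finite (relation_pairs n B N {..<j})"
    unfolding relation_pairs_def by (intro finite_SigmaI) auto
qed

text \<open>For two equal points the frequencies add up to a multiple of \<open>N\<close> strictly
  between 0 and \<open>2 * N\<close>, that is, to \<open>N\<close>, so one frequency determines the
  other. These pairs form the diagonal of the second moment.\<close>

lemma card_dual_pairs_le:
  fixes N :: nat
  defines "D \<equiv> \<lambda>n B. {x \<in> {0, 1::nat} \<rightarrow>\<^sub>E simplex_points n B. x 0 \<noteq> x 1}"
  assumes "N > 0"
  shows "card (dual_tuples n N (simplex_points n B) 2) \<le> (N - 1) * card (simplex_points n B) +
    (\<Sum>x\<in>D n B. card (modular_relations N {..n} {0, 1} (homogeneous n x)))"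
proof -
  let ?S = "simplex_points n B"
  let ?T = "dual_tuples n N ?S 2"
  have two: "{..<2} = {0, 1::nat}" by auto
  let ?Eq = "{p \<in> ?T. snd (p 0) = snd (p 1)}" and ?Ne = "{p \<in> ?T. snd (p 0) \<noteq> snd (p 1)}"
  have mem: "fst (p l) \<in> {0<..<N}" "snd (p l) \<in> ?S" if "p \<in> ?T" "l < 2" for p l
    using that unfolding dual_tuples_def by (auto simp: PiE_iff mem_Times_iff)
  have ext: "p = q" if "p \<in> ?T" "q \<in> ?T" "p 0 = q 0" "p 1 = q 1" for p q
    using that by (intro extensionalityI[of _ "{..<2}"]) (auto simp: dual_tuples_def PiE_def two)
  have "card ?Eq \<le> card ({0<..<N} \<times> ?S)"
  proof (rule card_inj_on_le[of "\<lambda>p. p 0"])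
    show "inj_on (\<lambda>p. p 0) ?Eq"
    proof (rule inj_onI)
      fix p q assume p: "p \<in> ?Eq" and q: "q \<in> ?Eq" and eq: "p 0 = q 0"
      have dv: "fst (t 0) + fst (t 1) = N" if "t \<in> ?T" for t
      proof -
        have "N dvd fst (t 0) + fst (t 1)" using that unfolding dual_tuples_def two by simp
        then obtain z where z: "fst (t 0) + fst (t 1) = N * z" by blast
        have "0 < N * z" "N * z < N * 2" using mem(1)[OF that, of 0] mem(1)[OF that, of 1] by (auto simp flip: z)
        then have "z = 1" by auto
        then show ?thesis using z by simp
      qed
      have "fst (p 1) = fst (q 1)" using dv[of p] dv[of q] p q eq by simp
      moreover have "snd (p 1) = snd (q 1)" using p q eq by auto
      ultimately show "p = q" using ext[of p q] p q eq by (auto simp: prod_eq_iff)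
    qed
    show "(\<lambda>p. p 0) ` ?Eq \<subseteq> {0<..<N} \<times> ?S"
    proof (rule image_subsetI)
      fix p assume "p \<in> ?Eq"
      then have "p \<in> ?T" by blast
      then show "p 0 \<in> {0<..<N} \<times> ?S" using mem[of p 0] by (simp add: mem_Times_iff)
    qed
  qed simp
  also have "\<dots> = (N - 1) * card ?S" by (simp add: card_cartesian_product)
  finally have T0: "card ?Eq \<le> (N - 1) * card ?S" .
  have finD: "finite (D n B)" unfolding D_def by simp
  have "card ?Ne \<le> card (SIGMA x:D n B. modular_relations N {..n} {0, 1} (homogeneous n x))"
  proof (rule card_inj_on_le[of "\<lambda>p. ((\<lambda>l\<in>{0, 1}. snd (p l)), (\<lambda>l\<in>{0, 1}. fst (p l)))"])
    show "inj_on (\<lambda>p. ((\<lambda>l\<in>{0, 1}. snd (p l)), (\<lambda>l\<in>{0, 1}. fst (p l)))) ?Ne"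
    proof (rule inj_onI)
      fix p q assume p: "p \<in> ?Ne" and q: "q \<in> ?Ne"
        and eq: "((\<lambda>l\<in>{0, 1}. snd (p l)), (\<lambda>l\<in>{0, 1}. fst (p l))) = ((\<lambda>l\<in>{0, 1}. snd (q l)), (\<lambda>l\<in>{0, 1}. fst (q l)))"
      have 1: "(\<lambda>l\<in>{0, 1}. snd (p l)) = (\<lambda>l\<in>{0, 1}. snd (q l))"
        and 2: "(\<lambda>l\<in>{0, 1}. fst (p l)) = (\<lambda>l\<in>{0, 1}. fst (q l))"
        using eq by simp_all
      have "p l = q l" if "l = 0 \<or> l = 1" for l
        using fun_cong[OF 1, of l] fun_cong[OF 2, of l] that by (auto simp: prod_eq_iff)
      then have "p 0 = q 0" "p 1 = q 1" by blast+
      then show "p = q" using p q by (intro ext) blast+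
    qed
    show "(\<lambda>p. ((\<lambda>l\<in>{0, 1}. snd (p l)), (\<lambda>l\<in>{0, 1}. fst (p l)))) ` ?Ne \<subseteq>
        (SIGMA x:D n B. modular_relations N {..n} {0, 1} (homogeneous n x))"
    proof (rule image_subsetI)
      fix p assume p: "p \<in> ?Ne"
      have "(\<lambda>l\<in>{0, 1}. snd (p l)) \<in> D n B" using mem(2)[of p] p by (auto simp: D_def)
      moreover have "(\<lambda>l\<in>{0, 1}. fst (p l)) \<in> modular_relations N {..n} {0, 1} (homogeneous n (\<lambda>l\<in>{0, 1}. snd (p l)))"
        using dual_tuples_modular_relation[of p n N ?S 2] p assms(2) by (simp only: two mem_Collect_eq)
      ultimately show "((\<lambda>l\<in>{0, 1}. snd (p l)), (\<lambda>l\<in>{0, 1}. fst (p l))) \<in>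
          (SIGMA x:D n B. modular_relations N {..n} {0, 1} (homogeneous n x))" by blast
    qed
    show "finite (SIGMA x:D n B. modular_relations N {..n} {0, 1} (homogeneous n x))"
      using finD by (intro finite_SigmaI) auto
  qed
  also have "\<dots> = (\<Sum>x\<in>D n B. card (modular_relations N {..n} {0, 1} (homogeneous n x)))"
    using finD by (intro card_SigmaI) auto
  finally have T1: "card ?Ne \<le> (\<Sum>x\<in>D n B. card (modular_relations N {..n} {0, 1} (homogeneous n x)))" .
  have "?T = ?Eq \<union> ?Ne" by blast
  then have "card ?T \<le> card ?Eq + card ?Ne" using card_Un_le[of ?Eq ?Ne] by simp
  then show ?thesis using T0 T1 by linarith
qed

section \<open>Covering all residues by the sum of two simplices\<close>

lemma sum_hits:
  assumes "finite S" "N > 0"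
  shows "(\<Sum>r<N. hits n N S a r) = card S"
proof -
  have uniq: "\<exists>!r. r < N \<and> N dvd u + r" for u
  proof (rule ex1I[of _ "(N - u mod N) mod N"])
    have "(u + (N - u mod N) mod N) mod N = (u mod N + (N - u mod N)) mod N"
      by (simp add: mod_add_left_eq mod_add_right_eq)
    also have "u mod N + (N - u mod N) = N" using assms(2) by (simp add: less_imp_le)
    finally have "(u + (N - u mod N) mod N) mod N = 0" by simp
    then have d: "N dvd u + (N - u mod N) mod N" by (rule mod_0_imp_dvd)
    then show "(N - u mod N) mod N < N \<and> N dvd u + (N - u mod N) mod N" using assms(2) by simp
    fix r assume r: "r < N \<and> N dvd u + r"
    then have "int N dvd int (u + r) - int (u + (N - u mod N) mod N)"
      using d by (intro dvd_diff) (simp_all only: int_dvd_int_iff)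
    then have "int N dvd int r - int ((N - u mod N) mod N)" by simp
    then have "int r mod int N = int ((N - u mod N) mod N) mod int N" by (simp add: mod_eq_dvd_iff)
    then show "r = (N - u mod N) mod N" using r assms(2) by (simp flip: zmod_int)
  qed
  have "(\<Sum>r<N. hits n N S a r) = (\<Sum>r<N. \<Sum>x\<in>S. if N dvd (\<Sum>\<rho><n. a \<rho> * x \<rho>) + r then 1 else 0)"
    using assms(1) by (simp add: hits_def sum.If_cases Int_def)
  also have "\<dots> = (\<Sum>x\<in>S. \<Sum>r<N. if N dvd (\<Sum>\<rho><n. a \<rho> * x \<rho>) + r then 1 else 0)"
    by (rule sum.swap)
  also have "\<dots> = (\<Sum>x\<in>S. 1)"
  proof (rule sum.cong[OF refl])
    fix x
    let ?u = "\<Sum>\<rho><n. a \<rho> * x \<rho>"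
    obtain r0 where r0: "r0 < N" "N dvd ?u + r0" "\<And>r. r < N \<Longrightarrow> N dvd ?u + r \<Longrightarrow> r = r0"
      using uniq[of ?u] by blast
    have "(\<Sum>r<N. if N dvd ?u + r then 1 else 0 :: nat) = card {r. r < N \<and> N dvd ?u + r}"
      by (simp add: sum.If_cases Int_def)
    also have "{r. r < N \<and> N dvd ?u + r} = {r0}" using r0 by blast
    finally show "(\<Sum>r<N. if N dvd ?u + r then 1 else 0 :: nat) = 1" by simp
  qed
  finally show ?thesis by simp
qed

definition covers :: "nat \<Rightarrow> nat \<Rightarrow> nat \<Rightarrow> (nat \<Rightarrow> nat) \<Rightarrow> bool" where
  "covers n N B a \<longleftrightarrow> (\<forall>r<N. \<exists>x\<in>simplex_points n B. N dvd (\<Sum>\<rho><n. a \<rho> * x \<rho>) + r)"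

lemma simplex_points_add:
  assumes "x \<in> simplex_points n B" "y \<in> simplex_points n C"
  shows "(\<lambda>\<rho>\<in>{..<n}. x \<rho> + y \<rho>) \<in> simplex_points n (B + C)"
  using assms by (auto simp: simplex_points_def PiE_iff sum.distrib add_mono trans_le_add1)

text \<open>Pigeonhole in a sumset: as \<open>s\<close> runs through the residues met by the second
  simplex, the differences \<open>r - s\<close> are too numerous to be all missed by the
  first.\<close>

lemma covers_if_many_residues:
  assumes N: "N > 0"
    and lt: "card {r. r < N \<and> hits n N (simplex_points n B1) a r = 0} < card {r. r < N \<and> hits n N (simplex_points n B2) a r > 0}"
  shows "covers n N (B1 + B2) a"
  unfolding covers_def
proof (intro allI impI)
  fix r assume r: "r < N"
  let ?U = "{r. r < N \<and> hits n N (simplex_points n B1) a r = 0}"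
  let ?V = "{r. r < N \<and> hits n N (simplex_points n B2) a r > 0}"
  define f where "f s = (r + (N - s)) mod N" for s
  have shift: "(f s + s) mod N = r" if "s < N" for s
  proof -
    have "(f s + s) mod N = (r + (N - s) + s) mod N" by (simp add: f_def mod_add_left_eq)
    also have "(r + (N - s) + s) mod N = (r + N) mod N" using that by simp
    finally show ?thesis using r by simp
  qed
  have inj: "inj_on f ?V"
  proof (rule inj_onI)
    fix s t assume s: "s \<in> ?V" and t: "t \<in> ?V" and eq: "f s = f t"
    have "(f s + s) mod N = (f s + t) mod N" using shift[of s] shift[of t] s t eq by simp
    then have "int (f s + s) mod int N = int (f s + t) mod int N" by (simp only: flip: zmod_int)
    then have "int N dvd int (f s + s) - int (f s + t)" by (simp only: mod_eq_dvd_iff)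
    then have "int N dvd int s - int t" by simp
    then have "int s mod int N = int t mod int N" by (simp add: mod_eq_dvd_iff)
    then show "s = t" using s t by simp
  qed
  have "\<not> f ` ?V \<subseteq> ?U"
  proof
    assume "f ` ?V \<subseteq> ?U"
    moreover have "finite ?U" by simp
    ultimately have "card ?V \<le> card ?U" by (rule card_inj_on_le[OF inj])
    then show False using lt by linarith
  qed
  then obtain s where "s \<in> ?V" "f s \<notin> ?U" by (meson image_subsetI)
  then have s: "s < N" "hits n N (simplex_points n B2) a s > 0" "f s \<notin> ?U" by simp_all
  have "f s < N" using N by (simp add: f_def)
  then have "hits n N (simplex_points n B1) a (f s) \<noteq> 0" "hits n N (simplex_points n B2) a s \<noteq> 0"
    using s by simp_all
  then have "{x \<in> simplex_points n B1. N dvd (\<Sum>\<rho><n. a \<rho> * x \<rho>) + f s} \<noteq> {}"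
    "{x \<in> simplex_points n B2. N dvd (\<Sum>\<rho><n. a \<rho> * x \<rho>) + s} \<noteq> {}"
    unfolding hits_def by (auto simp: card_eq_0_iff)
  then obtain x y where x: "x \<in> simplex_points n B1" "N dvd (\<Sum>\<rho><n. a \<rho> * x \<rho>) + f s"
    and y: "y \<in> simplex_points n B2" "N dvd (\<Sum>\<rho><n. a \<rho> * y \<rho>) + s" by blast
  let ?z = "\<lambda>\<rho>\<in>{..<n}. x \<rho> + y \<rho>"
  have "N dvd ((\<Sum>\<rho><n. a \<rho> * x \<rho>) + f s) + ((\<Sum>\<rho><n. a \<rho> * y \<rho>) + s)" by (rule dvd_add[OF x(2) y(2)])
  also have "((\<Sum>\<rho><n. a \<rho> * x \<rho>) + f s) + ((\<Sum>\<rho><n. a \<rho> * y \<rho>) + s) = (\<Sum>\<rho><n. a \<rho> * ?z \<rho>) + (f s + s)"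
    by (simp add: sum.distrib distrib_left)
  finally have "((\<Sum>\<rho><n. a \<rho> * ?z \<rho>) + (f s + s)) mod N = 0" by (simp add: dvd_eq_mod_eq_0)
  then have "((\<Sum>\<rho><n. a \<rho> * ?z \<rho>) + (f s + s) mod N) mod N = 0" by (simp add: mod_add_right_eq)
  then have "N dvd (\<Sum>\<rho><n. a \<rho> * ?z \<rho>) + r" using shift[OF s(1)] by (simp add: mod_0_imp_dvd)
  then show "\<exists>x\<in>simplex_points n (B1 + B2). N dvd (\<Sum>\<rho><n. a \<rho> * x \<rho>) + r"
    using simplex_points_add[OF x(1) y(1)] by blast
qed

text \<open>A missed residue contributes \<open>s1 ^ (2 * k)\<close> to the moment of order 2k, so
  Markov's inequality bounds the number of \<open>a\<close> for which the first simplex misses at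
  least s2 / 2 residues (\<open>Bad1\<close>). Outside \<open>Bad2\<close> the squares of the hits
  of the second simplex add up to at most 2 s2, and by Cauchy-Schwarz it meets at least s2 / 2
  residues. Outside both sets the pigeonhole argument applies.\<close>

lemma card_noncovering_le:
  fixes R :: real
  defines "s \<equiv> \<lambda>n B. real (card (simplex_points n B))"
  assumes N: "N > 0" and pos: "s n B1 > 0" "s n B2 > 0"
    and R: "real (card (relation_pairs n B1 N {..<2 * k})) \<le> R"
    and pairs: "real (\<Sum>x\<in>{x \<in> {0, 1::nat} \<rightarrow>\<^sub>E simplex_points n B2. x 0 \<noteq> x 1}.
       card (modular_relations N {..n} {0, 1} (homogeneous n x))) \<le> 2 * s n B2 ^ 2"
  shows "real (card {a \<in> {..<n} \<rightarrow>\<^sub>E {..<N}. \<not> covers n N (B1 + B2) a}) \<le>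
     real N ^ n * (2 * real N * R / (s n B2 * s n B1 ^ (2 * k)) + 3 * s n B2 / real N)"
proof -
  let ?A = "{..<n} \<rightarrow>\<^sub>E {..<N}"
  have finA: "finite ?A" by (intro finite_PiE) auto
  define h1 where "h1 = hits n N (simplex_points n B1)"
  define h2 where "h2 = hits n N (simplex_points n B2)"
  define s1 where "s1 = s n B1"
  define s2 where "s2 = s n B2"
  have s1: "s1 > 0" and s2: "s2 > 0" using pos by (simp_all add: s1_def s2_def)
  define U where "U a = {r. r < N \<and> h1 a r = 0}" for a
  have finU: "finite (U a)" for a by (simp add: U_def)
  define e where "e a = (\<Sum>r<N. real (h2 a r) ^ 2)" for a
  define Bad1 where "Bad1 = {a \<in> ?A. s2 \<le> 2 * real (card (U a))}"
  define Bad2 where "Bad2 = {a \<in> ?A. 2 * s2 < e a}"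
  have fin: "finite Bad1" "finite Bad2" using finA by (simp_all add: Bad1_def Bad2_def)
  have N0: "real N > 0" using N by simp
  have uncovered: "(\<Sum>a\<in>?A. real (card (U a))) * s1 ^ (2 * k) \<le> real N ^ (n + 1) * R"
  proof -
    have "(\<Sum>a\<in>?A. real (card (U a))) * s1 ^ (2 * k) = (\<Sum>a\<in>?A. \<Sum>r\<in>U a. s1 ^ (2 * k))"
      by (simp add: sum_distrib_right)
    also have "\<dots> = (\<Sum>a\<in>?A. \<Sum>r\<in>U a. (real N * real (h1 a r) - s1) ^ (2 * k))"
      by (intro sum.cong) (auto simp: U_def)
    also have "\<dots> \<le> (\<Sum>a\<in>?A. \<Sum>r<N. (real N * real (h1 a r) - s1) ^ (2 * k))"
      by (intro sum_mono sum_mono2) (auto simp: U_def)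
    also have "\<dots> = real N ^ (n + 1) * real (card (dual_tuples n N (simplex_points n B1) (2 * k)))"
      unfolding h1_def s1_def s_def by (rule hits_moment[OF _ N]) simp
    also have "\<dots> \<le> real N ^ (n + 1) * R"
    proof (rule mult_left_mono)
      have "real (card (dual_tuples n N (simplex_points n B1) (2 * k))) \<le> real (card (relation_pairs n B1 N {..<2 * k}))"
        using card_dual_tuples_le[OF N] by (simp only: of_nat_le_iff)
      then show "real (card (dual_tuples n N (simplex_points n B1) (2 * k))) \<le> R" using R by linarith
    qed simp
    finally show ?thesis .
  qed
  have bad1: "real (card Bad1) \<le> real N ^ n * (2 * real N * R / (s2 * s1 ^ (2 * k)))"
  proof -
    have "real (card Bad1) * s2 = (\<Sum>a\<in>Bad1. s2)" by simp
    also have "\<dots> \<le> (\<Sum>a\<in>Bad1. 2 * real (card (U a)))" by (intro sum_mono) (simp add: Bad1_def)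
    also have "\<dots> \<le> (\<Sum>a\<in>?A. 2 * real (card (U a)))" using finA by (intro sum_mono2) (auto simp: Bad1_def)
    also have "\<dots> = 2 * (\<Sum>a\<in>?A. real (card (U a)))" by (simp add: sum_distrib_left)
    finally have "real (card Bad1) * s2 * s1 ^ (2 * k) \<le> 2 * (\<Sum>a\<in>?A. real (card (U a))) * s1 ^ (2 * k)"
      using s1 by (intro mult_right_mono) auto
    also have "\<dots> \<le> 2 * (real N ^ (n + 1) * R)" using uncovered by simp
    finally have "real (card Bad1) * (s2 * s1 ^ (2 * k)) \<le> real N ^ n * (2 * real N * R)"
      by (simp add: mult.assoc mult.left_commute)
    then show ?thesis using s1 s2 by (simp add: pos_le_divide_eq)
  qed
  have sumh2: "(\<Sum>r<N. real (h2 a r)) = s2" for a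
    unfolding s2_def s_def h2_def by (simp only: sum_hits[OF finite_simplex_points N] flip: of_nat_sum)
  \<comment> \<open>\<open>e a - s2\<close> counts ordered pairs of distinct points in a common
    residue class. In the constant 3, frequency 0 accounts for 1 and the distinct pairs account for
    2; the diagonal is offset by subtracting \<open>s2\<close>.\<close>
  have collisions: "(\<Sum>a\<in>?A. e a - s2) \<le> real N ^ n * (3 * s2 ^ 2 / real N)"
  proof -
    have sq: "(\<Sum>r<N. (real N * real (h2 a r) - s2) ^ 2) = real N ^ 2 * e a - real N * s2 ^ 2" for a
    proof -
      have "(\<Sum>r<N. (real N * real (h2 a r) - s2) ^ 2) =
          (\<Sum>r<N. real N ^ 2 * real (h2 a r) ^ 2 - 2 * real N * s2 * real (h2 a r) + s2 ^ 2)"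
        by (intro sum.cong refl) (simp add: power2_eq_square algebra_simps)
      also have "\<dots> = real N ^ 2 * e a - 2 * real N * s2 * (\<Sum>r<N. real (h2 a r)) + real N * s2 ^ 2"
        by (simp add: e_def sum.distrib sum_subtractf sum_distrib_left)
      finally show ?thesis unfolding sumh2 by (simp add: power2_eq_square)
    qed
    have "(\<Sum>a\<in>?A. real N ^ 2 * e a - real N * s2 ^ 2) = real N ^ (n + 1) * real (card (dual_tuples n N (simplex_points n B2) 2))"
      using hits_moment[OF finite_simplex_points N, of n n B2 2]
      unfolding sq[symmetric] unfolding h2_def s2_def s_def .
    also have "\<dots> \<le> real N ^ (n + 1) * ((real N - 1) * s2 + 2 * s2 ^ 2)"
    proof (rule mult_left_mono)
      have "real (card (dual_tuples n N (simplex_points n B2) 2)) \<le> real ((N - 1) * card (simplex_points n B2) +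
    (\<Sum>x\<in>{x \<in> {0, 1::nat} \<rightarrow>\<^sub>E simplex_points n B2. x 0 \<noteq> x 1}. card (modular_relations N {..n} {0, 1} (homogeneous n x))))"
        using card_dual_pairs_le[OF N] by (simp only: of_nat_le_iff)
      then show "real (card (dual_tuples n N (simplex_points n B2) 2)) \<le> (real N - 1) * s2 + 2 * s2 ^ 2"
        using pairs N by (simp add: s2_def s_def of_nat_diff)
    qed simp
    also have "\<dots> \<le> real N ^ (n + 1) * (real N * s2 + 2 * s2 ^ 2)"
      using s2 by (intro mult_left_mono add_right_mono mult_right_mono) auto
    finally have *: "(\<Sum>a\<in>?A. real N ^ 2 * e a - real N * s2 ^ 2) \<le> real N ^ (n + 1) * (real N * s2 + 2 * s2 ^ 2)" .
    have cardA: "card ?A = N ^ n" by (simp add: card_PiE)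
    have "(\<Sum>a\<in>?A. real N ^ 2 * e a - real N * s2 ^ 2) =
        real N ^ 2 * (\<Sum>a\<in>?A. e a - s2) + real N ^ n * (real N ^ 2 * s2 - real N * s2 ^ 2)"
      by (simp add: sum_subtractf sum_distrib_left cardA algebra_simps)
    moreover have "real N ^ (n + 1) * (real N * s2 + 2 * s2 ^ 2) - real N ^ n * (real N ^ 2 * s2 - real N * s2 ^ 2) =
        real N ^ (n + 1) * (3 * s2 ^ 2)"
      by (simp add: power2_eq_square algebra_simps)
    moreover have "real N ^ 2 * (real N ^ n * (3 * s2 ^ 2 / real N)) = real N ^ (n + 1) * (3 * s2 ^ 2)"
      using N0 by (simp add: power2_eq_square)
    ultimately have "real N ^ 2 * (\<Sum>a\<in>?A. e a - s2) \<le> real N ^ 2 * (real N ^ n * (3 * s2 ^ 2 / real N))"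
      using * by linarith
    then show ?thesis by (rule mult_left_le_imp_le) (use N0 in simp)
  qed
  have bad2: "real (card Bad2) \<le> real N ^ n * (3 * s2 / real N)"
  proof -
    have nonneg: "0 \<le> e a - s2" for a
    proof -
      have "(\<Sum>r<N. real (h2 a r)) \<le> e a"
        unfolding e_def by (intro sum_mono) (simp add: power2_nat_le_imp_le self_le_power power2_eq_square flip: of_nat_mult)
      then show ?thesis unfolding sumh2 by simp
    qed
    have "real (card Bad2) * s2 = (\<Sum>a\<in>Bad2. s2)" by simp
    also have "\<dots> \<le> (\<Sum>a\<in>Bad2. e a - s2)" by (intro sum_mono) (auto simp: Bad2_def)
    also have "\<dots> \<le> (\<Sum>a\<in>?A. e a - s2)" using finA nonneg by (intro sum_mono2) (auto simp: Bad2_def)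
    also have "\<dots> \<le> real N ^ n * (3 * s2 ^ 2 / real N)" by (rule collisions)
    finally have "real (card Bad2) * s2 \<le> (real N ^ n * (3 * s2 / real N)) * s2"
      by (simp add: power2_eq_square)
    then show ?thesis by (rule mult_right_le_imp_le) (use s2 in simp)
  qed
  have "{a \<in> ?A. \<not> covers n N (B1 + B2) a} \<subseteq> Bad1 \<union> Bad2"
  proof (rule subsetI, rule ccontr)
    fix a assume a: "a \<in> {a \<in> ?A. \<not> covers n N (B1 + B2) a}" and notin: "a \<notin> Bad1 \<union> Bad2"
    have 1: "2 * real (card (U a)) < s2" and 2: "e a \<le> 2 * s2"
      using a notin by (auto simp: Bad1_def Bad2_def)
    let ?V = "{r. r < N \<and> h2 a r > 0}"
    have finV: "finite ?V" by simp
    have "s2 = (\<Sum>r\<in>?V. real (h2 a r) * 1)"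
      unfolding sumh2[of a, symmetric] by (simp, intro sum.mono_neutral_right) auto
    then have "s2 ^ 2 \<le> (\<Sum>r\<in>?V. real (h2 a r) ^ 2) * (\<Sum>r\<in>?V. 1 ^ 2)"
      using Cauchy_Schwarz_ineq_sum[of "\<lambda>r. real (h2 a r)" "\<lambda>r. 1" ?V] by simp
    also have "\<dots> \<le> e a * real (card ?V)"
      unfolding e_def by (auto intro!: mult_right_mono sum_mono2)
    also have "\<dots> \<le> 2 * s2 * real (card ?V)" using 2 by (intro mult_right_mono) auto
    finally have "s2 * s2 \<le> s2 * (2 * real (card ?V))" by (simp add: power2_eq_square)
    then have "s2 \<le> 2 * real (card ?V)" using s2 by simp
    then have "card (U a) < card ?V" using 1 by simp
    then have "covers n N (B1 + B2) a"
      unfolding U_def h1_def h2_def by (rule covers_if_many_residues[OF N])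
    then show False using a by simp
  qed
  then have "card {a \<in> ?A. \<not> covers n N (B1 + B2) a} \<le> card (Bad1 \<union> Bad2)"
    using fin by (intro card_mono) auto
  also have "\<dots> \<le> card Bad1 + card Bad2" by (rule card_Un_le)
  finally have "real (card {a \<in> ?A. \<not> covers n N (B1 + B2) a}) \<le> real (card Bad1) + real (card Bad2)"
    by (simp only: of_nat_le_iff flip: of_nat_add)
  also have "\<dots> \<le> real N ^ n * (2 * real N * R / (s2 * s1 ^ (2 * k))) + real N ^ n * (3 * s2 / real N)"
    using bad1 bad2 by (rule add_mono)
  finally show ?thesis by (simp add: s1_def s2_def distrib_left)
qed

section \<open>Choice of the two radii\<close>

lemma nat_floor_power_ge:
  fixes z :: real
  assumes "z \<ge> 2 * real n" "z \<ge> 1"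
  shows "z ^ n / 2 \<le> real (nat \<lfloor>z\<rfloor>) ^ n"
proof -
  have "1 / 2 \<le> 1 + real n * (- (1 / z))" using assms by (simp add: field_simps)
  also have "\<dots> \<le> (1 + - (1 / z)) ^ n" using assms by (intro Bernoulli_inequality) (simp add: field_simps)
  finally have "1 / 2 * z ^ n \<le> (1 + - (1 / z)) ^ n * z ^ n" using assms by (intro mult_right_mono) auto
  also have "\<dots> = (z - 1) ^ n" using assms by (simp add: power_mult_distrib[symmetric] field_simps)
  also have "\<dots> \<le> real (nat \<lfloor>z\<rfloor>) ^ n" using assms by (intro power_mono) linarith+
  finally show ?thesis by simp
qed

text \<open>A simplex of size \<open>Z = root n (fact n * T)\<close> has about T points, so the
  sizes \<open>p * Z\<close> and \<open>q * Z\<close> yield about \<open>p ^ n * T\<close> and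
  \<open>q ^ n * T\<close>. The two error terms decay like powers of
  \<open>(3 / 4) / q = 150 / 151\<close>, up to a polynomial, and of q; the rate 0.999 dominates
  both.\<close>

lemma noncovering_exponentially_rare:
  obtains C n0 where "C > 0" "n0 > 0" "\<And>n. n \<ge> n0 \<Longrightarrow> \<exists>T0. \<forall>T\<ge>T0. \<forall>N. T \<le> N \<and> N \<le> 2 * T \<longrightarrow>
    (\<exists>B. real B \<le> 1.7555 * root n (fact n * real T) \<and>
      real (card {a \<in> {..<n} \<rightarrow>\<^sub>E {..<N}. \<not> covers n N B a}) \<le> C * 0.999 ^ n * real N ^ n)"
proof -
  define p where "p = (2001 / 2000 :: real)"
  define q where "q = (151 / 200 :: real)"
  \<comment> \<open>With this k the tuples that coincide in pairs, of relative size
    \<open>(1 / p) ^ (n * k)\<close> up to a constant, weigh no more than the additive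
    relations.\<close>
  obtain k where "(1 / p) ^ k < 3 / 4" using real_arch_pow_inv[of "3 / 4" "1 / p"] by (auto simp: p_def)
  then have k: "(1 / p) ^ k \<le> 3 / 4" by simp
  obtain C1 n1 where C1: "C1 > 0" and n1: "\<And>n. n \<ge> n1 \<Longrightarrow> \<exists>B0. \<forall>B\<ge>B0. \<forall>N. 0 < N \<and> N \<le> card (simplex_points n B) \<longrightarrow>
     real (card (relation_pairs n B N {..<2 * k})) \<le>
       C1 * (real N ^ k * real (card (simplex_points n B)) ^ k +
         real n ^ (2 * k + 3) * (3 / 4) ^ n * real (card (simplex_points n B)) ^ (2 * k))"
    using relation_pairs_bound[of k] by blast
  obtain n2 where n2: "\<And>n. n \<ge> n2 \<Longrightarrow> \<exists>B0. \<forall>B\<ge>B0. \<forall>N>0.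
     real (\<Sum>x\<in>{x \<in> {0, 1::nat} \<rightarrow>\<^sub>E simplex_points n B. x 0 \<noteq> x 1}.
       card (modular_relations N {..n} {0, 1} (homogeneous n x))) \<le> 2 * real (card (simplex_points n B)) ^ 2"
    using distinct_pair_relations_bound by blast
  \<comment> \<open>The first simplex has at least \<open>p ^ n * T / 4\<close> points, so a factor
    8 guarantees at least \<open>2 * T \<ge> N\<close> of them, as the bound on relation pairs
    demands.\<close>
  obtain n3 where n3: "8 < p ^ n3" using real_arch_pow[of p 8] by (auto simp: p_def)
  obtain C2 where C2: "C2 > 0" "\<And>n. real n ^ (2 * k + 3) * (150 / 151) ^ n \<le> C2 * 0.999 ^ n"
    using polynomial_times_geometric_le[of "150 / 151" "0.999" "2 * k + 3"] by auto
  define C where "C = 16 * C1 * (8 ^ k + 1) * C2 + 3"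
  define n0 where "n0 = max (max n1 n2) (max n3 1)"
  show ?thesis
  proof (rule that[of C n0])
    show "C > 0" using C1 C2 by (simp add: C_def add_pos_pos)
    show "n0 > 0" by (simp add: n0_def)
    fix n assume n: "n0 \<le> n"
    then have nn: "n1 \<le> n" "n2 \<le> n" "n3 \<le> n" "n > 0" by (auto simp: n0_def)
    have pn: "8 \<le> p ^ n"
    proof -
      have "p ^ n3 \<le> p ^ n" using nn by (intro power_increasing) (auto simp: p_def)
      then show ?thesis using n3 by linarith
    qed
    obtain b1 where b1: "\<And>B N. b1 \<le> B \<Longrightarrow> 0 < N \<Longrightarrow> N \<le> card (simplex_points n B) \<Longrightarrow>
     real (card (relation_pairs n B N {..<2 * k})) \<le>
       C1 * (real N ^ k * real (card (simplex_points n B)) ^ k +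
         real n ^ (2 * k + 3) * (3 / 4) ^ n * real (card (simplex_points n B)) ^ (2 * k))"
      using n1[OF nn(1)] by blast
    obtain b2 where b2: "\<And>B N. b2 \<le> B \<Longrightarrow> 0 < N \<Longrightarrow>
     real (\<Sum>x\<in>{x \<in> {0, 1::nat} \<rightarrow>\<^sub>E simplex_points n B. x 0 \<noteq> x 1}.
       card (modular_relations N {..n} {0, 1} (homogeneous n x))) \<le> 2 * real (card (simplex_points n B)) ^ 2"
      using n2[OF nn(2)] by blast
    \<comment> \<open>The factor 2 is there because the radii are estimated from below by
      \<open>Z / 2\<close>.\<close>
    define M where "M = 2 * (b1 + b2 + 2 * n\<^sup>2 + 2 * n + 2)"
    show "\<exists>T0. \<forall>T\<ge>T0. \<forall>N. T \<le> N \<and> N \<le> 2 * T \<longrightarrow>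
      (\<exists>B. real B \<le> 1.7555 * root n (fact n * real T) \<and>
      real (card {a \<in> {..<n} \<rightarrow>\<^sub>E {..<N}. \<not> covers n N B a}) \<le> C * 0.999 ^ n * real N ^ n)"
    proof (rule exI[of _ "M ^ n"], intro allI impI)
      fix T N assume T: "M ^ n \<le> T" and N: "T \<le> N \<and> N \<le> 2 * T"
      define Z where "Z = root n (fact n * real T)"
      have "0 < M ^ n" by (simp add: M_def)
      then have T0: "0 < T" using T by linarith
      have N0: "0 < N" using N T0 by linarith
      have Z0: "Z > 0" using T0 nn(4) by (simp add: Z_def)
      have Zn: "Z ^ n = fact n * real T" using T0 nn(4) by (simp add: Z_def)
      have MZ: "real M \<le> Z"
      proof -
        have "real M ^ n \<le> 1 * real T" using T by (simp flip: of_nat_power)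
        also have "\<dots> \<le> Z ^ n" unfolding Zn by (intro mult_right_mono) auto
        finally show ?thesis using Z0 nn(4) by (metis less_imp_le power_mono_iff of_nat_0_le_iff)
      qed
      define B1 where "B1 = nat \<lfloor>p * Z\<rfloor>"
      define B2 where "B2 = nat \<lfloor>q * Z\<rfloor>"
      have Zh: "Z / 2 \<le> p * Z" "Z / 2 \<le> q * Z" using Z0 by (auto simp: p_def q_def)
      have Zb: "real (b1 + b2 + 2 * n\<^sup>2 + 2 * n + 2) \<le> Z / 2" using MZ unfolding M_def by simp
      have big: "b1 + b2 + 2 * n\<^sup>2 + 2 * n \<le> B1" "b1 + b2 + 2 * n\<^sup>2 + 2 * n \<le> B2"
      proof -
        have "real (b1 + b2 + 2 * n\<^sup>2 + 2 * n) + 2 \<le> p * Z" "real (b1 + b2 + 2 * n\<^sup>2 + 2 * n) + 2 \<le> q * Z"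
          using Zb Zh by auto
        then show "b1 + b2 + 2 * n\<^sup>2 + 2 * n \<le> B1" "b1 + b2 + 2 * n\<^sup>2 + 2 * n \<le> B2"
          unfolding B1_def B2_def by linarith+
      qed
      have floors: "real B1 \<le> p * Z" "real B2 \<le> q * Z"
      proof -
        have "0 \<le> p * Z" "0 \<le> q * Z" using Z0 by (simp_all add: p_def q_def)
        then show "real B1 \<le> p * Z" "real B2 \<le> q * Z" unfolding B1_def B2_def by (simp_all only: of_nat_floor)
      qed
      have half: "(p * Z) ^ n / 2 \<le> real B1 ^ n" "(q * Z) ^ n / 2 \<le> real B2 ^ n"
      proof -
        have "real (2 * n + 2) \<le> real (b1 + b2 + 2 * n\<^sup>2 + 2 * n + 2)" by (simp only: of_nat_le_iff)
        then have "real (2 * n + 2) \<le> Z / 2" using Zb by linarith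
        then have "2 * real n \<le> Z / 2" "1 \<le> Z / 2" by simp_all
        then have "2 * real n \<le> p * Z" "1 \<le> p * Z" "2 * real n \<le> q * Z" "1 \<le> q * Z"
          using Zh by linarith+
        then show "(p * Z) ^ n / 2 \<le> real B1 ^ n" "(q * Z) ^ n / 2 \<le> real B2 ^ n"
          unfolding B1_def B2_def by (simp_all only: nat_floor_power_ge)
      qed
      define s1 where "s1 = real (card (simplex_points n B1))"
      define s2 where "s2 = real (card (simplex_points n B2))"
      have s1ge: "p ^ n * real T / 4 \<le> s1"
      proof -
        have "p ^ n * real T / 4 = ((p * Z) ^ n / 2) / (2 * fact n)"
          by (simp add: power_mult_distrib Zn)
        also have "\<dots> \<le> real B1 ^ n / (2 * fact n)" using half by (intro divide_right_mono) auto
        also have "\<dots> \<le> s1" unfolding s1_def using big by (intro card_simplex_points_ge) simp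
        finally show ?thesis .
      qed
      have s2ge: "q ^ n * real T / 4 \<le> s2"
      proof -
        have "q ^ n * real T / 4 = ((q * Z) ^ n / 2) / (2 * fact n)"
          by (simp add: power_mult_distrib Zn)
        also have "\<dots> \<le> real B2 ^ n / (2 * fact n)" using half by (intro divide_right_mono) auto
        also have "\<dots> \<le> s2" unfolding s2_def using big by (intro card_simplex_points_ge) simp
        finally show ?thesis .
      qed
      have s2le: "s2 \<le> q ^ n * real T"
      proof -
        have "s2 \<le> real B2 ^ n / fact n" unfolding s2_def by (rule card_simplex_points_le)
        also have "\<dots> \<le> (q * Z) ^ n / fact n" using floors by (intro divide_right_mono power_mono) auto
        also have "\<dots> = q ^ n * real T" by (simp add: power_mult_distrib Zn)
        finally show ?thesis .
      qed
      have p0: "p > 0" and q0: "q > 0" by (simp_all add: p_def q_def)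
      have pos: "s1 > 0" "s2 > 0"
      proof -
        have "0 < p ^ n * real T / 4" "0 < q ^ n * real T / 4" using p0 q0 T0 by simp_all
        then show "s1 > 0" "s2 > 0" using s1ge s2ge by linarith+
      qed
      have NT: "real T \<le> real N" "real N \<le> 2 * real T" using N by linarith+
      have Ns1: "N \<le> card (simplex_points n B1)"
      proof -
        have "8 * real T \<le> p ^ n * real T" using pn by (intro mult_right_mono) auto
        then have "real N \<le> s1" using s1ge NT by linarith
        then show ?thesis by (simp add: s1_def)
      qed
      define \<delta> where "\<delta> = real n ^ (2 * k + 3) * (3 / 4) ^ n"
      define R where "R = C1 * (real N ^ k * s1 ^ k + \<delta> * s1 ^ (2 * k))"
      have bound: "real (card {a \<in> {..<n} \<rightarrow>\<^sub>E {..<N}. \<not> covers n N (B1 + B2) a}) \<le>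
          real N ^ n * (2 * real N * R / (s2 * s1 ^ (2 * k)) + 3 * s2 / real N)"
        unfolding s1_def s2_def
      proof (rule card_noncovering_le[OF N0])
        show "real (card (relation_pairs n B1 N {..<2 * k})) \<le> R"
          unfolding R_def \<delta>_def s1_def by (rule b1[OF _ N0 Ns1]) (use big in simp)
      qed (use pos b2[OF _ N0, of B2] big in \<open>simp_all add: s1_def s2_def\<close>)
      have t1: "2 * real N * R / (s2 * s1 ^ (2 * k)) \<le> 16 * C1 * (8 ^ k + 1) * C2 * 0.999 ^ n"
      proof -
        have "2 * real N * R / (s2 * s1 ^ (2 * k)) = 2 * C1 * (real N / s2) * ((real N / s1) ^ k + \<delta>)"
          using pos by (simp add: R_def field_simps power_divide power_mult power2_eq_square power_mult_distrib)
        also have "\<dots> \<le> 2 * C1 * (8 * (1 / q) ^ n) * (8 ^ k * (3 / 4) ^ n + \<delta>)"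
        proof (intro mult_mono add_mono)
          \<comment> \<open>The factor 8 combines \<open>N \<le> 2 * T\<close> with the quarter lost
            in the lower bound for the number of points: one half to the rounding of the radius, one
            half to \<open>card_simplex_points_ge\<close>.\<close>
          have "real N / s2 \<le> (2 * real T) / (q ^ n * real T / 4)"
            using NT pos q0 T0 s2ge by (intro frac_le) auto
          then show "real N / s2 \<le> 8 * (1 / q) ^ n" using T0 q0 by (simp add: power_divide)
          have "real N / s1 \<le> (2 * real T) / (p ^ n * real T / 4)"
            using NT pos p0 T0 s1ge by (intro frac_le) auto
          then have "real N / s1 \<le> 8 * (1 / p) ^ n" using T0 p0 by (simp add: power_divide)
          then have "(real N / s1) ^ k \<le> (8 * (1 / p) ^ n) ^ k" using pos by (intro power_mono) auto
          also have "\<dots> = 8 ^ k * ((1 / p) ^ k) ^ n" by (simp add: power_mult_distrib power_mult[symmetric] mult.commute)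
          also have "\<dots> \<le> 8 ^ k * (3 / 4) ^ n" using k p0 by (intro mult_left_mono power_mono) auto
          finally show "(real N / s1) ^ k \<le> 8 ^ k * (3 / 4) ^ n" .
        qed (use C1 pos q0 in \<open>auto simp: \<delta>_def intro!: add_nonneg_nonneg\<close>)
        also have "\<dots> \<le> 2 * C1 * (8 * (1 / q) ^ n) * ((8 ^ k + 1) * \<delta>)"
        proof (rule mult_left_mono)
          have "1 * (3 / 4) ^ n \<le> \<delta>" unfolding \<delta>_def using nn(4) by (intro mult_right_mono) auto
          then have "8 ^ k * (3 / 4) ^ n \<le> 8 ^ k * \<delta>" by (intro mult_left_mono) auto
          then show "8 ^ k * (3 / 4) ^ n + \<delta> \<le> (8 ^ k + 1) * \<delta>" by (simp add: algebra_simps)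
        qed (use C1 q0 in auto)
        also have "\<dots> = 16 * C1 * (8 ^ k + 1) * (real n ^ (2 * k + 3) * ((3 / 4) ^ n * (1 / q) ^ n))"
          by (simp add: \<delta>_def)
        also have "(3 / 4) ^ n * (1 / q) ^ n = (150 / 151) ^ n"
          unfolding power_mult_distrib[symmetric] by (simp add: q_def)
        also have "16 * C1 * (8 ^ k + 1) * (real n ^ (2 * k + 3) * (150 / 151) ^ n) \<le> 16 * C1 * (8 ^ k + 1) * (C2 * 0.999 ^ n)"
          using C1 by (intro mult_left_mono C2) auto
        finally show ?thesis by simp
      qed
      have t2: "3 * s2 / real N \<le> 3 * 0.999 ^ n"
      proof -
        have "3 * s2 / real N \<le> 3 * (q ^ n * real T) / real T"
          using s2le NT T0 pos by (intro frac_le) auto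
        also have "\<dots> = 3 * q ^ n" using T0 by simp
        also have "\<dots> \<le> 3 * 0.999 ^ n" by (intro mult_left_mono power_mono) (auto simp: q_def)
        finally show ?thesis .
      qed
      have "real N ^ n * (2 * real N * R / (s2 * s1 ^ (2 * k)) + 3 * s2 / real N) \<le>
          real N ^ n * (16 * C1 * (8 ^ k + 1) * C2 * 0.999 ^ n + 3 * 0.999 ^ n)"
        by (intro mult_left_mono add_mono t1 t2) auto
      also have "\<dots> = C * 0.999 ^ n * real N ^ n" by (simp add: C_def algebra_simps)
      finally have "real (card {a \<in> {..<n} \<rightarrow>\<^sub>E {..<N}. \<not> covers n N (B1 + B2) a}) \<le> C * 0.999 ^ n * real N ^ n"
        using bound by linarith
      moreover have "real (B1 + B2) \<le> 1.7555 * Z"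
        using floors by (simp add: p_def q_def)
      ultimately show "\<exists>B. real B \<le> 1.7555 * root n (fact n * real T) \<and>
          real (card {a \<in> {..<n} \<rightarrow>\<^sub>E {..<N}. \<not> covers n N B a}) \<le> C * 0.999 ^ n * real N ^ n"
        unfolding Z_def by blast
    qed
  qed
qed

section \<open>Frobenius numbers in a box\<close>

lemma admissible_box:
  fixes lo hi :: "nat \<Rightarrow> real"
  assumes lohi: "\<And>i. i < d \<Longrightarrow> 0 \<le> lo i \<and> lo i < hi i"
  shows "admissible_domain d (Pi\<^sub>E {..<d} (\<lambda>i. {lo i..hi i}))"
proof -
  let ?C = "Pi\<^sub>E {..<d} (\<lambda>i. {lo i..hi i})" and ?O = "Pi\<^sub>E {..<d} (\<lambda>i. {lo i<..<hi i})"
  interpret product_sigma_finite "\<lambda>_::nat. lborel :: real measure" ..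
  have int: "Rd_topology d interior_of ?C = ?O"
  proof (rule interior_of_unique)
    show "?O \<subseteq> ?C" by (rule PiE_mono) auto
    show "openin (Rd_topology d) ?O" by (simp add: openin_PiE)
    fix T assume T: "T \<subseteq> ?C" "openin (Rd_topology d) T"
    show "T \<subseteq> ?O"
    proof
      fix x assume "x \<in> T"
      then obtain U where U: "\<And>i. i < d \<Longrightarrow> open (U i)" "x \<in> Pi\<^sub>E {..<d} U" "Pi\<^sub>E {..<d} U \<subseteq> T"
        using T(2) unfolding openin_product_topology_alt by simp (metis lessThan_iff)
      have "x i \<in> {lo i<..<hi i}" if i: "i < d" for i
      proof -
        have "U i \<subseteq> {lo i..hi i}"
        proof
          fix y assume "y \<in> U i"
          then have "x(i := y) \<in> Pi\<^sub>E {..<d} U"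
            using U(2) i by (auto simp: PiE_iff extensional_def)
          then have "x(i := y) \<in> ?C" using U(3) T(1) by blast
          from PiE_mem[OF this, of i] show "y \<in> {lo i..hi i}" using i by simp
        qed
        then have "U i \<subseteq> interior {lo i..hi i}" using U(1)[OF i] by (rule interior_maximal)
        moreover have "x i \<in> U i" using U(2) i by auto
        ultimately show ?thesis by auto
      qed
      then show "x \<in> ?O" using U(2) by (auto simp: PiE_iff)
    qed
  qed
  have "Rd_topology d closure_of ?C = ?C" by (simp add: closure_of_product_topology)
  then have fr: "Rd_topology d frontier_of ?C = ?C - ?O"
    by (simp add: frontier_of_def int)
  have sets: "?C \<in> sets (Rd_lebesgue d)" "?O \<in> sets (Rd_lebesgue d)"
    by (auto intro!: sets_PiM_I_finite)
  have em: "emeasure (Rd_lebesgue d) ?C = (\<Prod>i<d. ennreal (hi i - lo i))"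
    "emeasure (Rd_lebesgue d) ?O = (\<Prod>i<d. ennreal (hi i - lo i))"
    using lohi by (simp_all add: emeasure_PiM less_imp_le)
  have fin: "(\<Prod>i<d. ennreal (hi i - lo i)) \<noteq> \<infinity>"
  proof -
    have "(\<Prod>i<d. ennreal (hi i - lo i)) = ennreal (\<Prod>i<d. hi i - lo i)"
      by (rule prod_ennreal) (use lohi in force)
    then show ?thesis by simp
  qed
  have "emeasure (Rd_lebesgue d) (?C - ?O) = 0"
    using sets em fin by (subst emeasure_Diff) (auto intro!: PiE_mono)
  with sets have null: "?C - ?O \<in> null_sets (Rd_lebesgue d)" by (auto intro: null_setsI)
  have "(\<lambda>i\<in>{..<d}. (lo i + hi i) / 2) \<in> ?O" using lohi by (auto simp: field_simps)
  then have ne: "?O \<noteq> {}" by blast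
  have sub: "?C \<subseteq> ({..<d} \<rightarrow>\<^sub>E {0..})" using lohi by (intro PiE_mono) (auto intro: order_trans)
  have bdd: "\<exists>B. \<forall>x\<in>?C. \<forall>i<d. \<bar>x i\<bar> \<le> B"
  proof (intro exI[of _ "\<Sum>i<d. hi i"] ballI allI impI)
    fix x i assume x: "x \<in> ?C" and i: "i < d"
    have "x i \<in> {lo i..hi i}" using PiE_mem[OF x, of i] i by simp
    then have "\<bar>x i\<bar> \<le> hi i" using lohi[OF i] by auto
    also have "\<dots> \<le> (\<Sum>i<d. hi i)" using lohi i by (intro member_le_sum) (auto intro: less_imp_le order_le_less_trans)
    finally show "\<bar>x i\<bar> \<le> (\<Sum>i<d. hi i)" .
  qed
  show ?thesis
    unfolding admissible_domain_def int fr using sub bdd ne null by blast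
qed

section \<open>The bound of Brauer and Shockley\<close>

lemma Greatest_int_le:
  fixes P :: "int \<Rightarrow> bool"
  assumes "P m0" "\<And>m. P m \<Longrightarrow> m \<le> b"
  shows "(GREATEST m. P m) \<le> b"
proof -
  \<comment> \<open>The witness \<open>m0\<close> bounds the search from below, so that a maximum
    exists; without one \<open>GREATEST\<close> would be an unspecified integer.\<close>
  let ?S = "{m \<in> {m0..b}. P m}"
  have ne: "m0 \<in> ?S" using assms by auto
  have fin: "finite ?S" by (rule finite_subset[of _ "{m0..b}"]) auto
  have M: "Max ?S \<in> ?S" using fin ne by (intro Max_in) auto
  have "(GREATEST m. P m) = Max ?S"
  proof (rule Greatest_equality)
    show "P (Max ?S)" using M by blast
    fix m assume m: "P m"
    show "m \<le> Max ?S"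
    proof (cases "m0 \<le> m")
      case True
      then show ?thesis using assms(2)[OF m] m by (intro Max_ge[OF fin]) auto
    next
      case False
      then show ?thesis using M by auto
    qed
  qed
  then show ?thesis using M by auto
qed

text \<open>Given m, choose x in the simplex such that the sum of \<open>a i * x i\<close> is
  congruent modulo \<open>a n\<close> to m plus the sum of the first n generators. If m exceeds the
  bound, the difference of the two sides is greater than \<open>- a n\<close>, hence a nonnegative
  multiple of \<open>a n\<close>. This multiple is the coefficient of the last generator, and
  \<open>x i - 1\<close> is the coefficient of the others.\<close>

lemma frobenius_pos_le:
  assumes cov: "covers n (a n) B a" and pos: "\<And>i. i \<le> n \<Longrightarrow> 0 < a i" and A: "\<And>\<rho>. \<rho> < n \<Longrightarrow> a \<rho> \<le> A"
  shows "frobenius_pos (Suc n) a \<le> int (A * B)"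
proof -
  let ?s = "int (\<Sum>i<n. a i)"
  define N where "N = a n"
  have N: "N > 0" using pos by (simp add: N_def)
  have "(GREATEST m. \<not> representable (Suc n) a m) \<le> int (A * B) - int (\<Sum>i<Suc n. a i)"
  proof (rule Greatest_int_le)
    show "\<not> representable (Suc n) a (- 1)"
    proof
      assume "representable (Suc n) a (- 1)"
      then obtain x where "- 1 = int (\<Sum>i<Suc n. x i * a i)" unfolding representable_def by blast
      moreover have "0 \<le> int (\<Sum>i<Suc n. x i * a i)" by (rule of_nat_0_le_iff)
      ultimately show False by linarith
    qed
    fix m assume m: "\<not> representable (Suc n) a m"
    show "m \<le> int (A * B) - int (\<Sum>i<Suc n. a i)"
    proof (rule ccontr)
      assume "\<not> ?thesis"
      then have big: "int (A * B) < m + ?s + int N" by (simp add: N_def)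
      define r where "r = nat ((- (m + ?s)) mod int N)"
      have r: "int r = (- (m + ?s)) mod int N" using N by (simp add: r_def)
      have "r < N" using N by (simp add: r_def nat_less_iff)
      then obtain x where x: "x \<in> simplex_points n B" "N dvd (\<Sum>\<rho><n. a \<rho> * x \<rho>) + r"
        using cov unfolding covers_def N_def by blast
      let ?ax = "int (\<Sum>\<rho><n. a \<rho> * x \<rho>)"
      have "int N dvd int ((\<Sum>\<rho><n. a \<rho> * x \<rho>) + r)" using x(2) by (simp only: int_dvd_int_iff)
      then have "int N dvd ?ax + int r" by simp
      moreover have "int N dvd int r + (m + ?s)"
      proof -
        have "int r mod int N = (- (m + ?s)) mod int N" by (simp add: r)
        then have "int N dvd int r - (- (m + ?s))" by (simp only: mod_eq_dvd_iff)
        then show ?thesis by (simp only: diff_minus_eq_add)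
      qed
      ultimately have "int N dvd (int r + (m + ?s)) - (?ax + int r)" by (rule dvd_diff[rotated])
      moreover have "(int r + (m + ?s)) - (?ax + int r) = m + ?s - ?ax" by simp
      ultimately have "int N dvd m + ?s - ?ax" by (simp only:)
      then obtain t where t: "m + ?s - ?ax = int N * t" by blast
      have "(\<Sum>\<rho><n. a \<rho> * x \<rho>) \<le> (\<Sum>\<rho><n. A * x \<rho>)" using A by (intro sum_mono mult_right_mono) auto
      also have "\<dots> = A * (\<Sum>\<rho><n. x \<rho>)" by (simp add: sum_distrib_left)
      also have "\<dots> \<le> A * B" using x(1) by (intro mult_left_mono) (auto simp: simplex_points_def)
      finally have "?ax \<le> int (A * B)" by (simp only: of_nat_le_iff)
      then have "0 < int N * (t + 1)" using big t by (simp add: distrib_left)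
      then have t0: "0 \<le> t" using N by (simp add: zero_less_mult_iff)
      define y where "y i = (if i < n then x i - 1 else nat t)" for i
      have "int (\<Sum>i<n. y i * a i) = ?ax - ?s"
      proof -
        have "int (y i * a i) = int (a i * x i) - int (a i)" if "i < n" for i
        proof -
          have "1 \<le> x i" using simplex_points_coord(1)[OF x(1) that] .
          then show ?thesis using that by (simp add: y_def of_nat_diff algebra_simps)
        qed
        then show ?thesis by (simp add: sum_subtractf)
      qed
      then have "int (\<Sum>i<Suc n. y i * a i) = ?ax - ?s + t * int N"
        using t0 by (simp add: y_def N_def)
      also have "\<dots> = m" using t by (simp add: algebra_simps)
      finally have "representable (Suc n) a m" unfolding representable_def by metis
      then show False using m by simp
    qed
  qed
  then show ?thesis unfolding frobenius_pos_def frobenius_number_def by linarith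
qed

section \<open>Lifting residues to integer vectors in the box\<close>

lemma covers_mod:
  assumes "covers n N B (\<lambda>\<rho>\<in>{..<n}. a \<rho> mod N)"
  shows "covers n N B a"
  unfolding covers_def
proof (intro allI impI)
  fix r assume "r < N"
  then obtain x where x: "x \<in> simplex_points n B" "N dvd (\<Sum>\<rho><n. (\<lambda>\<rho>\<in>{..<n}. a \<rho> mod N) \<rho> * x \<rho>) + r"
    using assms unfolding covers_def by blast
  have "((\<Sum>\<rho><n. (\<lambda>\<rho>\<in>{..<n}. a \<rho> mod N) \<rho> * x \<rho>) + r) mod N = ((\<Sum>\<rho><n. a \<rho> * x \<rho>) + r) mod N"
  proof -
    have "(\<Sum>\<rho><n. (\<lambda>\<rho>\<in>{..<n}. a \<rho> mod N) \<rho> * x \<rho>) mod N = (\<Sum>\<rho><n. (a \<rho> mod N) * x \<rho>) mod N" by simp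
    also have "\<dots> = (\<Sum>\<rho><n. ((a \<rho> mod N) * x \<rho>) mod N) mod N" by (rule mod_sum_eq[symmetric])
    also have "\<dots> = (\<Sum>\<rho><n. (a \<rho> * x \<rho>) mod N) mod N" by (simp add: mod_mult_left_eq)
    also have "\<dots> = (\<Sum>\<rho><n. a \<rho> * x \<rho>) mod N" by (rule mod_sum_eq)
    finally show ?thesis by (metis mod_add_left_eq)
  qed
  then have "N dvd (\<Sum>\<rho><n. a \<rho> * x \<rho>) + r" using x(2) by (simp add: dvd_eq_mod_eq_0)
  then show "\<exists>x\<in>simplex_points n B. N dvd (\<Sum>\<rho><n. a \<rho> * x \<rho>) + r" using x(1) by blast
qed

lemma card_residue_class_interval_le:
  fixes u l N :: nat
  assumes "N > 0"
  shows "card {t \<in> {u..u + l}. t mod N = y} \<le> l div N + 1"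
proof -
  have "card {t \<in> {u..u + l}. t mod N = y} \<le> card {0..l div N}"
  proof (rule card_inj_on_le[of "\<lambda>t. (t - u) div N"])
    show "inj_on (\<lambda>t. (t - u) div N) {t \<in> {u..u + l}. t mod N = y}"
    proof (rule inj_onI)
      fix s t assume s: "s \<in> {t \<in> {u..u + l}. t mod N = y}" and t: "t \<in> {t \<in> {u..u + l}. t mod N = y}"
        and eq: "(s - u) div N = (t - u) div N"
      have "int s mod int N = int t mod int N" using s t by (simp flip: zmod_int)
      then have "int N dvd int s - int t" by (simp only: mod_eq_dvd_iff)
      then have "int N dvd int (s - u) - int (t - u)" using s t by (simp add: of_nat_diff)
      then have "int (s - u) mod int N = int (t - u) mod int N" by (simp only: mod_eq_dvd_iff)
      then have "(s - u) mod N = (t - u) mod N" by (simp only: flip: zmod_int)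
      then have "s - u = t - u" using eq by (metis div_mult_mod_eq)
      moreover have "u \<le> s" "u \<le> t" using s t by auto
      ultimately show "s = t" by linarith
    qed
    show "(\<lambda>t. (t - u) div N) ` {t \<in> {u..u + l}. t mod N = y} \<subseteq> {0..l div N}"
      by (auto intro!: div_le_mono)
  qed simp
  then show ?thesis by simp
qed

text \<open>The integer points of the dilated box \<open>[10000 n, 10001 n]\<^sup>n \<times> [1, 2]\<close>: its first \<open>n\<close> sides are
  long compared with the last coordinate, which serves as the modulus, but short compared with
  the distance to the origin.\<close>

definition box_vectors :: "nat \<Rightarrow> nat \<Rightarrow> (nat \<Rightarrow> nat) set" where
  "box_vectors n T = Pi\<^sub>E {..<Suc n} (\<lambda>i. if i < n then {10000 * n * T..10000 * n * T + n * T} else {T..T + T})"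

lemma finite_box_vectors [simp]: "finite (box_vectors n T)"
  unfolding box_vectors_def by (intro finite_PiE) auto

lemma box_vectors_bounds:
  assumes "a \<in> box_vectors n T"
  shows "\<And>i. i < n \<Longrightarrow> 10000 * n * T \<le> a i" "\<And>i. i < n \<Longrightarrow> a i \<le> 10000 * n * T + n * T" "T \<le> a n" "a n \<le> 2 * T"
proof -
  have *: "a i \<in> (if i < n then {10000 * n * T..10000 * n * T + n * T} else {T..T + T})" if "i < Suc n" for i
    using PiE_mem[OF assms[unfolded box_vectors_def], of i] that by simp
  show "10000 * n * T \<le> a i" "a i \<le> 10000 * n * T + n * T" if "i < n" for i
    using *[of i] that by auto
  show "T \<le> a n" "a n \<le> 2 * T" using *[of n] by auto
qed

text \<open>Each residue has at most \<open>n * T div N + 1\<close> lifts in a side of the box.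
  Because of \<open>N \<le> 2 * T\<close> the rounding costs at most
  \<open>(1 + 2 / n) ^ n \<le> 9\<close>; sides of length proportional to n keep this bounded in
  n.\<close>

lemma card_noncovering_box_le:
  assumes n: "n > 0" and N: "N > 0" "N \<le> 2 * T"
  shows "real (card {a \<in> box_vectors n T. a n = N \<and> \<not> covers n N B a}) \<le>
    real (card {a \<in> {..<n} \<rightarrow>\<^sub>E {..<N}. \<not> covers n N B a}) / real N ^ n * (9 * (real n * real T) ^ n)"
proof -
  let ?X = "{a \<in> box_vectors n T. a n = N \<and> \<not> covers n N B a}"
  let ?Y = "{a \<in> {..<n} \<rightarrow>\<^sub>E {..<N}. \<not> covers n N B a}"
  define f where "f a = (\<lambda>\<rho>\<in>{..<n}. a \<rho> mod N)" for a :: "nat \<Rightarrow> nat"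
  have "card ?X \<le> card ?Y * (n * T div N + 1) ^ n"
  proof (rule card_le_fibers[where f = f])
    show "finite ?X" by simp
    show "finite ?Y" by (rule finite_subset[of _ "{..<n} \<rightarrow>\<^sub>E {..<N}"]) (auto intro: finite_PiE)
    show "f ` ?X \<subseteq> ?Y"
    proof (rule image_subsetI)
      fix a assume a: "a \<in> ?X"
      then have "\<not> covers n N B (f a)" using covers_mod[of n N B a] unfolding f_def by blast
      then show "f a \<in> ?Y" using N by (auto simp: f_def)
    qed
    fix y assume "y \<in> ?Y"
    let ?F = "{a \<in> ?X. f a = y}"
    let ?I = "\<lambda>\<rho>. {t \<in> {10000 * n * T..10000 * n * T + n * T}. t mod N = y \<rho>}"
    have "card ?F \<le> card (Pi\<^sub>E {..<n} ?I)"
    proof (rule card_inj_on_le[of "\<lambda>a. restrict a {..<n}"])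
      show "inj_on (\<lambda>a. restrict a {..<n}) ?F"
      proof (rule inj_onI)
        fix a b assume a: "a \<in> ?F" and b: "b \<in> ?F" and eq: "restrict a {..<n} = restrict b {..<n}"
        have "a i = b i" if "i < Suc n" for i
        proof (cases "i < n")
          case True
          then show ?thesis using fun_cong[OF eq, of i] by simp
        next
          case False
          then have "i = n" using that by simp
          then show ?thesis using a b by simp
        qed
        then show "a = b" using a b
          by (intro extensionalityI[of _ "{..<Suc n}"]) (auto simp: box_vectors_def PiE_def)
      qed
      show "(\<lambda>a. restrict a {..<n}) ` ?F \<subseteq> Pi\<^sub>E {..<n} ?I"
      proof (rule image_subsetI)
        fix a assume a: "a \<in> ?F"
        then have box: "a \<in> box_vectors n T" and fa: "f a = y" by simp_all
        have "a i mod N = y i" if "i < n" for i using fun_cong[OF fa, of i] that by (simp add: f_def)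
        then show "restrict a {..<n} \<in> Pi\<^sub>E {..<n} ?I" using box_vectors_bounds(1,2)[OF box] by auto
      qed
    qed (auto intro: finite_PiE)
    also have "\<dots> = (\<Prod>\<rho><n. card (?I \<rho>))" by (simp add: card_PiE)
    also have "\<dots> \<le> (\<Prod>\<rho><n. n * T div N + 1)"
      by (intro prod_mono conjI le0 card_residue_class_interval_le N(1))
    finally show "card ?F \<le> (n * T div N + 1) ^ n" by simp
  qed
  then have "real (card ?X) \<le> real (card ?Y * (n * T div N + 1) ^ n)" by (simp only: of_nat_le_iff)
  also have "\<dots> = real (card ?Y) * (real (n * T div N) + 1) ^ n" by (simp add: add.commute)
  also have "\<dots> \<le> real (card ?Y) * ((real n * real T) / real N + 1) ^ n"
    using of_nat_div_le_of_nat[of "n * T" N, where 'a = real] by (intro mult_left_mono power_mono add_right_mono) auto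
  also have "\<dots> = real (card ?Y) / real N ^ n * (real n * real T + real N) ^ n"
  proof -
    have "real n * real T / real N + 1 = (real n * real T + real N) / real N"
      using N by (simp add: add_divide_distrib)
    then show ?thesis by (simp only: power_divide times_divide_eq_left times_divide_eq_right)
  qed
  also have "\<dots> \<le> real (card ?Y) / real N ^ n * (9 * (real n * real T) ^ n)"
  proof (rule mult_left_mono)
    have "(real n * real T + real N) ^ n \<le> (real n * real T * (1 + 2 / real n)) ^ n"
      using N n by (intro power_mono) (auto simp: field_simps)
    also have "\<dots> = (1 + 2 / real n) ^ n * (real n * real T) ^ n" by (simp add: power_mult_distrib)
    also have "\<dots> \<le> 9 * (real n * real T) ^ n"
    proof (rule mult_right_mono)
      show "(1 + 2 / real n) ^ n \<le> 9" using one_plus_divide_power_le[of n 2] n by simp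
    qed simp
    finally show "(real n * real T + real N) ^ n \<le> 9 * (real n * real T) ^ n" .
  qed simp
  finally show ?thesis .
qed

text \<open>A common divisor g divides the last coordinate, so \<open>g \<le> 2 * T\<close>.
  Relative to the volume, multiples of g number at most \<open>54 / (2 ^ n * g\<^sup>2)\<close>:
  rounding costs 9 in the first n coordinates and 3 in the last, and 2 comes from retaining
  \<open>2 ^ (n - 1)\<close>. For n at least 7 the sum over g is at most 1/2.\<close>

lemma card_primitive_box_ge:
  assumes n: "n \<ge> 7" and T: "T > 0"
  shows "(real n * real T) ^ n * real T / 2 \<le> real (card {a \<in> box_vectors n T. Gcd (a ` {..<Suc n}) = 1})"
proof -
  let ?V = "box_vectors n T"
  let ?P = "{a \<in> ?V. Gcd (a ` {..<Suc n}) = 1}"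
  define M where "M g = {a \<in> ?V. \<forall>i<Suc n. g dvd a i}" for g
  have total: "card ?V = (n * T + 1) ^ n * (T + 1)"
    unfolding box_vectors_def by (simp add: card_PiE mult.commute[of n T])
  have "?V \<subseteq> ?P \<union> (\<Union>g\<in>{2..2 * T}. M g)"
  proof
    fix a assume a: "a \<in> ?V"
    let ?g = "Gcd (a ` {..<Suc n})"
    have dv: "?g dvd a i" if "i < Suc n" for i using that by (intro Gcd_dvd) auto
    show "a \<in> ?P \<union> (\<Union>g\<in>{2..2 * T}. M g)"
    proof (cases "?g = 1")
      case False
      have an: "T \<le> a n" "a n \<le> 2 * T" using box_vectors_bounds[OF a] by auto
      have gd: "?g dvd a n" using dv by simp
      have an0: "0 < a n" using an T by linarith
      have "?g \<noteq> 0" using gd an0 by (metis dvd_0_left less_irrefl)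
      moreover have "?g \<le> a n" by (rule dvd_imp_le[OF gd an0])
      ultimately have g: "?g \<in> {2..2 * T}" using False an(2) unfolding atLeastAtMost_iff by linarith
      have "a \<in> M ?g" unfolding M_def mem_Collect_eq using a dv by blast
      then show ?thesis using g by blast
    qed (use a in simp)
  qed
  then have "card ?V \<le> card (?P \<union> (\<Union>g\<in>{2..2 * T}. M g))" by (intro card_mono) (auto simp: M_def)
  also have "\<dots> \<le> card ?P + card (\<Union>g\<in>{2..2 * T}. M g)" by (rule card_Un_le)
  also have "card (\<Union>g\<in>{2..2 * T}. M g) \<le> (\<Sum>g\<in>{2..2 * T}. card (M g))" by (rule card_UN_le) simp
  finally have "real (card ?V) \<le> real (card ?P + (\<Sum>g\<in>{2..2 * T}. card (M g)))" by (simp only: of_nat_le_iff add_le_mono1 add_left_mono)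
  then have split: "real (card ?V) \<le> real (card ?P) + (\<Sum>g\<in>{2..2 * T}. real (card (M g)))" by simp
  have M: "real (card (M g)) \<le> (real n * real T) ^ n * real T * (27 * 2 / 2 ^ n) * (1 / real g ^ 2)"
    if g: "g \<in> {2..2 * T}" for g
  proof -
    let ?J = "\<lambda>i. if i < n then {t \<in> {10000 * n * T..10000 * n * T + n * T}. t mod g = 0} else {t \<in> {T..T + T}. t mod g = 0}"
    have "M g \<subseteq> Pi\<^sub>E {..<Suc n} ?J"
    proof
      fix a assume a: "a \<in> M g"
      then have box: "a \<in> Pi\<^sub>E {..<Suc n} (\<lambda>i. if i < n then {10000 * n * T..10000 * n * T + n * T} else {T..T + T})"
        and dv: "\<And>i. i < Suc n \<Longrightarrow> a i mod g = 0"
        by (auto simp: M_def box_vectors_def dvd_eq_mod_eq_0)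
      show "a \<in> Pi\<^sub>E {..<Suc n} ?J"
      proof (rule PiE_I)
        fix i assume i: "i \<in> {..<Suc n}"
        show "a i \<in> ?J i" using PiE_mem[OF box i] dv[of i] i by auto
      qed (use box in \<open>auto simp: PiE_def extensional_def\<close>)
    qed
    then have "card (M g) \<le> card (Pi\<^sub>E {..<Suc n} ?J)" by (intro card_mono finite_PiE) auto
    also have "\<dots> = (\<Prod>i<n. card {t \<in> {10000 * n * T..10000 * n * T + n * T}. t mod g = 0}) * card {t \<in> {T..T + T}. t mod g = 0}"
      by (simp add: card_PiE)
    also have "\<dots> \<le> (\<Prod>i<n. n * T div g + 1) * (T div g + 1)"
      using g by (intro mult_mono prod_mono conjI card_residue_class_interval_le) auto
    finally have "real (card (M g)) \<le> real ((n * T div g + 1) ^ n * (T div g + 1))" by (simp only: of_nat_le_iff prod_constant card_lessThan)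
    also have "\<dots> = (real (n * T div g) + 1) ^ n * (real (T div g) + 1)" by (simp only: of_nat_mult of_nat_power of_nat_add of_nat_1)
    also have "\<dots> \<le> (real n * real T / real g * (1 + 2 / real n)) ^ n * (3 * real T / real g)"
    proof (intro mult_mono power_mono)
      have g1: "real g \<le> 2 * real T" "real g > 0" using g by auto
      have "real (n * T div g) \<le> real n * real T / real g"
        using of_nat_div_le_of_nat[of "n * T" g, where 'a = real] by simp
      moreover have one: "1 \<le> 2 * real T / real g" using g1 by simp
      moreover have "real n * real T / real g * (1 + 2 / real n) = real n * real T / real g + 2 * real T / real g"
        using n g1 by (simp add: field_simps)
      ultimately show "real (n * T div g) + 1 \<le> real n * real T / real g * (1 + 2 / real n)" by linarith
      have "real (T div g) \<le> real T / real g" using of_nat_div_le_of_nat[of T g, where 'a = real] by simp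
      moreover have "real T / real g + 2 * real T / real g = 3 * real T / real g"
        by (simp add: add_divide_distrib[symmetric])
      ultimately show "real (T div g) + 1 \<le> 3 * real T / real g"
        using one by linarith
    qed auto
    also have "\<dots> = (1 + 2 / real n) ^ n * ((real n * real T) ^ n * real T * (3 / (real g ^ n * real g)))"
      by (simp add: power_mult_distrib power_divide)
    also have "\<dots> \<le> 9 * ((real n * real T) ^ n * real T * (3 * 2 / 2 ^ n / real g ^ 2))"
    proof (intro mult_mono mult_left_mono)
      show "(1 + 2 / real n) ^ n \<le> 9" using one_plus_divide_power_le[of n 2] n by simp
      have "(2::real) ^ (n - 1) \<le> real g ^ (n - 1)" using g by (intro power_mono) auto
      then have "2 ^ (n - 1) * real g ^ 2 \<le> real g ^ (n - 1) * real g ^ 2" by (intro mult_right_mono) auto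
      also have "\<dots> = real g ^ n * real g" using n by (cases n) (simp_all add: power2_eq_square)
      finally have "3 / (real g ^ n * real g) \<le> 3 / (2 ^ (n - 1) * real g ^ 2)"
        using g by (intro divide_left_mono) auto
      also have "\<dots> = 3 * 2 / 2 ^ n / real g ^ 2" using n by (cases n) simp_all
      finally show "3 / (real g ^ n * real g) \<le> 3 * 2 / 2 ^ n / real g ^ 2" .
    qed auto
    finally show ?thesis by (simp add: mult.commute)
  qed
  have "(\<Sum>g\<in>{2..2 * T}. real (card (M g))) \<le>
      (\<Sum>g\<in>{2..2 * T}. (real n * real T) ^ n * real T * (27 * 2 / 2 ^ n) * (1 / real g ^ 2))"
    by (intro sum_mono M)
  also have "\<dots> = (real n * real T) ^ n * real T * (27 * 2 / 2 ^ n) * (\<Sum>g\<in>{2..2 * T}. 1 / real g ^ 2)"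
    by (rule sum_distrib_left[symmetric])
  also have "\<dots> \<le> (real n * real T) ^ n * real T * (1 / 2) * 1"
  proof (intro mult_mono mult_left_mono sum_inverse_squares_le)
    have "(2::real) ^ 7 \<le> 2 ^ n" using n by (intro power_increasing) auto
    then show "27 * 2 / 2 ^ n \<le> (1 / 2 :: real)" by (simp add: field_simps)
  qed (auto intro: sum_nonneg)
  finally have nonprim: "(\<Sum>g\<in>{2..2 * T}. real (card (M g))) \<le> (real n * real T) ^ n * real T / 2" by simp
  have "(real n * real T) ^ n * real T \<le> (real n * real T + 1) ^ n * (real T + 1)"
    by (intro mult_mono power_mono) auto
  also have "\<dots> = real (card ?V)"
    unfolding total by (simp only: of_nat_mult of_nat_power of_nat_add of_nat_1)
  finally show ?thesis using split nonprim by linarith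
qed

section \<open>Frequencies among the primitive vectors of the box\<close>

lemma primitive_in_dilate_box:
  fixes lo hi :: "nat \<Rightarrow> nat"
  assumes "T > 0"
  shows "primitive_in_dilate d (Pi\<^sub>E {..<d} (\<lambda>i. {real (lo i)..real (hi i)})) (real T) =
    {a \<in> primitive_vectors d. \<forall>i<d. T * lo i \<le> a i \<and> a i \<le> T * hi i}"
proof -
  let ?D = "Pi\<^sub>E {..<d} (\<lambda>i. {real (lo i)..real (hi i)})"
  have "(\<lambda>i\<in>{..<d}. real (a i)) \<in> (\<lambda>x. \<lambda>i\<in>{..<d}. real T * x i) ` ?D \<longleftrightarrow> (\<forall>i<d. T * lo i \<le> a i \<and> a i \<le> T * hi i)" for a
  proof
    assume "(\<lambda>i\<in>{..<d}. real (a i)) \<in> (\<lambda>x. \<lambda>i\<in>{..<d}. real T * x i) ` ?D"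
    then obtain x where x: "x \<in> ?D" "(\<lambda>i\<in>{..<d}. real (a i)) = (\<lambda>i\<in>{..<d}. real T * x i)" by blast
    show "\<forall>i<d. T * lo i \<le> a i \<and> a i \<le> T * hi i"
    proof (intro allI impI)
      fix i assume i: "i < d"
      have eq: "real (a i) = real T * x i" using fun_cong[OF x(2), of i] i by simp
      have "real (lo i) \<le> x i \<and> x i \<le> real (hi i)" using PiE_mem[OF x(1), of i] i by simp
      then have "real T * real (lo i) \<le> real (a i) \<and> real (a i) \<le> real T * real (hi i)"
        unfolding eq by (auto intro: mult_left_mono)
      then show "T * lo i \<le> a i \<and> a i \<le> T * hi i" by (simp only: of_nat_le_iff flip: of_nat_mult)
    qed
  next
    assume b: "\<forall>i<d. T * lo i \<le> a i \<and> a i \<le> T * hi i"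
    define x where "x = (\<lambda>i\<in>{..<d}. real (a i) / real T)"
    have "x \<in> ?D"
    proof (rule PiE_I)
      fix i assume i: "i \<in> {..<d}"
      then have "real (T * lo i) \<le> real (a i)" "real (a i) \<le> real (T * hi i)"
        using b by (simp_all only: of_nat_le_iff lessThan_iff)
      then show "x i \<in> {real (lo i)..real (hi i)}" using assms i by (simp add: x_def field_simps)
    qed (simp add: x_def)
    moreover have "(\<lambda>i\<in>{..<d}. real (a i)) = (\<lambda>i\<in>{..<d}. real T * x i)"
      using assms by (auto simp: x_def fun_eq_iff)
    ultimately show "(\<lambda>i\<in>{..<d}. real (a i)) \<in> (\<lambda>x. \<lambda>i\<in>{..<d}. real T * x i) ` ?D" by blast
  qed
  then show ?thesis unfolding primitive_in_dilate_def by simp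
qed

definition box_side_lo :: "nat \<Rightarrow> nat \<Rightarrow> nat" where
  "box_side_lo n i = (if i < n then 10000 * n else 1)"

definition box_side_hi :: "nat \<Rightarrow> nat \<Rightarrow> nat" where
  "box_side_hi n i = (if i < n then 10000 * n + n else 2)"

definition box_domain :: "nat \<Rightarrow> (nat \<Rightarrow> real) set" where
  "box_domain n = Pi\<^sub>E {..<Suc n} (\<lambda>i. {real (box_side_lo n i)..real (box_side_hi n i)})"

lemma primitive_in_dilate_box_domain:
  assumes "T > 0" "n > 0"
  shows "primitive_in_dilate (Suc n) (box_domain n) (real T) =
    {a \<in> box_vectors n T. Gcd (a ` {..<Suc n}) = 1}"
proof -
  have "a \<in> primitive_vectors (Suc n) \<and> (\<forall>i<Suc n. T * box_side_lo n i \<le> a i \<and> a i \<le> T * box_side_hi n i) \<longleftrightarrow>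
      a \<in> box_vectors n T \<and> Gcd (a ` {..<Suc n}) = 1" for a
  proof
    assume h: "a \<in> primitive_vectors (Suc n) \<and> (\<forall>i<Suc n. T * box_side_lo n i \<le> a i \<and> a i \<le> T * box_side_hi n i)"
    have "a \<in> box_vectors n T"
      unfolding box_vectors_def
    proof (rule PiE_I)
      fix i assume i: "i \<in> {..<Suc n}"
      then have b: "T * box_side_lo n i \<le> a i" "a i \<le> T * box_side_hi n i" using h by auto
      show "a i \<in> (if i < n then {10000 * n * T..10000 * n * T + n * T} else {T..T + T})"
        using b by (cases "i < n") (simp_all add: box_side_lo_def box_side_hi_def algebra_simps)
    next
      fix i assume "i \<notin> {..<Suc n}"
      then show "a i = undefined" using h by (auto simp: primitive_vectors_def PiE_def extensional_def)
    qed
    then show "a \<in> box_vectors n T \<and> Gcd (a ` {..<Suc n}) = 1" using h by (simp add: primitive_vectors_def)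
  next
    assume h: "a \<in> box_vectors n T \<and> Gcd (a ` {..<Suc n}) = 1"
    then have box: "a \<in> box_vectors n T" by blast
    note bd = box_vectors_bounds[OF box]
    have pos: "0 < a i" if "i < Suc n" for i
    proof (cases "i < n")
      case True
      have "0 < 10000 * n * T" using assms by simp
      then show ?thesis using bd(1)[OF True] by linarith
    next
      case False
      then have "i = n" using that by simp
      then show ?thesis using bd(3) assms by simp
    qed
    have ext: "a \<in> extensional {..<Suc n}" using box by (simp add: box_vectors_def PiE_def)
    have "a \<in> {..<Suc n} \<rightarrow>\<^sub>E {0<..}" using pos ext by (simp add: PiE_iff)
    then have "a \<in> primitive_vectors (Suc n)" using h by (simp add: primitive_vectors_def)
    moreover have "T * box_side_lo n i \<le> a i \<and> a i \<le> T * box_side_hi n i" if "i < Suc n" for i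
    proof (cases "i < n")
      case True
      then show ?thesis using bd(1,2)[OF True] by (simp add: box_side_lo_def box_side_hi_def algebra_simps)
    next
      case False
      then have "i = n" using that by simp
      then show ?thesis using bd(3,4) by (simp add: box_side_lo_def box_side_hi_def algebra_simps)
    qed
    ultimately show "a \<in> primitive_vectors (Suc n) \<and> (\<forall>i<Suc n. T * box_side_lo n i \<le> a i \<and> a i \<le> T * box_side_hi n i)"
      by blast
  qed
  then show ?thesis unfolding box_domain_def primitive_in_dilate_box[OF assms(1)] by blast
qed

text \<open>The first n coordinates lie between \<open>10000 * n * T\<close> and
  \<open>10001 * n * T\<close>, so replacing the largest of them by their geometric mean costs only
  the factor 1.0001, and 1.7555 times 1.0001 is less than 1.756. The last coordinate contributes at
  least \<open>root n T\<close> to the denominator, which cancels the T in the bound for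
  \<open>B\<close>.\<close>

lemma normalized_frobenius_le:
  assumes a: "a \<in> box_vectors n T" and n: "n > 0" and T: "T > 0"
    and B: "real B \<le> 1.7555 * root n (fact n * real T)" and cov: "covers n (a n) B a"
  shows "normalized_frobenius (Suc n) a \<le> 1.756 * fact n powr (1 / real n)"
proof -
  note bd = box_vectors_bounds[OF a]
  let ?P = "\<Prod>i<Suc n. real (a i)"
  have K0: "0 < 10000 * n * T" using n T by simp
  have pos: "0 < a i" if "i \<le> n" for i
  proof (cases "i < n")
    case True
    then show ?thesis using bd(1)[OF True] K0 by linarith
  next
    case False
    then have "i = n" using that by simp
    then show ?thesis using bd(3) T by simp
  qed
  have f: "frobenius_pos (Suc n) a \<le> int ((10000 * n * T + n * T) * B)"
    by (rule frobenius_pos_le[where A = "10000 * n * T + n * T"]) (use cov pos bd in auto)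
  have P0: "0 < ?P" using pos by (intro prod_pos) (auto simp: less_Suc_eq_le)
  have root_lower: "10000 * real n * real T * root n (real T) \<le> ?P powr (1 / real n)"
  proof -
    have "(10000 * real n * real T) ^ n * real T = (\<Prod>i<n. real (10000 * n * T)) * real T"
      by simp
    also have "\<dots> \<le> (\<Prod>i<n. real (a i)) * real (a n)"
      using bd by (intro mult_mono prod_mono prod_nonneg conjI) (auto simp only: of_nat_le_iff of_nat_0_le_iff lessThan_iff)
    also have "\<dots> = ?P" by simp
    finally have "root n ((10000 * real n * real T) ^ n * real T) \<le> root n ?P"
      using n by (simp only: real_root_le_iff)
    moreover have "root n ((10000 * real n * real T) ^ n * real T) = 10000 * real n * real T * root n (real T)"
      using n by (simp add: real_root_mult real_root_power_cancel)
    moreover have "root n ?P = ?P powr (1 / real n)"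
      using n P0 by (simp add: root_powr_inverse)
    ultimately show ?thesis by linarith
  qed
  have "real_of_int (frobenius_pos (Suc n) a) \<le> real ((10000 * n * T + n * T) * B)"
    using f by linarith
  also have "\<dots> = 10001 * real n * real T * real B" by (simp add: algebra_simps)
  also have "\<dots> \<le> 10001 * real n * real T * (1.7555 * root n (fact n * real T))"
    by (intro mult_left_mono B) auto
  also have "\<dots> \<le> 1.756 * (root n (fact n) * (10000 * real n * real T * root n (real T)))"
  proof -
    have "0 \<le> root n (fact n) * root n (real T) * (real n * real T)"
      using n by simp
    then show ?thesis by (simp add: real_root_mult algebra_simps)
  qed
  also have "\<dots> \<le> 1.756 * (root n (fact n) * ?P powr (1 / real n))"
    using n by (intro mult_left_mono root_lower) auto
  also have "root n (fact n) = fact n powr (1 / real n)" using n by (simp add: root_powr_inverse)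
  finally have "real_of_int (frobenius_pos (Suc n) a) \<le> 1.756 * fact n powr (1 / real n) * ?P powr (1 / real n)"
    by (simp add: mult.assoc)
  moreover have "0 < ?P powr (1 / real n)"
    by (subst powr_gt_zero) (rule less_imp_neq[OF P0, symmetric])
  ultimately show ?thesis
    unfolding normalized_frobenius_def by (simp add: pos_divide_le_eq)
qed

text \<open>The constant 36 is 9 times 2 times 2: the lift to the box costs 9, there are
  \<open>T + 1 \<le> 2 * T\<close> moduli, and the primitive vectors number at least half the
  volume.\<close>

lemma box_tail_frequency_le:
  assumes n: "n \<ge> 7" and T: "T > 0" and C: "C > 0"
    and cov: "\<And>N. T \<le> N \<Longrightarrow> N \<le> 2 * T \<Longrightarrow> \<exists>B. real B \<le> 1.7555 * root n (fact n * real T) \<and>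
      real (card {a \<in> {..<n} \<rightarrow>\<^sub>E {..<N}. \<not> covers n N B a}) \<le> C * real N ^ n"
  shows "real (card {a \<in> primitive_in_dilate (Suc n) (box_domain n) (real T).
      normalized_frobenius (Suc n) a > 1.756 * fact n powr (1 / real n)}) /
    real (card (primitive_in_dilate (Suc n) (box_domain n) (real T))) \<le> 36 * C"
proof -
  have n0: "n > 0" using n by simp
  let ?W = "(real n * real T) ^ n"
  have W: "?W > 0" using n0 T by simp
  define B where "B N = (SOME B. real B \<le> 1.7555 * root n (fact n * real T) \<and>
      real (card {a \<in> {..<n} \<rightarrow>\<^sub>E {..<N}. \<not> covers n N B a}) \<le> C * real N ^ n)" for N
  have "real (B N) \<le> 1.7555 * root n (fact n * real T) \<and>
      real (card {a \<in> {..<n} \<rightarrow>\<^sub>E {..<N}. \<not> covers n N (B N) a}) \<le> C * real N ^ n"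
    if "T \<le> N" "N \<le> 2 * T" for N
    unfolding B_def by (rule someI_ex[OF cov[OF that]])
  then have B: "\<And>N. T \<le> N \<Longrightarrow> N \<le> 2 * T \<Longrightarrow> real (B N) \<le> 1.7555 * root n (fact n * real T)"
    "\<And>N. T \<le> N \<Longrightarrow> N \<le> 2 * T \<Longrightarrow>
      real (card {a \<in> {..<n} \<rightarrow>\<^sub>E {..<N}. \<not> covers n N (B N) a}) \<le> C * real N ^ n"
    by simp_all
  define X where "X N = {a \<in> box_vectors n T. a n = N \<and> \<not> covers n N (B N) a}" for N
  let ?P = "primitive_in_dilate (Suc n) (box_domain n) (real T)"
  let ?Q = "{a \<in> ?P. normalized_frobenius (Suc n) a > 1.756 * fact n powr (1 / real n)}"
  have P: "?P = {a \<in> box_vectors n T. Gcd (a ` {..<Suc n}) = 1}"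
    by (rule primitive_in_dilate_box_domain[OF T n0])
  have "?Q \<subseteq> (\<Union>N\<in>{T..2 * T}. X N)"
  proof
    fix a assume "a \<in> ?Q"
    then have a: "a \<in> box_vectors n T" and big: "normalized_frobenius (Suc n) a > 1.756 * fact n powr (1 / real n)"
      unfolding P by auto
    have an: "T \<le> a n" "a n \<le> 2 * T" using box_vectors_bounds[OF a] by auto
    have "\<not> covers n (a n) (B (a n)) a"
      using normalized_frobenius_le[OF a n0 T B(1)[OF an]] big by linarith
    then have "a \<in> X (a n)" using a by (simp add: X_def)
    then show "a \<in> (\<Union>N\<in>{T..2 * T}. X N)" using an by auto
  qed
  then have "card ?Q \<le> card (\<Union>N\<in>{T..2 * T}. X N)" by (intro card_mono) (auto simp: X_def)
  also have "\<dots> \<le> (\<Sum>N\<in>{T..2 * T}. card (X N))" by (rule card_UN_le) simp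
  finally have "real (card ?Q) \<le> real (\<Sum>N\<in>{T..2 * T}. card (X N))" by (simp only: of_nat_le_iff)
  also have "\<dots> = (\<Sum>N\<in>{T..2 * T}. real (card (X N)))" by simp
  also have "\<dots> \<le> (\<Sum>N\<in>{T..2 * T}. C * (9 * ?W))"
  proof (rule sum_mono)
    fix N assume N: "N \<in> {T..2 * T}"
    then have N0: "0 < N" "T \<le> N" "N \<le> 2 * T" using T by auto
    have "real (card (X N)) \<le>
        real (card {a \<in> {..<n} \<rightarrow>\<^sub>E {..<N}. \<not> covers n N (B N) a}) / real N ^ n * (9 * ?W)"
      unfolding X_def by (rule card_noncovering_box_le[OF n0 N0(1,3)])
    also have "\<dots> \<le> C * (9 * ?W)"
      using B(2)[OF N0(2,3)] N0 by (intro mult_right_mono) (auto simp: pos_divide_le_eq)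
    finally show "real (card (X N)) \<le> C * (9 * ?W)" .
  qed
  also have "\<dots> = (real T + 1) * (C * (9 * ?W))" by simp
  also have "\<dots> \<le> (2 * real T) * (C * (9 * ?W))" using T C by (intro mult_right_mono) auto
  also have "\<dots> = 36 * C * (?W * real T / 2)" by simp
  finally have Q: "real (card ?Q) \<le> 36 * C * (?W * real T / 2)" .
  have den: "?W * real T / 2 \<le> real (card ?P)" unfolding P by (rule card_primitive_box_ge[OF n T])
  have den0: "0 < real (card ?P)"
  proof -
    have "0 < ?W * real T / 2" using W T by simp
    then show ?thesis using den by linarith
  qed
  have "36 * C * (?W * real T / 2) \<le> 36 * C * real (card ?P)" using den C by (intro mult_left_mono) auto
  then show ?thesis using Q den0 by (simp add: pos_divide_le_eq)
qed

section \<open>Passage to the limit and conclusion\<close>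

lemma frobenius_limit_tail_bounds:
  assumes "frobenius_limit_tail d \<psi>" "R \<ge> 0"
  shows "0 \<le> \<psi> R" "\<psi> R \<le> 1"
proof -
  have "((\<lambda>T. real (card {a \<in> primitive_in_dilate d ({..<d} \<rightarrow>\<^sub>E {0..1}) T. normalized_frobenius d a > R}) /
               real (card (primitive_in_dilate d ({..<d} \<rightarrow>\<^sub>E {0..1}) T))) \<longlongrightarrow> \<psi> R) at_top"
    using assms admissible_unit_cube[of d] unfolding frobenius_limit_tail_def by blast
  then show "0 \<le> \<psi> R" by (rule tendsto_lowerbound) auto
  have "antimono_on {0..} \<psi>" "\<psi> 0 = 1" using assms(1) by (simp_all add: frobenius_limit_tail_def)
  then show "\<psi> R \<le> 1" using monotone_onD[of "{0..}" "(\<le>)" "(\<ge>)" \<psi> 0 R] assms(2) by simp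
qed

text \<open>The frequency bound holds for fixed n and all large integers T, with a constant
  independent of n. It passes to the limit along the integers, which agrees with the limit along the
  reals.\<close>

lemma frobenius_limit_tail_exponential_bound:
  obtains C n0 where "C > 0" "n0 > 0"
    "\<And>n \<psi>. n \<ge> n0 \<Longrightarrow> frobenius_limit_tail (Suc n) \<psi> \<Longrightarrow> \<psi> (1.756 * fact n powr (1 / real n)) \<le> C * 0.999 ^ n"
proof -
  obtain C n1 where C: "C > 0" "n1 > 0" and n1: "\<And>n. n \<ge> n1 \<Longrightarrow> \<exists>T0. \<forall>T\<ge>T0. \<forall>N. T \<le> N \<and> N \<le> 2 * T \<longrightarrow>
    (\<exists>B. real B \<le> 1.7555 * root n (fact n * real T) \<and>
      real (card {a \<in> {..<n} \<rightarrow>\<^sub>E {..<N}. \<not> covers n N B a}) \<le> C * 0.999 ^ n * real N ^ n)"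
    using noncovering_exponentially_rare by blast
  show ?thesis
  proof (rule that[of "36 * C" "max n1 7"])
    show "36 * C > 0" "max n1 7 > 0" using C by auto
    fix n and \<psi> :: "real \<Rightarrow> real" assume n: "n \<ge> max n1 7" and \<psi>: "frobenius_limit_tail (Suc n) \<psi>"
    let ?R = "1.756 * fact n powr (1 / real n)"
    let ?f = "\<lambda>T. real (card {a \<in> primitive_in_dilate (Suc n) (box_domain n) T. normalized_frobenius (Suc n) a > ?R}) /
               real (card (primitive_in_dilate (Suc n) (box_domain n) T))"
    have adm: "admissible_domain (Suc n) (box_domain n)"
      unfolding box_domain_def using n
      by (intro admissible_box) (auto simp: box_side_lo_def box_side_hi_def)
    have "0 \<le> ?R" by simp
    then have "(?f \<longlongrightarrow> \<psi> ?R) at_top"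
      using \<psi> adm unfolding frobenius_limit_tail_def by blast
    then have lim: "(\<lambda>T. ?f (real T)) \<longlonglongrightarrow> \<psi> ?R"
      using filterlim_real_sequentially by (rule filterlim_compose)
    obtain T0 where T0: "\<And>T N. T \<ge> T0 \<Longrightarrow> T \<le> N \<Longrightarrow> N \<le> 2 * T \<Longrightarrow>
    \<exists>B. real B \<le> 1.7555 * root n (fact n * real T) \<and>
      real (card {a \<in> {..<n} \<rightarrow>\<^sub>E {..<N}. \<not> covers n N B a}) \<le> C * 0.999 ^ n * real N ^ n"
      using n1[of n] n by auto
    have "?f (real T) \<le> 36 * (C * 0.999 ^ n)" if T: "T \<ge> max T0 1" for T
      by (rule box_tail_frequency_le) (use n T T0[of T] C in auto)
    then have "\<psi> ?R \<le> 36 * (C * 0.999 ^ n)" using lim by (intro LIMSEQ_le_const2[OF lim]) blast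
    then show "\<psi> ?R \<le> 36 * C * 0.999 ^ n" by simp
  qed
qed

theorem theorem4:
  fixes \<Psi> :: "nat \<Rightarrow> real \<Rightarrow> real" and \<alpha> :: real
  assumes "\<And>d. d \<ge> 3 \<Longrightarrow> frobenius_limit_tail d (\<Psi> d)"
    and "\<alpha> > 1 + eta0"
  shows "((\<lambda>d. \<Psi> d (\<alpha> * fact (d - 1) powr (1 / (real d - 1)))) \<longlonglongrightarrow> 0) \<and>
         (\<exists>C c. C > 0 \<and> 0 < c \<and> c < 1 \<and>
            (\<forall>d\<ge>3. \<Psi> d (\<alpha> * fact (d - 1) powr (1 / (real d - 1))) \<le> C * c ^ d))"
proof -
  let ?R = "\<lambda>d. \<alpha> * fact (d - 1) powr (1 / (real d - 1))"
  \<comment> \<open>\<open>eta0\<close> enters through its lower bound 0.756; by monotonicity the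
    tail at \<alpha> is then controlled by the tail at 1.756.\<close>
  have \<alpha>: "1.756 \<le> \<alpha>" using assms(2) eta0_bounds(1) by simp
  have R0: "0 \<le> ?R d" for d using \<alpha> by simp
  have bounds: "0 \<le> \<Psi> d (?R d)" "\<Psi> d (?R d) \<le> 1" if "d \<ge> 3" for d
    using frobenius_limit_tail_bounds[OF assms(1)[OF that] R0] by auto
  obtain C0 n0 where C0: "C0 > 0" and n0: "n0 > 0" and tail:
    "\<And>n \<psi>. n \<ge> n0 \<Longrightarrow> frobenius_limit_tail (Suc n) \<psi> \<Longrightarrow> \<psi> (1.756 * fact n powr (1 / real n)) \<le> C0 * 0.999 ^ n"
    using frobenius_limit_tail_exponential_bound by blast
  define c where "c = (0.999 :: real)"
  \<comment> \<open>\<open>C0 / c\<close> accounts for the shift from n to \<open>d = n + 1\<close>.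
    The summand \<open>1 / c ^ n0\<close> makes the bound at least 1 for the remaining
    \<open>d \<le> n0\<close>, where the tail is at most 1.\<close>
  define C where "C = C0 / c + 1 / c ^ n0"
  have c: "0 < c" "c < 1" by (simp_all add: c_def)
  have C: "C > 0" using C0 c by (simp add: C_def add_pos_pos)
  have main: "\<Psi> d (?R d) \<le> C * c ^ d" if d: "d \<ge> 3" for d
  proof (cases "n0 \<le> d - 1")
    case True
    define n where "n = d - 1"
    have dn: "d = Suc n" using d by (simp add: n_def)
    have anti: "antimono_on {0..} (\<Psi> d)" using assms(1)[OF d] by (simp add: frobenius_limit_tail_def)
    have "1.756 * fact n powr (1 / real n) \<le> ?R d"
      unfolding dn using \<alpha> by (simp add: mult_right_mono)
    then have "\<Psi> d (?R d) \<le> \<Psi> d (1.756 * fact n powr (1 / real n))"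
      using monotone_onD[OF anti, of "1.756 * fact n powr (1 / real n)" "?R d"] R0[of d] by simp
    also have "\<dots> \<le> C0 * 0.999 ^ n"
    proof (rule tail)
      show "n0 \<le> n" using True by (simp add: n_def)
      show "frobenius_limit_tail (Suc n) (\<Psi> d)" using assms(1)[OF d] by (simp only: dn[symmetric])
    qed
    also have "\<dots> = C0 / c * c ^ d" using c by (simp add: dn c_def)
    also have "\<dots> \<le> C * c ^ d" using c by (intro mult_right_mono) (auto simp: C_def)
    finally show ?thesis .
  next
    case False
    then have dn: "d \<le> n0" by simp
    have "\<Psi> d (?R d) \<le> 1" by (rule bounds[OF d])
    also have "\<dots> = 1 / c ^ n0 * c ^ n0" using c by simp
    also have "\<dots> \<le> C * c ^ d"
      using c C0 dn by (intro mult_mono power_decreasing) (auto simp: C_def)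
    finally show ?thesis .
  qed
  have "(\<lambda>d. C * c ^ d) \<longlonglongrightarrow> C * 0" using c by (intro tendsto_mult tendsto_const LIMSEQ_realpow_zero) auto
  then have upper: "(\<lambda>d. C * c ^ d) \<longlonglongrightarrow> 0" by simp
  have "(\<lambda>d. \<Psi> d (?R d)) \<longlonglongrightarrow> 0"
  proof (rule tendsto_sandwich[OF _ _ tendsto_const upper])
    show "eventually (\<lambda>d. 0 \<le> \<Psi> d (?R d)) sequentially"
      using bounds(1) by (rule eventually_sequentiallyI)
    show "eventually (\<lambda>d. \<Psi> d (?R d) \<le> C * c ^ d) sequentially"
      using main by (rule eventually_sequentiallyI)
  qed
  then show ?thesis using main C c by blast
qed

end
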